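(* Fix $\delta\in\mathbb{R}$ and let $L^{\mathrm{pp}}$ be the point-to-point half-space last passage percolation with diagonal parameter $\frac12+\delta2^{-4/3}N^{-1/3}$. Consider the rescaled process $$u\mapsto\mathcal{L}^{\mathrm{pp}}_N(u)=\frac{L^{\mathrm{pp}}\big(N+u(2N)^{2/3},\,N-u(2N)^{2/3}\big)-4N}{2^{4/3}N^{1/3}},\qquad u\ge0.$$ Then $$\lim_{N\to\infty}\mathcal{L}^{\mathrm{pp}}_N(u)=\mathcal{A}^{\mathrm{pp}}_\delta(u)-u^2$$ in the sense of weak convergence on the space of continuous functions on compact intervals of $[0,\infty)$.
   Context: Half-space last passage percolation: given weights $\omega_{i,j}$ on $\{(i,j)\in\mathbb{Z}^2: i\ge j\ge0\}$, put $L(b)=\max_{\pi}\sum_{(i,j)\in\pi\setminus\{(0,0)\}}\omega_{i,j}$, the maximum being over up-right lattice paths in the half-space from $(0,0)$ to $b$. $\exp(a)$ is the exponential law with rate $a$. Point-to-point model $L^{\mathrm{pp}}$ with diagonal parameter $\rho$: independent weights $\omega_{0,0}=0$, $\omega_{i,i}\sim\exp(\rho)$ and $\omega_{i,0}=0$ for $i\ge1$, $\omega_{i,j}\sim\exp(1)$ for $0<j<i$. The process $u\mapsto\mathcal{L}^{\mathrm{pp}}_N(u)$ is regarded as a random continuous function by linear interpolation between the values of $u$ for which $u(2N)^{2/3}$ is an integer. Limit process (known result of Baik, Barraquand, Corwin and Suidan, which may be taken as given): for every $\delta\in\mathbb{R}$ the finite-dimensional distributions of $\mathcal{L}^{\mathrm{pp}}_N(u)$,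 $u\ge0$, converge as $N\to\infty$ to those of a process written $\mathcal{A}^{\mathrm{pp}}_\delta(u)-u^2$; this determines the law of $\mathcal{A}^{\mathrm{pp}}_\delta$ (whose joint distributions are given by Fredholm Pfaffians of an explicit crossover kernel). *)

theory Defs
  imports "HOL-Probability.Probability"
begin

section \<open>Half-space last passage percolation\<close>

definition half_space :: "(nat \<times> nat) set" where
  "half_space = {(i, j). j \<le> i}"

definition up_right_step :: "nat \<times> nat \<Rightarrow> nat \<times> nat \<Rightarrow> bool" where
  "up_right_step p q \<longleftrightarrow>
     q = (Suc (fst p), snd p) \<or> q = (fst p, Suc (snd p))"

definition half_space_paths :: "nat \<times> nat \<Rightarrow> (nat \<times> nat) list set" where
  "half_space_paths b =
     {ps. ps \<noteq> [] \<and> hd ps = (0, 0) \<and> last ps = b \<and>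
          successively up_right_step ps \<and> set ps \<subseteq> half_space}"

text \<open>Only meaningful for \<open>b \<in> half_space\<close>: then the set of paths is finite and nonempty. Up-right
  paths do not revisit a point, so summing over \<open>set ps\<close> counts every weight once.\<close>

definition lpp :: "(nat \<times> nat \<Rightarrow> real) \<Rightarrow> nat \<times> nat \<Rightarrow> real" where
  "lpp w b = Max ((\<lambda>ps. \<Sum>p \<in> set ps - {(0, 0)}. w p) ` half_space_paths b)"

text \<open>\<open>pp_weights M \<rho> w\<close>: the random variables \<open>w (i, j)\<close> on \<open>M\<close> are the weights of the
  point-to-point model with diagonal parameter \<open>\<rho>\<close>. To be used for \<open>\<rho> > 0\<close> only, since otherwise
  \<open>exponential_density \<rho>\<close> is not a probability density.\<close>

definition pp_weights :: "'a measure \<Rightarrow> real \<Rightarrow> (nat \<times> nat \<Rightarrow> 'a \<Rightarrow> real) \<Rightarrow> bool" where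
  "pp_weights M \<rho> w \<longleftrightarrow>
     prob_space M \<and>
     prob_space.indep_vars M (\<lambda>_. borel) w half_space \<and>
     (\<forall>i. \<forall>x \<in> space M. w (i, 0) x = 0) \<and>
     (\<forall>i\<ge>1. distributed M lborel (w (i, i)) (exponential_density \<rho>)) \<and>
     (\<forall>i j. 0 < j \<and> j < i \<longrightarrow> distributed M lborel (w (i, j)) (exponential_density 1))"

definition diag_param :: "real \<Rightarrow> nat \<Rightarrow> real" where
  "diag_param \<delta> N = 1/2 + \<delta> * 2 powr (-4/3) * real N powr (-1/3)"

text \<open>The rescaled passage time at the lattice point \<open>(N + k, N - k)\<close>. This point leaves the
  half-space when \<open>k > N\<close>; there the value is frozen at the one for \<open>k = N\<close>. On a fixed compact
  interval of \<open>u\<close> this only concerns finitely many \<open>N\<close>.\<close>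

definition pp_grid :: "(nat \<times> nat \<Rightarrow> real) \<Rightarrow> nat \<Rightarrow> nat \<Rightarrow> real" where
  "pp_grid w N k =
     (lpp w (N + min k N, N - min k N) - 4 * real N) / (2 powr (4/3) * real N powr (1/3))"

text \<open>The rescaled process, for \<open>u \<ge> 0\<close>: the value \<open>pp_grid w N k\<close> at the \<open>u\<close> with
  \<open>u (2N)\<^sup>2\<^sup>/\<^sup>3 = k\<close>, interpolated linearly in between.\<close>

definition pp_process :: "(nat \<times> nat \<Rightarrow> real) \<Rightarrow> nat \<Rightarrow> real \<Rightarrow> real" where
  "pp_process w N u =
     (let t = u * (2 * real N) powr (2/3); k = nat \<lfloor>t\<rfloor>
      in (1 - frac t) * pp_grid w N k + frac t * pp_grid w N (Suc k))"


section \<open>Weak convergence of random elements of a topological space\<close>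

definition borel_of :: "'s topology \<Rightarrow> 's measure" where
  "borel_of T = sigma (topspace T) {U. openin T U}"

text \<open>The random elements \<open>X n\<close> of \<open>T\<close>, defined on possibly different probability spaces \<open>M n\<close>,
  converge weakly (in distribution) to the random element \<open>Y\<close> defined on \<open>Q\<close>. Finitely many \<open>n\<close>
  are allowed to be degenerate.\<close>

definition converges_weakly ::
  "'s topology \<Rightarrow> (nat \<Rightarrow> 'a measure) \<Rightarrow> (nat \<Rightarrow> 'a \<Rightarrow> 's) \<Rightarrow> 'b measure \<Rightarrow> ('b \<Rightarrow> 's) \<Rightarrow> bool" where
  "converges_weakly T M X Q Y \<longleftrightarrow>
     (\<forall>\<^sub>F n in sequentially. prob_space (M n) \<and> X n \<in> M n \<rightarrow>\<^sub>M borel_of T) \<and>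
     prob_space Q \<and> Y \<in> Q \<rightarrow>\<^sub>M borel_of T \<and>
     (\<forall>F. continuous_map T euclideanreal F \<and> bounded (F ` topspace T) \<longrightarrow>
        (\<lambda>n. \<integral>x. F (X n x) \<partial>M n) \<longlonglongrightarrow> (\<integral>x. F (Y x) \<partial>Q))"

text \<open>Continuous functions on \<open>{a..b}\<close> with the topology of uniform convergence; the elements are
  extensional functions, so a function on the line enters through \<open>restrict\<close>.\<close>

definition C_top :: "real \<Rightarrow> real \<Rightarrow> (real \<Rightarrow> real) topology" where
  "C_top a b = mtopology_of (cfunspace (top_of_set {a..b}) euclidean_metric)"

text \<open>Weak convergence of the finite-dimensional distributions at times \<open>u \<ge> 0\<close>; for finite \<open>I\<close>,
  \<open>product_topology (\<lambda>_. euclideanreal) I\<close> is Euclidean space with coordinates indexed by \<open>I\<close>.\<close>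

definition fdd_converges ::
  "(nat \<Rightarrow> 'a measure) \<Rightarrow> (nat \<Rightarrow> 'a \<Rightarrow> real \<Rightarrow> real) \<Rightarrow> 'b measure \<Rightarrow> ('b \<Rightarrow> real \<Rightarrow> real) \<Rightarrow> bool" where
  "fdd_converges M X Q Y \<longleftrightarrow>
     (\<forall>I. finite I \<and> I \<subseteq> {0..} \<longrightarrow>
        converges_weakly (product_topology (\<lambda>_. euclideanreal) I)
          M (\<lambda>n x. restrict (X n x) I) Q (\<lambda>y. restrict (Y y) I))"

end

theory Submission
  imports Defs
begin

text \<open>Given the convergence of the finite-dimensional distributions, only tightness is needed. The
  increments of the passage time along the antidiagonal are compared with those of stationary models,
  where the weights of the bottom row are exponential with rate \<open>1 - a\<close> if those of the diagonal have
  rate \<open>a\<close>: by Burke's theorem these increments form a random walk. Adding weights to the bottom row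
  makes increments to the right larger, so the stationary model with the same diagonal rate gives an
  upper bound. For the lower bound the diagonal rate is lowered to \<open>1/2 - R N\<^sup>-\<^sup>1\<^sup>/\<^sup>3\<close>. The comparison then
  holds as soon as the maximal path visits the diagonal, and this has probability close to \<open>1\<close> for
  large \<open>R\<close>, because the exponential moments of the passage time with diagonal rate \<open>a\<close> and row rate \<open>b\<close>
  are explicit at the exponent \<open>a + b - 1\<close>.\<close>

section \<open>Deterministic comparison of passage times\<close>

text \<open>All models are scalings of one family of rate 1 exponentials, so comparisons hold path
  by path. The lower bound is the delicate one: the bottom row of the point-to-point model is 0, and
  no stationary model has a smaller one. Once a maximal path has touched the diagonal, however, the
  bottom row has no more influence. The touching is certified by explicit moments, but their
  exponent \<open>a + b - 1\<close> vanishes exactly in the stationary case. Hence an intermediate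
  model with \<open>b\<close> slightly below \<open>1 - a\<close>: its negative exponent yields a
  lower tail, while equal rates \<open>e > 1/2\<close> yield an upper tail for the paths that avoid
  the diagonal.

  The limit is known only through its finite-dimensional distributions and may have irregular paths.
  The modulus bound is therefore carried over to it on countable sets of times, which yields a
  continuous version. Weak convergence then follows by interpolation at finitely many times and
  Lipschitz test functions, without extracting subsequences.\<close>

text \<open>Only meaningful for \<open>j \<le> i\<close>.\<close>

fun passage :: "(nat \<times> nat \<Rightarrow> real) \<Rightarrow> nat \<Rightarrow> nat \<Rightarrow> real" where
  "passage w 0 j = 0"
| "passage w (Suc i) 0 = passage w i 0 + w (Suc i, 0)"
| "passage w (Suc i) (Suc j) =
     (if j < i then max (passage w i (Suc j)) (passage w (Suc i) j) else passage w (Suc i) j)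
     + w (Suc i, Suc j)"

section \<open>Paths in the half-space and the recursion for the passage time\<close>

lemma half_space_paths_le:
  assumes "ps \<in> half_space_paths q" "p \<in> set ps"
  shows "fst p + snd p \<le> fst q + snd q"
proof -
  have *: "successively up_right_step ps \<Longrightarrow> p \<in> set ps \<Longrightarrow>
      fst p + snd p \<le> fst (last ps) + snd (last ps)" for ps
  proof (induction ps rule: rev_induct)
    case (snoc r ps)
    show ?case
    proof (cases "ps = []")
      case False
      then have "successively up_right_step ps" "up_right_step (last ps) r"
        using snoc.prems by (auto simp: successively_append_iff)
      then show ?thesis
        using snoc False by (auto simp: up_right_step_def)
    qed (use snoc.prems in simp)
  qed simp
  show ?thesis
    using *[of ps] assms by (simp add: half_space_paths_def)
qed

lemma half_space_paths_origin: "half_space_paths (0, 0) = {[(0, 0)]}"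
proof (intro equalityI subsetI)
  fix ps assume ps: "ps \<in> half_space_paths (0, 0)"
  have all: "p = (0, 0)" if "p \<in> set ps" for p
    using half_space_paths_le[OF ps that] by (cases p) simp
  obtain qs where qs: "ps = (0, 0) # qs"
    using ps by (cases ps) (auto simp: half_space_paths_def)
  have "qs = []"
  proof (cases qs)
    case (Cons q rs)
    then have "up_right_step (0, 0) q"
      using ps qs by (auto simp: half_space_paths_def)
    moreover have "q = (0, 0)"
      using all[of q] qs Cons by simp
    ultimately show ?thesis
      by (simp add: up_right_step_def)
  qed
  with qs show "ps \<in> {[(0, 0)]}"
    by simp
qed (auto simp: half_space_paths_def half_space_def)

lemma half_space_paths_snoc:
  assumes "q \<in> half_space" "q \<noteq> (0, 0)"
  shows "half_space_paths q =
    (\<lambda>ps. ps @ [q]) ` (\<Union>p \<in> {p. up_right_step p q}. half_space_paths p)"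
proof (intro equalityI subsetI)
  fix ps assume ps: "ps \<in> half_space_paths q"
  then have "ps \<noteq> []" "last ps = q" "hd ps = (0, 0)"
    by (simp_all add: half_space_paths_def)
  then obtain qs where qs: "ps = qs @ [q]"
    by (cases ps rule: rev_cases) auto
  then have "qs \<noteq> []"
    using \<open>hd ps = (0, 0)\<close> assms by auto
  with ps qs have "qs \<in> half_space_paths (last qs)" "up_right_step (last qs) q"
    by (simp_all add: half_space_paths_def successively_append_iff)
  with qs show "ps \<in> (\<lambda>ps. ps @ [q]) ` (\<Union>p \<in> {p. up_right_step p q}. half_space_paths p)"
    by blast
next
  fix ps assume "ps \<in> (\<lambda>ps. ps @ [q]) ` (\<Union>p \<in> {p. up_right_step p q}. half_space_paths p)"
  then obtain p qs where "ps = qs @ [q]" "up_right_step p q" "qs \<in> half_space_paths p"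
    by blast
  then show "ps \<in> half_space_paths q"
    using assms by (simp add: half_space_paths_def successively_append_iff)
qed

definition path_sums :: "(nat \<times> nat \<Rightarrow> real) \<Rightarrow> nat \<times> nat \<Rightarrow> real set" where
  "path_sums w b = (\<lambda>ps. \<Sum>p \<in> set ps - {(0, 0)}. w p) ` half_space_paths b"

text \<open>The coordinate sum rises with each step, so the new endpoint does not occur earlier on
  the path, and a sum over \<open>set ps\<close> gains exactly one term.\<close>

lemma path_sums_snoc:
  assumes "q \<in> half_space" "q \<noteq> (0, 0)"
  shows "path_sums w q = (\<lambda>x. x + w q) ` (\<Union>p \<in> {p. up_right_step p q}. path_sums w p)"
proof -
  have "(\<Sum>p \<in> set (ps @ [q]) - {(0, 0)}. w p) = (\<Sum>p \<in> set ps - {(0, 0)}. w p) + w q"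
    if "up_right_step p q" "ps \<in> half_space_paths p" for p ps
  proof -
    have "q \<notin> set ps"
      using half_space_paths_le[OF that(2), of q] that(1) by (auto simp: up_right_step_def)
    then have "set (ps @ [q]) - {(0, 0)} = insert q (set ps - {(0, 0)})"
      using assms by auto
    with \<open>q \<notin> set ps\<close> show ?thesis
      by simp
  qed
  then show ?thesis
    unfolding path_sums_def half_space_paths_snoc[OF assms] image_image image_UN
    by (intro SUP_cong image_cong) auto
qed

lemma path_sums_outside: "b \<notin> half_space \<Longrightarrow> path_sums w b = {}"
  using last_in_set by (fastforce simp: path_sums_def half_space_paths_def)

text \<open>The three claims are proved together because \<open>Max\<close> splits over the two
  predecessors only for finite nonempty sets. At a diagonal point the left predecessor lies outside
  the half-space and contributes the empty set; this is the branch of \<open>passage\<close> without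
  a maximum.\<close>

lemma path_sums_finite_Max:
  assumes "j \<le> i"
  shows "finite (path_sums w (i, j)) \<and> path_sums w (i, j) \<noteq> {} \<and>
         Max (path_sums w (i, j)) = passage w i j"
  using assms
proof (induction "i + j" arbitrary: i j rule: less_induct)
  case less
  have steps: "{p. up_right_step p (a, b)} =
      {p. a = Suc (fst p) \<and> b = snd p} \<union> {p. a = fst p \<and> b = Suc (snd p)}" for a b
    by (auto simp: up_right_step_def)
  have Max_add: "Max ((\<lambda>x. x + c) ` S) = Max S + c" if "finite S" "S \<noteq> {}" for S and c :: real
    using that by (intro mono_Max_commute[symmetric]) (auto simp: mono_def)
  show ?case
  proof (cases i)
    case 0
    then show ?thesis
      using less.prems by (simp add: path_sums_def half_space_paths_origin)
  next
    case (Suc i')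
    note i = this
    show ?thesis
    proof (cases j)
      case 0
      have "{p. up_right_step p (i, j)} = {(i', 0)}"
        unfolding steps using i 0 by auto
      then have "path_sums w (i, j) = (\<lambda>x. x + w (i, j)) ` path_sums w (i', 0)"
        using i 0 by (subst path_sums_snoc) (auto simp: half_space_def)
      then show ?thesis
        using less.hyps[of i' 0] i 0 by (simp add: Max_add)
    next
      case (Suc j')
      have "{p. up_right_step p (i, j)} = {(i', j), (i, j')}"
        unfolding steps using i Suc by auto
      then have eq: "path_sums w (i, j) =
          (\<lambda>x. x + w (i, j)) ` (path_sums w (i', j) \<union> path_sums w (i, j'))"
        using i Suc less.prems by (subst path_sums_snoc) (auto simp: half_space_def)
      have 2: "finite (path_sums w (i, j'))" "path_sums w (i, j') \<noteq> {}"
         "Max (path_sums w (i, j')) = passage w i j'"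
        using less.hyps[of i j'] less.prems Suc by auto
      show ?thesis
      proof (cases "j \<le> i'")
        case True
        then have "finite (path_sums w (i', j))" "path_sums w (i', j) \<noteq> {}"
         "Max (path_sums w (i', j)) = passage w i' j"
          using less.hyps[of i' j] i by auto
        with 2 show ?thesis
          unfolding eq using True i Suc by (subst Max_add) (auto simp: Max_Un)
      next
        case False
        then have "path_sums w (i', j) = {}"
          by (intro path_sums_outside) (auto simp: half_space_def)
        with 2 show ?thesis
          unfolding eq using False i Suc by (simp add: Max_add)
      qed
    qed
  qed
qed

lemma lpp_eq_passage: "j \<le> i \<Longrightarrow> lpp w (i, j) = passage w i j"
  using path_sums_finite_Max[of j i w] by (simp add: lpp_def path_sums_def)

section \<open>Locality and monotonicity of the increments\<close>

lemma passage_cong: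
  assumes "\<And>a b. b \<le> a \<Longrightarrow> a \<le> i \<Longrightarrow> 0 < a \<Longrightarrow> v (a, b) = w (a, b)" "j \<le> i"
  shows "passage v i j = passage w i j"
  using assms
proof (induction w i j rule: passage.induct)
  case (3 w i j)
  have "passage v (Suc i) j = passage w (Suc i) j"
    using 3 by (cases "j < i") auto
  moreover have "passage v i (Suc j) = passage w i (Suc j)" if "j < i"
    using 3 that by auto
  ultimately show ?case
    using 3 by auto
qed auto

text \<open>The increments \<open>I\<close> along rows and \<open>J\<close> along columns obey \<open>I' = w + max 0 (I - J)\<close> and
  \<open>J' = w + max 0 (J - I)\<close>, which is increasing in the own and decreasing in the other argument.\<close>

lemma increments_compare:
  fixes L1 L2 :: "nat \<Rightarrow> nat \<Rightarrow> real"
  assumes rec1: "\<And>i j. r \<le> j \<Longrightarrow> j < i \<Longrightarrow>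
      L1 (Suc i) (Suc j) = max (L1 i (Suc j)) (L1 (Suc i) j) + w (Suc i, Suc j)"
    and rec2: "\<And>i j. r \<le> j \<Longrightarrow> j < i \<Longrightarrow>
      L2 (Suc i) (Suc j) = max (L2 i (Suc j)) (L2 (Suc i) j) + w (Suc i, Suc j)"
    and row: "\<And>i. r \<le> i \<Longrightarrow> L1 (Suc i) r - L1 i r \<le> L2 (Suc i) r - L2 i r"
    and diag: "\<And>i. r \<le> i \<Longrightarrow>
      L2 (Suc i) (Suc i) - L2 (Suc i) i \<le> L1 (Suc i) (Suc i) - L1 (Suc i) i"
  shows increments_compare_row: "r \<le> j \<Longrightarrow> j \<le> i \<Longrightarrow> L1 (Suc i) j - L1 i j \<le> L2 (Suc i) j - L2 i j"
    and increments_compare_column: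
      "r \<le> j \<Longrightarrow> j < i \<Longrightarrow> L2 i (Suc j) - L2 i j \<le> L1 i (Suc j) - L1 i j"
proof -
  have "(r \<le> j \<and> j \<le> i \<longrightarrow> L1 (Suc i) j - L1 i j \<le> L2 (Suc i) j - L2 i j) \<and>
        (r \<le> j \<and> j < i \<longrightarrow> L2 i (Suc j) - L2 i j \<le> L1 i (Suc j) - L1 i j)" for i j
  proof (induction "i + i + j + j" arbitrary: i j rule: less_induct)
    case less
    have "L1 (Suc i) j - L1 i j \<le> L2 (Suc i) j - L2 i j" if j: "r \<le> j" "j \<le> i"
    proof (cases "j = r")
      case False
      then obtain j' where j': "j = Suc j'"
        using j by (cases j) auto
      have "L1 (Suc i) j' - L1 i j' \<le> L2 (Suc i) j' - L2 i j'"
           "L2 i (Suc j') - L2 i j' \<le> L1 i (Suc j') - L1 i j'"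
        using less[of i j'] j j' False by auto
      then show ?thesis
        using rec1[of j' i] rec2[of j' i] j j' False by auto
    qed (use row j in auto)
    moreover have "L2 i (Suc j) - L2 i j \<le> L1 i (Suc j) - L1 i j" if j: "r \<le> j" "j < i"
    proof -
      obtain i' where i': "i = Suc i'"
        using j by (cases i) auto
      show ?thesis
      proof (cases "j = i'")
        case False
        have "L1 (Suc i') j - L1 i' j \<le> L2 (Suc i') j - L2 i' j"
             "L2 i' (Suc j) - L2 i' j \<le> L1 i' (Suc j) - L1 i' j"
          using less[of i' j] j i' False by auto
        then show ?thesis
          using rec1[of j i'] rec2[of j i'] j i' False by auto
      qed (use diag[of i'] j i' in auto)
    qed
    ultimately show ?case
      by blast
  qed
  then show "r \<le> j \<Longrightarrow> j \<le> i \<Longrightarrow> L1 (Suc i) j - L1 i j \<le> L2 (Suc i) j - L2 i j"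
    "r \<le> j \<Longrightarrow> j < i \<Longrightarrow> L2 i (Suc j) - L2 i j \<le> L1 i (Suc j) - L1 i j"
    by blast+
qed

text \<open>A step along the antidiagonal goes right and then down, so its increment is a horizontal
  increment minus a vertical one. The two kinds are ordered in opposite directions, so their effects
  add up in the comparison.\<close>

lemma antidiagonal_step:
  fixes L :: "nat \<Rightarrow> nat \<Rightarrow> real"
  assumes "k < n"
  shows "L (n + Suc k) (n - Suc k) - L (n + k) (n - k) =
    (L (Suc (n + k)) (n - k) - L (n + k) (n - k)) -
    (L (Suc (n + k)) (Suc (n - Suc k)) - L (Suc (n + k)) (n - Suc k))"
  using assms by (simp add: Suc_diff_Suc)

text \<open>The row \<open>r\<close> is where the induction starts: 0 for full passage times, and 1
  for paths that touch the diagonal, whose recursion takes its regular form only above row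
  1.\<close>

lemma increments_compare_antidiagonal:
  fixes L1 L2 :: "nat \<Rightarrow> nat \<Rightarrow> real"
  assumes "\<And>i j. r \<le> j \<Longrightarrow> j < i \<Longrightarrow>
      L1 (Suc i) (Suc j) = max (L1 i (Suc j)) (L1 (Suc i) j) + w (Suc i, Suc j)"
    and "\<And>i j. r \<le> j \<Longrightarrow> j < i \<Longrightarrow>
      L2 (Suc i) (Suc j) = max (L2 i (Suc j)) (L2 (Suc i) j) + w (Suc i, Suc j)"
    and "\<And>i. r \<le> i \<Longrightarrow> L1 (Suc i) r - L1 i r \<le> L2 (Suc i) r - L2 i r"
    and "\<And>i. r \<le> i \<Longrightarrow>
      L2 (Suc i) (Suc i) - L2 (Suc i) i \<le> L1 (Suc i) (Suc i) - L1 (Suc i) i"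
    and "k \<le> l" "l + r \<le> n"
  shows "L1 (n + l) (n - l) - L1 (n + k) (n - k) \<le> L2 (n + l) (n - l) - L2 (n + k) (n - k)"
  using assms(5,6)
proof (induction l rule: dec_induct)
  case (step l)
  have "L1 (Suc (n + l)) (n - l) - L1 (n + l) (n - l) \<le> L2 (Suc (n + l)) (n - l) - L2 (n + l) (n - l)"
    by (rule increments_compare_row[where w = w]) (use assms step in auto)
  moreover have "L2 (Suc (n + l)) (Suc (n - Suc l)) - L2 (Suc (n + l)) (n - Suc l)
      \<le> L1 (Suc (n + l)) (Suc (n - Suc l)) - L1 (Suc (n + l)) (n - Suc l)"
    by (rule increments_compare_column[where w = w]) (use assms step in auto)
  ultimately show ?case
    using step.IH step.prems antidiagonal_step[of l n L1] antidiagonal_step[of l n L2] by linarith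
qed simp

text \<open>A larger bottom row and a smaller diagonal both favour endpoints further away from the
  diagonal.\<close>

lemma passage_compare_antidiagonal:
  assumes bulk: "\<And>i j. 0 < j \<Longrightarrow> j < i \<Longrightarrow> v (i, j) = w (i, j)"
    and row: "\<And>i. 0 < i \<Longrightarrow> v (i, 0) \<le> w (i, 0)"
    and diag: "\<And>i. 0 < i \<Longrightarrow> w (i, i) \<le> v (i, i)"
    and "k \<le> l" "l \<le> n"
  shows "passage v (n + l) (n - l) - passage v (n + k) (n - k)
       \<le> passage w (n + l) (n - l) - passage w (n + k) (n - k)"
  by (rule increments_compare_antidiagonal[where r = 0 and w = w]) (use assms in auto)

text \<open>Maximum over the paths that visit the diagonal at some point other than the origin.\<close>

fun diagonal_passage :: "(nat \<times> nat \<Rightarrow> real) \<Rightarrow> nat \<Rightarrow> nat \<Rightarrow> real" where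
  "diagonal_passage w 0 j = 0"
| "diagonal_passage w (Suc i) 0 = 0"
| "diagonal_passage w (Suc i) (Suc j) =
     (if i \<le> j then passage w (Suc i) (Suc j)
      else (if j = 0 then diagonal_passage w i 1
            else max (diagonal_passage w i (Suc j)) (diagonal_passage w (Suc i) j))
           + w (Suc i, Suc j))"

lemma diagonal_passage_le: "0 < j \<Longrightarrow> j \<le> i \<Longrightarrow> diagonal_passage w i j \<le> passage w i j"
proof (induction w i j rule: diagonal_passage.induct)
  case (3 w i j)
  then show ?case
    by (cases "i \<le> j"; cases "j = 0") (auto simp: le_max_iff_disj)
qed auto

text \<open>A maximal path either touches the diagonal away from the origin or collects only
  off-diagonal weights, and on those \<open>w\<close> dominates \<open>v\<close>.\<close>

lemma passage_le_max_diagonal: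
  assumes "\<And>i j. j < i \<Longrightarrow> v (i, j) \<le> w (i, j)" "j \<le> i" "0 < j"
  shows "passage v i j \<le> max (diagonal_passage v i j) (passage w i j)"
proof -
  have row: "passage v i 0 \<le> passage w i 0" for i
    by (induction i) (auto intro: add_mono assms)
  show ?thesis
    using assms(2,3)
  proof (induction "i + j" arbitrary: i j rule: less_induct)
    case less
    then obtain i' j' where ij: "i = Suc i'" "j = Suc j'"
      by (metis not0_implies_Suc not_gr0 le_zero_eq)
    show ?case
    proof (cases "i' \<le> j'")
      case False
      have "passage v i' j \<le> max (diagonal_passage v i' j) (passage w i' j)"
        using less False ij by auto
      moreover have "0 < j' \<Longrightarrow> passage v i j' \<le> max (diagonal_passage v i j') (passage w i j')"
        using less False ij by auto
      moreover have "v (i, j) \<le> w (i, j)"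
        using False ij by (intro assms) auto
      ultimately show ?thesis
        using False ij row[of i] by (cases "j' = 0") (auto simp: max_def split: if_splits)
    qed (use ij in auto)
  qed
qed

text \<open>Here \<open>u\<close> serves to certify that the maximal path for \<open>v\<close> visits the diagonal. After such a
  visit the paths for \<open>v\<close> and \<open>w\<close> cross, and exchanging their tails gives the inequality.\<close>

lemma passage_compare_antidiagonal_diag:
  assumes bulk: "\<And>i j. 0 < j \<Longrightarrow> j < i \<Longrightarrow> v (i, j) = w (i, j)"
    and diag: "\<And>i. 0 < i \<Longrightarrow> w (i, i) \<le> v (i, i)"
    and u: "\<And>i j. j < i \<Longrightarrow> v (i, j) \<le> u (i, j)"
    and less: "passage u (n + m) (n - m) < passage v (n + m) (n - m)"
    and "k \<le> l" "l \<le> m" "m < n"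
  shows "passage v (n + l) (n - l) - passage v (n + k) (n - k)
       \<le> passage w (n + l) (n - l) - passage w (n + k) (n - k)"
proof -
  let ?D = "diagonal_passage v"
  have le: "?D (n + k) (n - k) \<le> passage v (n + k) (n - k)" if "k \<le> m" for k
    using that assms by (intro diagonal_passage_le) auto
  \<comment> \<open>Since \<open>u\<close> stays strictly below at this endpoint, the maximum is
    attained by the paths through the diagonal.\<close>
  have "passage v (n + m) (n - m) \<le> max (?D (n + m) (n - m)) (passage u (n + m) (n - m))"
    using assms by (intro passage_le_max_diagonal) auto
  with less have eq: "?D (n + m) (n - m) = passage v (n + m) (n - m)"
    using le[of m] by (simp add: max_def split: if_splits)
  have rec: "?D (Suc i) (Suc j) = max (?D i (Suc j)) (?D (Suc i) j) + w (Suc i, Suc j)"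
    if "1 \<le> j" "j < i" for i j
    using that bulk by auto
  \<comment> \<open>The deficit of \<open>?D\<close> against \<open>passage v\<close> is nonnegative
    and nondecreasing in \<open>k\<close>. It vanishes at \<open>k = m\<close>, hence at all earlier
    points: one certificate at the far end serves the whole range.\<close>
  have mono: "?D (n + m) (n - m) - ?D (n + k) (n - k)
      \<le> passage v (n + m) (n - m) - passage v (n + k) (n - k)" if "k \<le> m" for k
  proof (rule increments_compare_antidiagonal[where r = 1 and w = w])
    show "passage v (Suc i) (Suc i) - passage v (Suc i) i \<le> ?D (Suc i) (Suc i) - ?D (Suc i) i"
      if "1 \<le> i" for i
      using that diagonal_passage_le[of i "Suc i" v] by auto
    show "?D (Suc i) 1 - ?D i 1 \<le> passage v (Suc i) 1 - passage v i 1" if "1 \<le> i" for i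
      using that by auto
  qed (use that assms rec in auto)
  have all_eq: "?D (n + k) (n - k) = passage v (n + k) (n - k)" if "k \<le> m" for k
    using le[OF that] mono[OF that] eq by linarith
  \<comment> \<open>In row 1 a path that has touched the diagonal can only go right, so the
    increments of \<open>?D\<close> there are the bare weights, the smallest possible. The
    comparison starts from row 1 and thus holds whatever the bottom row of \<open>w\<close>
    is.\<close>
  have "?D (n + l) (n - l) - ?D (n + k) (n - k)
       \<le> passage w (n + l) (n - l) - passage w (n + k) (n - k)"
  proof (rule increments_compare_antidiagonal[where r = 1 and w = w])
    show "passage w (Suc i) (Suc i) - passage w (Suc i) i \<le> ?D (Suc i) (Suc i) - ?D (Suc i) i"
      if "1 \<le> i" for i
      using that diagonal_passage_le[of i "Suc i" v] diag[of "Suc i"] by auto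
    show "?D (Suc i) 1 - ?D i 1 \<le> passage w (Suc i) 1 - passage w i 1" if "1 \<le> i" for i
      using that bulk[of 1 "Suc i"] by auto
  qed (use assms rec in auto)
  then show ?thesis
    using all_eq[of k] all_eq[of l] assms by simp
qed

section \<open>Stationarity\<close>

lemma exponential_density_tilt:
  assumes "t < l"
  shows "exponential_density l x * exp (t * x) = l / (l - t) * exponential_density (l - t) x"
proof -
  have "exp (- x * l) * exp (t * x) = exp (- x * (l - t))"
    by (simp add: exp_add[symmetric] algebra_simps)
  with assms show ?thesis
    by (simp add: exponential_density_def mult.assoc)
qed

lemma nn_integral_exponential_density:
  assumes "0 < l"
  shows "(\<integral>\<^sup>+x. ennreal (exponential_density l x) \<partial>lborel) = 1"
proof -
  interpret prob_space "density lborel (exponential_density l)"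
    using assms by (rule prob_space_exponential_density)
  show ?thesis
    using emeasure_space_1 by (simp add: emeasure_density)
qed

lemma exponential_mgf:
  assumes X: "distributed M lborel X (exponential_density l)" and "0 < l" "t < l"
  shows "(\<integral>\<^sup>+\<omega>. ennreal (exp (t * X \<omega>)) \<partial>M) = ennreal (l / (l - t))"
proof -
  have "(\<integral>\<^sup>+\<omega>. ennreal (exp (t * X \<omega>)) \<partial>M) =
      (\<integral>\<^sup>+x. ennreal (exponential_density l x) * ennreal (exp (t * x)) \<partial>lborel)"
    by (rule distributed_nn_integral[symmetric, OF X]) simp
  also have "\<dots> = (\<integral>\<^sup>+x. ennreal (l / (l - t)) * ennreal (exponential_density (l - t) x) \<partial>lborel)"
    using assms by (intro nn_integral_cong)
      (simp add: ennreal_mult'[symmetric] ennreal_mult''[symmetric] exponential_density_tilt)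
  also have "\<dots> = ennreal (l / (l - t))"
    using assms by (simp add: nn_integral_cmult nn_integral_exponential_density)
  finally show ?thesis .
qed

lemma (in prob_space) exponential_AE_pos:
  assumes X: "distributed M lborel X (exponential_density l)" and "0 < l"
  shows "AE \<omega> in M. 0 < X \<omega>"
proof -
  have [measurable]: "X \<in> borel_measurable M"
    using distributed_measurable[OF X] by simp
  show ?thesis
    using exponential_distributedD_gt[OF X, of 0] \<open>0 < l\<close> prob_eq_1[of "{\<omega> \<in> space M. 0 < X \<omega>}"]
    by simp
qed

text \<open>Unlike \<open>indep_var\<close>, this allows random variables of different types.\<close>

definition (in prob_space) indep_pair ::
  "'b measure \<Rightarrow> ('a \<Rightarrow> 'b) \<Rightarrow> 'c measure \<Rightarrow> ('a \<Rightarrow> 'c) \<Rightarrow> bool" where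
  "indep_pair S X T Y \<longleftrightarrow> X \<in> measurable M S \<and> Y \<in> measurable M T \<and>
     distr M S X \<Otimes>\<^sub>M distr M T Y = distr M (S \<Otimes>\<^sub>M T) (\<lambda>\<omega>. (X \<omega>, Y \<omega>))"

lemma (in prob_space) indep_pair_compose:
  assumes "indep_pair S X T Y" and f: "f \<in> measurable S S'" and g: "g \<in> measurable T T'"
  shows "indep_pair S' (\<lambda>\<omega>. f (X \<omega>)) T' (\<lambda>\<omega>. g (Y \<omega>))"
proof -
  have [measurable]: "X \<in> measurable M S" "Y \<in> measurable M T"
      "f \<in> measurable S S'" "g \<in> measurable T T'"
    and eq: "distr M S X \<Otimes>\<^sub>M distr M T Y = distr M (S \<Otimes>\<^sub>M T) (\<lambda>\<omega>. (X \<omega>, Y \<omega>))"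
    using assms by (simp_all add: indep_pair_def)
  interpret X: prob_space "distr M S X"
    by (rule prob_space_distr) simp
  interpret Y: prob_space "distr M T Y"
    by (rule prob_space_distr) simp
  interpret Y': prob_space "distr (distr M T Y) T' g"
    by (rule Y.prob_space_distr) simp
  have "distr M S' (\<lambda>\<omega>. f (X \<omega>)) \<Otimes>\<^sub>M distr M T' (\<lambda>\<omega>. g (Y \<omega>)) =
      distr (distr M S X) S' f \<Otimes>\<^sub>M distr (distr M T Y) T' g"
    by (simp add: distr_distr comp_def)
  also have "\<dots> = distr (distr M S X \<Otimes>\<^sub>M distr M T Y) (S' \<Otimes>\<^sub>M T') (\<lambda>(x, y). (f x, g y))"
    by (rule pair_measure_distr) (simp_all add: Y'.sigma_finite_measure_axioms)
  also have "\<dots> = distr M (S' \<Otimes>\<^sub>M T') (\<lambda>\<omega>. (f (X \<omega>), g (Y \<omega>)))"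
    unfolding eq by (subst distr_distr) (simp_all add: comp_def)
  finally show ?thesis
    by (simp add: indep_pair_def)
qed

lemma (in prob_space) indep_var_iff_indep_pair: "indep_var S X T Y \<longleftrightarrow> indep_pair S X T Y"
  by (simp add: indep_pair_def indep_var_distribution_eq)

lemma (in prob_space) indep_pair_restrict:
  assumes "indep_vars N X I" "A \<inter> B = {}" "A \<subseteq> I" "B \<subseteq> I"
    and "f \<in> measurable (PiM A N) S" "g \<in> measurable (PiM B N) T"
  shows "indep_pair S (\<lambda>\<omega>. f (\<lambda>i\<in>A. X i \<omega>)) T (\<lambda>\<omega>. g (\<lambda>i\<in>B. X i \<omega>))"
  by (rule indep_pair_compose[OF indep_var_restrict[OF assms(1-4), unfolded indep_var_iff_indep_pair]
        assms(5,6)])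

lemma (in prob_space) indep_pair_prob:
  assumes "indep_pair S X T Y" "A \<in> sets S" "B \<in> sets T"
  shows "prob {\<omega> \<in> space M. X \<omega> \<in> A \<and> Y \<omega> \<in> B} =
    prob {\<omega> \<in> space M. X \<omega> \<in> A} * prob {\<omega> \<in> space M. Y \<omega> \<in> B}"
proof -
  have [measurable]: "X \<in> measurable M S" "Y \<in> measurable M T" "A \<in> sets S" "B \<in> sets T"
    and eq: "distr M S X \<Otimes>\<^sub>M distr M T Y = distr M (S \<Otimes>\<^sub>M T) (\<lambda>\<omega>. (X \<omega>, Y \<omega>))"
    using assms by (simp_all add: indep_pair_def)
  interpret Y: prob_space "distr M T Y"
    by (rule prob_space_distr) simp
  have "emeasure (distr M S X \<Otimes>\<^sub>M distr M T Y) (A \<times> B) =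
      emeasure (distr M S X) A * emeasure (distr M T Y) B"
    by (rule Y.emeasure_pair_measure_Times) simp_all
  then show ?thesis
    unfolding eq
    by (simp add: emeasure_distr emeasure_eq_measure vimage_def Int_def conj_ac
        ennreal_mult'[symmetric])
qed

lemma (in prob_space) indep_pair_nn_integral:
  fixes f :: "'b \<Rightarrow> ennreal" and g :: "'c \<Rightarrow> ennreal"
  assumes indep: "indep_pair S X T Y"
    and f: "f \<in> borel_measurable S" and g: "g \<in> borel_measurable T"
  shows "(\<integral>\<^sup>+\<omega>. f (X \<omega>) * g (Y \<omega>) \<partial>M) = (\<integral>\<^sup>+\<omega>. f (X \<omega>) \<partial>M) * (\<integral>\<^sup>+\<omega>. g (Y \<omega>) \<partial>M)"
proof -
  have "indep_var borel (\<lambda>\<omega>. f (X \<omega>)) borel (\<lambda>\<omega>. g (Y \<omega>))"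
    unfolding indep_var_iff_indep_pair by (rule indep_pair_compose[OF indep f g])
  moreover have "case_bool borel borel = (\<lambda>_. borel :: ennreal measure)"
    by (auto split: bool.split)
  ultimately have "indep_vars (\<lambda>_. borel)
      (case_bool (\<lambda>\<omega>. f (X \<omega>)) (\<lambda>\<omega>. g (Y \<omega>))) UNIV"
    by (simp add: indep_var_def)
  from indep_vars_nn_integral[OF _ this] show ?thesis
    by (simp add: UNIV_bool mult.commute)
qed

section \<open>Burke's theorem at a single site\<close>

lemma (in prob_space) exponential_gt_indep:
  assumes U: "distributed M lborel U (exponential_density l)" and "0 < l"
    and indep: "indep_pair borel U N W"
    and f[measurable]: "f \<in> borel_measurable N" and S[measurable]: "S \<in> sets N"
    and nonneg: "\<And>x. x \<in> S \<Longrightarrow> 0 \<le> f x"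
  shows "emeasure M {\<omega> \<in> space M. W \<omega> \<in> S \<and> f (W \<omega>) < U \<omega>} =
    (\<integral>\<^sup>+\<omega>. indicator S (W \<omega>) * ennreal (exp (- l * f (W \<omega>))) \<partial>M)"
proof -
  have [measurable]: "U \<in> borel_measurable M" "W \<in> measurable M N"
    using indep by (simp_all add: indep_pair_def)
  let ?A = "{p \<in> space (borel \<Otimes>\<^sub>M N). snd p \<in> S \<and> f (snd p) < fst p}"
  have A[measurable]: "?A \<in> sets (borel \<Otimes>\<^sub>M N)"
    by measurable
  interpret U: prob_space "distr M borel U"
    by (rule prob_space_distr) simp
  interpret W: prob_space "distr M N W"
    by (rule prob_space_distr) simp
  interpret UW: pair_prob_space "distr M borel U" "distr M N W" ..
  have "emeasure M {\<omega> \<in> space M. W \<omega> \<in> S \<and> f (W \<omega>) < U \<omega>} =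
      emeasure (distr M (borel \<Otimes>\<^sub>M N) (\<lambda>\<omega>. (U \<omega>, W \<omega>))) ?A"
    by (subst emeasure_distr)
      (auto simp: space_pair_measure intro!: arg_cong[where f = "emeasure M"]
         dest: measurable_space[OF \<open>W \<in> measurable M N\<close>])
  also have "\<dots> = emeasure (distr M borel U \<Otimes>\<^sub>M distr M N W) ?A"
    using indep by (simp add: indep_pair_def)
  \<comment> \<open>Fix the value of \<open>W\<close> and integrate out \<open>U\<close>.
    Restriction to \<open>S\<close> keeps the threshold nonnegative, which the formula for the
    exponential tail requires.\<close>
  also have "\<dots> = (\<integral>\<^sup>+x. emeasure (distr M borel U) ((\<lambda>u. (u, x)) -` ?A) \<partial>distr M N W)"
    using A by (intro UW.emeasure_pair_measure_alt2) simp
  also have "\<dots> = (\<integral>\<^sup>+x. indicator S x * ennreal (exp (- l * f x)) \<partial>distr M N W)"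
  proof (intro nn_integral_cong)
    fix x assume "x \<in> space (distr M N W)"
    then have x: "x \<in> space N"
      by simp
    show "emeasure (distr M borel U) ((\<lambda>u. (u, x)) -` ?A) = indicator S x * ennreal (exp (- l * f x))"
    proof (cases "x \<in> S")
      case True
      then have "(\<lambda>u. (u, x)) -` ?A = {u. f x < u}"
        using x by (auto simp: space_pair_measure)
      then have "emeasure (distr M borel U) ((\<lambda>u. (u, x)) -` ?A) = emeasure M {\<omega> \<in> space M. f x < U \<omega>}"
        by (simp add: emeasure_distr vimage_def Int_def conj_commute)
      then show ?thesis
        using exponential_distributedD_gt[OF U nonneg[OF True] \<open>0 < l\<close>] True
        by (simp add: emeasure_eq_measure mult.commute)
    next
      case False
      then have "(\<lambda>u. (u, x)) -` ?A = {}"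
        by auto
      then show ?thesis
        using False by simp
    qed
  qed
  also have "\<dots> = (\<integral>\<^sup>+\<omega>. indicator S (W \<omega>) * ennreal (exp (- l * f (W \<omega>))) \<partial>M)"
    by (subst nn_integral_distr) simp_all
  finally show ?thesis .
qed

text \<open>For \<open>y \<le> x\<close> the event splits according to \<open>Z\<close>. If
  \<open>Z\<close> exceeds \<open>x\<close>, both conditions hold. If \<open>Z\<close> is at most
  \<open>x\<close>, the first condition forces \<open>U - V > x - Z\<close>, so the second maximum
  is 0 and the second condition reads \<open>y < Z\<close>. The case \<open>x \<le> y\<close> is the
  same with \<open>U\<close> and \<open>V\<close> exchanged.\<close>

lemma (in prob_space) burke_tail_aux:
  assumes U: "distributed M lborel U (exponential_density c)"
    and V: "distributed M lborel V (exponential_density a)"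
    and Z: "distributed M lborel Z (exponential_density 1)"
    and rates: "0 < a" "0 < c" "a + c = 1"
    and indep: "indep_pair borel U (borel \<Otimes>\<^sub>M borel) (\<lambda>\<omega>. (V \<omega>, Z \<omega>))" "indep_pair borel V borel Z"
    and xy: "0 \<le> y" "y \<le> x"
  shows "prob {\<omega> \<in> space M. x < max 0 (U \<omega> - V \<omega>) + Z \<omega> \<and> y < max 0 (V \<omega> - U \<omega>) + Z \<omega>} =
    exp (- c * x) * exp (- a * y)"
proof -
  have [measurable]: "U \<in> borel_measurable M" "V \<in> borel_measurable M" "Z \<in> borel_measurable M"
    using distributed_measurable[OF U] distributed_measurable[OF V] distributed_measurable[OF Z]
    by simp_all
  define S :: "(real \<times> real) set" where "S = {0..} \<times> {y<..x}"
  define f :: "real \<times> real \<Rightarrow> real" where "f p = fst p + x - snd p" for p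
  have [measurable]: "S \<in> sets (borel \<Otimes>\<^sub>M borel)" "f \<in> borel_measurable (borel \<Otimes>\<^sub>M borel)"
    unfolding S_def f_def[abs_def] by measurable
  let ?B = "{\<omega> \<in> space M. (V \<omega>, Z \<omega>) \<in> S \<and> f (V \<omega>, Z \<omega>) < U \<omega>}"
  have [measurable]: "?B \<in> sets M"
    by measurable
  have "emeasure M ?B = (\<integral>\<^sup>+\<omega>. indicator S (V \<omega>, Z \<omega>) * ennreal (exp (- c * f (V \<omega>, Z \<omega>))) \<partial>M)"
    by (rule exponential_gt_indep[OF U \<open>0 < c\<close> indep(1)]) (auto simp: S_def f_def)
  also have "\<dots> = (\<integral>\<^sup>+\<omega>. ennreal (exp (- c * V \<omega>)) *
      (ennreal (exp (- c * x)) * (indicator {y<..x} (Z \<omega>) * ennreal (exp (c * Z \<omega>)))) \<partial>M)"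
  proof (rule nn_integral_cong_AE)
    have eq: "exp (- c * f (v, z)) = exp (- c * v) * (exp (- c * x) * exp (c * z))" for v z
      by (simp add: f_def exp_add[symmetric] algebra_simps)
    show "AE \<omega> in M. indicator S (V \<omega>, Z \<omega>) * ennreal (exp (- c * f (V \<omega>, Z \<omega>))) =
      ennreal (exp (- c * V \<omega>)) *
      (ennreal (exp (- c * x)) * (indicator {y<..x} (Z \<omega>) * ennreal (exp (c * Z \<omega>))))"
      using exponential_AE_pos[OF V \<open>0 < a\<close>]
    proof eventually_elim
      case (elim \<omega>)
      then show ?case
        unfolding eq by (auto simp: S_def indicator_def ennreal_mult)
    qed
  qed
  also have "\<dots> = (\<integral>\<^sup>+\<omega>. ennreal (exp (- c * V \<omega>)) \<partial>M) *
      (\<integral>\<^sup>+\<omega>. ennreal (exp (- c * x)) * (indicator {y<..x} (Z \<omega>) * ennreal (exp (c * Z \<omega>))) \<partial>M)"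
    by (rule indep_pair_nn_integral[OF indep(2)]) simp_all
  \<comment> \<open>The value is \<open>a / (a + c)\<close>, and \<open>a + c = 1\<close>.\<close>
  also have "(\<integral>\<^sup>+\<omega>. ennreal (exp (- c * V \<omega>)) \<partial>M) = ennreal a"
    using exponential_mgf[OF V \<open>0 < a\<close>, of "- c"] rates by simp
  also have "(\<integral>\<^sup>+\<omega>. ennreal (exp (- c * x)) * (indicator {y<..x} (Z \<omega>) * ennreal (exp (c * Z \<omega>))) \<partial>M) =
      (\<integral>\<^sup>+z. ennreal (exponential_density 1 z) *
         (ennreal (exp (- c * x)) * (indicator {y<..x} z * ennreal (exp (c * z)))) \<partial>lborel)"
    by (rule distributed_nn_integral[symmetric, OF Z]) simp
  also have "\<dots> = (\<integral>\<^sup>+z. ennreal (exp (- c * x) / a) *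
      (ennreal (exponential_density a z) * indicator {y<..x} z) \<partial>lborel)"
  proof (intro nn_integral_cong)
    fix z :: real
    \<comment> \<open>Tilting rate 1 by \<open>c\<close> gives rate \<open>1 - c = a\<close>, which
      is the rate of \<open>V\<close>. The truncated moment of \<open>Z\<close> thereby turns into a
      probability for \<open>V\<close>.\<close>
    have eq: "exponential_density 1 z * exp (c * z) = 1 / a * exponential_density a z"
    proof -
      have "1 - c = a"
        using rates by simp
      then show ?thesis
        using exponential_density_tilt[of c 1 z, unfolded \<open>1 - c = a\<close>] rates by simp
    qed
    have "exponential_density 1 z * (exp (- c * x) * exp (c * z)) =
        exp (- c * x) * (exponential_density 1 z * exp (c * z))"
      by (simp only: mult_ac)
    also have "\<dots> = exp (- c * x) / a * exponential_density a z"
      unfolding eq by simp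
    finally show "ennreal (exponential_density 1 z) *
         (ennreal (exp (- c * x)) * (indicator {y<..x} z * ennreal (exp (c * z)))) =
         ennreal (exp (- c * x) / a) * (ennreal (exponential_density a z) * indicator {y<..x} z)"
      using rates by (auto simp: indicator_def ennreal_mult'[symmetric] ennreal_mult''[symmetric])
  qed
  also have "\<dots> = ennreal (exp (- c * x) / a) *
      (\<integral>\<^sup>+z. ennreal (exponential_density a z) * indicator {y<..x} z \<partial>lborel)"
    by (rule nn_integral_cmult) simp
  also have "(\<integral>\<^sup>+z. ennreal (exponential_density a z) * indicator {y<..x} z \<partial>lborel) =
      (\<integral>\<^sup>+\<omega>. indicator {y<..x} (V \<omega>) \<partial>M)"
    by (rule distributed_nn_integral[OF V]) simp
  also have "\<dots> = emeasure M {\<omega> \<in> space M. V \<omega> \<in> {y<..x}}"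
  proof -
    have "(\<integral>\<^sup>+\<omega>. indicator {y<..x} (V \<omega>) \<partial>M) =
        (\<integral>\<^sup>+\<omega>. indicator {\<omega> \<in> space M. V \<omega> \<in> {y<..x}} \<omega> \<partial>M)"
      by (intro nn_integral_cong) (auto simp: indicator_def)
    then show ?thesis
      by simp
  qed
  also have "\<dots> = ennreal (exp (- a * y) - exp (- a * x))"
  proof -
    have eq: "{\<omega> \<in> space M. V \<omega> \<in> {y<..x}} = {\<omega> \<in> space M. y < V \<omega>} - {\<omega> \<in> space M. x < V \<omega>}"
      using xy by auto
    have "prob {\<omega> \<in> space M. V \<omega> \<in> {y<..x}} =
        prob {\<omega> \<in> space M. y < V \<omega>} - prob {\<omega> \<in> space M. x < V \<omega>}"
      unfolding eq by (rule finite_measure_Diff) (use xy in auto)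
    then show ?thesis
      using exponential_distributedD_gt[OF V _ \<open>0 < a\<close>] xy by (simp add: emeasure_eq_measure mult.commute)
  qed
  finally have "emeasure M ?B =
      ennreal (a * (exp (- c * x) / a * (exp (- a * y) - exp (- a * x))))"
    using rates xy by (simp add: ennreal_mult'[symmetric] ennreal_mult''[symmetric])
  then have B: "prob ?B = exp (- c * x) * (exp (- a * y) - exp (- a * x))"
    using rates xy by (simp add: emeasure_eq_measure)
  let ?A = "{\<omega> \<in> space M. x < max 0 (U \<omega> - V \<omega>) + Z \<omega> \<and> y < max 0 (V \<omega> - U \<omega>) + Z \<omega>}"
  have "prob ?A = prob ({\<omega> \<in> space M. x < Z \<omega>} \<union> ?B)"
  proof (rule finite_measure_eq_AE)
    show "AE \<omega> in M. \<omega> \<in> ?A \<longleftrightarrow> \<omega> \<in> {\<omega> \<in> space M. x < Z \<omega>} \<union> ?B"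
      using exponential_AE_pos[OF V \<open>0 < a\<close>] by eventually_elim (use xy in \<open>auto simp: S_def f_def max_def\<close>)
  qed measurable
  also have "\<dots> = prob {\<omega> \<in> space M. x < Z \<omega>} + prob ?B"
    by (rule finite_measure_Union) (auto simp: S_def)
  also have "prob {\<omega> \<in> space M. x < Z \<omega>} = exp (- c * x) * exp (- a * x)"
  proof -
    have "- c * x + - a * x = - ((a + c) * x)"
      by (simp add: algebra_simps)
    then have "exp (- c * x) * exp (- a * x) = exp (- x)"
      unfolding exp_add[symmetric] rates(3) by simp
    then show ?thesis
      using exponential_distributedD_gt[OF Z, of x] xy by simp
  qed
  finally show ?thesis
    using B by (simp add: algebra_simps)
qed

lemma (in prob_space) burke_tail:
  fixes X :: "'i \<Rightarrow> 'a \<Rightarrow> real"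
  assumes indep: "indep_vars (\<lambda>_. borel) X {p, q, r}" and distinct: "distinct [p, q, r]"
    and X: "distributed M lborel (X p) (exponential_density a)"
      "distributed M lborel (X q) (exponential_density c)"
      "distributed M lborel (X r) (exponential_density 1)"
    and rates: "0 < a" "0 < c" "a + c = 1"
    and xy: "0 \<le> x" "0 \<le> y"
  shows "prob {\<omega> \<in> space M. x < max 0 (X q \<omega> - X p \<omega>) + X r \<omega> \<and>
      y < max 0 (X p \<omega> - X q \<omega>) + X r \<omega>} = exp (- c * x) * exp (- a * y)"
proof -
  have triple: "indep_pair borel (X i) (borel \<Otimes>\<^sub>M borel) (\<lambda>\<omega>. (X j \<omega>, X k \<omega>))"
    and pair: "indep_pair borel (X j) borel (X k)"
    if "distinct [i, j, k]" "{i, j, k} = {p, q, r}" for i j k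
  proof -
    show "indep_pair borel (X i) (borel \<Otimes>\<^sub>M borel) (\<lambda>\<omega>. (X j \<omega>, X k \<omega>))"
      using indep_pair_restrict[OF indep, of "{i}" "{j, k}" "\<lambda>v. v i" borel "\<lambda>v. (v j, v k)" "borel \<Otimes>\<^sub>M borel"]
        that by auto
    show "indep_pair borel (X j) borel (X k)"
      using indep_pair_restrict[OF indep, of "{j}" "{k}" "\<lambda>v. v j" borel "\<lambda>v. v k" borel] that by auto
  qed
  show ?thesis
  proof (cases "y \<le> x")
    case True
    then show ?thesis
      using xy distinct by (intro burke_tail_aux X rates triple pair) auto
  next
    case False
    have "prob {\<omega> \<in> space M. y < max 0 (X p \<omega> - X q \<omega>) + X r \<omega> \<and>
        x < max 0 (X q \<omega> - X p \<omega>) + X r \<omega>} = exp (- a * y) * exp (- c * x)"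
      using False xy distinct rates by (intro burke_tail_aux X triple pair) auto
    then show ?thesis
      by (simp add: conj_commute mult.commute)
  qed
qed

text \<open>The outgoing pair is a function of the three variables that it replaces, hence
  independent of all others; the product form of its joint tail gives the two laws and the
  independence within the pair. Old and new variables live in one indexed family, so that the lemma
  can be iterated.\<close>

lemma (in prob_space) burke_flip:
  fixes X :: "'i \<Rightarrow> 'a \<Rightarrow> real"
  assumes fin: "finite S" and indep: "indep_vars (\<lambda>_. borel) X S"
    and S: "{p, q, r} \<subseteq> S" and distinct: "distinct [p, q, r]" "p' \<noteq> q'"
    and new: "p' \<notin> S - {p, q, r}" "q' \<notin> S - {p, q, r}"
    and X: "distributed M lborel (X p) (exponential_density a)"
      "distributed M lborel (X q) (exponential_density c)"
      "distributed M lborel (X r) (exponential_density 1)"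
    and rates: "0 < a" "0 < c" "a + c = 1"
    and p': "\<And>\<omega>. X p' \<omega> = max 0 (X p \<omega> - X q \<omega>) + X r \<omega>"
    and q': "\<And>\<omega>. X q' \<omega> = max 0 (X q \<omega> - X p \<omega>) + X r \<omega>"
  shows "indep_vars (\<lambda>_. borel) X (insert p' (insert q' (S - {p, q, r})))"
    and "distributed M lborel (X p') (exponential_density a)"
    and "distributed M lborel (X q') (exponential_density c)"
proof -
  define T where "T = S - {p, q, r}"
  have rv: "X i \<in> borel_measurable M" if "i \<in> S" for i
    using indep that by (auto simp: indep_vars_def)
  have [measurable]: "X p \<in> borel_measurable M" "X q \<in> borel_measurable M" "X r \<in> borel_measurable M"
    using S by (auto intro: rv)
  have [measurable]: "X p' \<in> borel_measurable M" "X q' \<in> borel_measurable M"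
    unfolding p'[abs_def] q'[abs_def] by measurable
  have pos: "AE \<omega> in M. 0 < X p' \<omega> \<and> 0 < X q' \<omega>"
    using exponential_AE_pos[OF X(3)] by (auto simp: p' q')
  have tail: "prob {\<omega> \<in> space M. x < X q' \<omega> \<and> y < X p' \<omega>} = exp (- c * x) * exp (- a * y)"
    if "0 \<le> x" "0 \<le> y" for x y
    unfolding p' q' using that S
    by (intro burke_tail[OF indep_vars_subset[OF indep]] X rates distinct) auto
  have tail_q: "prob {\<omega> \<in> space M. x < X q' \<omega>} = exp (- c * x)" if "0 \<le> x" for x
  proof -
    have "prob {\<omega> \<in> space M. x < X q' \<omega>} = prob {\<omega> \<in> space M. x < X q' \<omega> \<and> 0 < X p' \<omega>}"
      by (rule finite_measure_eq_AE) (use pos in auto)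
    then show ?thesis
      using tail[OF that, of 0] by simp
  qed
  have tail_p: "prob {\<omega> \<in> space M. y < X p' \<omega>} = exp (- a * y)" if "0 \<le> y" for y
  proof -
    have "prob {\<omega> \<in> space M. y < X p' \<omega>} = prob {\<omega> \<in> space M. 0 < X q' \<omega> \<and> y < X p' \<omega>}"
      by (rule finite_measure_eq_AE) (use pos in auto)
    then show ?thesis
      using tail[OF _ that, of 0] by simp
  qed
  have exponential: "distributed M lborel Y (exponential_density l)"
    if [measurable]: "Y \<in> borel_measurable M" and "0 < l"
      and Y: "\<And>y. 0 \<le> y \<Longrightarrow> prob {\<omega> \<in> space M. y < Y \<omega>} = exp (- l * y)" for Y l
    unfolding exponential_distributed_iff[OF \<open>0 < l\<close>]
  proof (intro conjI allI impI)
    fix y :: real assume "0 \<le> y"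
    have "{\<omega> \<in> space M. Y \<omega> \<le> y} = space M - {\<omega> \<in> space M. y < Y \<omega>}"
      by auto
    then show "prob {\<omega> \<in> space M. Y \<omega> \<le> y} = 1 - exp (- y * l)"
      using Y[OF \<open>0 \<le> y\<close>] by (simp add: prob_compl mult.commute)
  qed fact
  show "distributed M lborel (X p') (exponential_density a)"
    using rates by (intro exponential tail_p) auto
  show "distributed M lborel (X q') (exponential_density c)"
    using rates by (intro exponential tail_q) auto

  \<comment> \<open>Half-lines are a generator stable under intersection. \<open>UNIV\<close> is
    included because the criterion for independence asks for the whole space among the
    generators.\<close>
  let ?E = "insert UNIV (range greaterThan) :: real set set"
  \<comment> \<open>The tail formula covers nonnegative thresholds only. As the new variables are
    almost surely positive, every generator acts on them like a half-line with nonnegative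
    endpoint.\<close>
  have E_tail: "\<exists>x\<ge>0. \<forall>t>0. t \<in> A \<longleftrightarrow> x < t" if "A \<in> ?E" for A
  proof (cases "A = UNIV")
    case False
    with that obtain x where "A = {x<..}"
      by auto
    then show ?thesis
      by (intro exI[of _ "max x 0"]) auto
  qed (auto intro: exI[of _ 0])
  have E_borel: "A \<in> sets borel" if "A \<in> ?E" for A
    using that by auto
  have pair: "prob {\<omega> \<in> space M. (X q' \<omega>, X p' \<omega>) \<in> A \<times> B} =
      prob (X q' -` A \<inter> space M) * prob (X p' -` B \<inter> space M)" if AB: "A \<in> ?E" "B \<in> ?E" for A B
  proof -
    note [measurable] = E_borel[OF AB(1)] E_borel[OF AB(2)]
    obtain x where x: "0 \<le> x" "\<And>t. 0 < t \<Longrightarrow> t \<in> A \<longleftrightarrow> x < t"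
      using E_tail[OF AB(1)] by blast
    obtain y where y: "0 \<le> y" "\<And>t. 0 < t \<Longrightarrow> t \<in> B \<longleftrightarrow> y < t"
      using E_tail[OF AB(2)] by blast
    have "prob {\<omega> \<in> space M. (X q' \<omega>, X p' \<omega>) \<in> A \<times> B} =
        prob {\<omega> \<in> space M. x < X q' \<omega> \<and> y < X p' \<omega>}"
      by (rule finite_measure_eq_AE[OF AE_mp[OF pos AE_I2]]) (use x y in auto)
    moreover have "prob (X q' -` A \<inter> space M) = prob {\<omega> \<in> space M. x < X q' \<omega>}"
      by (rule finite_measure_eq_AE[OF AE_mp[OF pos AE_I2]]) (use x y in auto)
    moreover have "prob (X p' -` B \<inter> space M) = prob {\<omega> \<in> space M. y < X p' \<omega>}"
      by (rule finite_measure_eq_AE[OF AE_mp[OF pos AE_I2]]) (use x y in auto)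
    ultimately show ?thesis
      using tail[OF x(1) y(1)] tail_q[OF x(1)] tail_p[OF y(1)] by simp
  qed
  have groups: "indep_pair (borel \<Otimes>\<^sub>M borel) (\<lambda>\<omega>. (X q' \<omega>, X p' \<omega>)) (PiM T (\<lambda>_. borel)) (\<lambda>\<omega>. \<lambda>i\<in>T. X i \<omega>)"
    using indep_pair_restrict[OF indep, of "{p, q, r}" T
        "\<lambda>v. (max 0 (v q - v p) + v r, max 0 (v p - v q) + v r)" "borel \<Otimes>\<^sub>M borel" "\<lambda>v. v"] S
    by (auto simp: p' q' T_def)
  show "indep_vars (\<lambda>_. borel) X (insert p' (insert q' (S - {p, q, r})))"
    unfolding T_def[symmetric]
  proof (subst indep_vars_finite[where E = "\<lambda>_. ?E"])
    show "sets borel = sigma_sets (space borel) ?E"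
    proof -
      have "sets (borel :: real measure) = sigma_sets UNIV (range greaterThan)"
        by (simp add: borel_Ioi)
      also have "\<dots> = sigma_sets UNIV ?E"
        by (intro equalityI sigma_sets_mono) (auto intro: sigma_sets.Basic sigma_sets_top)
      finally show ?thesis
        by simp
    qed
    have "{x<..} \<inter> {y<..} = {max x y<..}" for x y :: real
      by auto
    then show "Int_stable ?E"
      by (auto simp: Int_stable_def)
    show "random_variable borel (X i)" if "i \<in> insert p' (insert q' T)" for i
      using that rv by (auto simp: T_def)
    show "\<forall>A\<in>insert p' (insert q' T) \<rightarrow> ?E. prob (\<Inter>j\<in>insert p' (insert q' T). X j -` A j \<inter> space M) =
       (\<Prod>j\<in>insert p' (insert q' T). prob (X j -` A j \<inter> space M))"
    proof
      fix A assume A: "A \<in> insert p' (insert q' T) \<rightarrow> ?E"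
      have AE: "A i \<in> ?E" if "i \<in> insert p' (insert q' T)" for i
        using A that by blast
      then have A_borel: "A i \<in> sets borel" if "i \<in> insert p' (insert q' T)" for i
        using that by (intro E_borel) blast
      have finT: "finite T"
        using fin by (simp add: T_def)
      have box: "PiE T A \<in> sets (PiM T (\<lambda>_. borel))"
        by (intro sets_PiM_I_finite finT A_borel) simp
      have "(\<Inter>j\<in>insert p' (insert q' T). X j -` A j \<inter> space M) =
          {\<omega> \<in> space M. (X q' \<omega>, X p' \<omega>) \<in> A q' \<times> A p' \<and> (\<lambda>i\<in>T. X i \<omega>) \<in> PiE T A}"
        by auto
      also have "prob \<dots> = prob {\<omega> \<in> space M. (X q' \<omega>, X p' \<omega>) \<in> A q' \<times> A p'} *
          prob {\<omega> \<in> space M. (\<lambda>i\<in>T. X i \<omega>) \<in> PiE T A}"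
        by (intro indep_pair_prob[OF groups] box pair_measureI A_borel) simp_all
      also have "prob {\<omega> \<in> space M. (\<lambda>i\<in>T. X i \<omega>) \<in> PiE T A} = (\<Prod>j\<in>T. prob (X j -` A j \<inter> space M))"
      \<comment> \<open>For empty \<open>T\<close> the intersection over \<open>T\<close> would be
        the universe instead of the sample space.\<close>
      proof (cases "T = {}")
        case False
        have "prob (\<Inter>j\<in>T. X j -` A j \<inter> space M) = (\<Prod>j\<in>T. prob (X j -` A j \<inter> space M))"
          by (intro indep_varsD[OF indep False finT] A_borel) (auto simp: T_def)
        moreover have "{\<omega> \<in> space M. (\<lambda>i\<in>T. X i \<omega>) \<in> PiE T A} = (\<Inter>j\<in>T. X j -` A j \<inter> space M)"
          using False by auto
        ultimately show ?thesis
          by simp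
      qed (simp add: prob_space restrict_def)
      also have "prob {\<omega> \<in> space M. (X q' \<omega>, X p' \<omega>) \<in> A q' \<times> A p'} =
          prob (X q' -` A q' \<inter> space M) * prob (X p' -` A p' \<inter> space M)"
        by (intro pair AE) simp_all
      finally show "prob (\<Inter>j\<in>insert p' (insert q' T). X j -` A j \<inter> space M) =
          (\<Prod>j\<in>insert p' (insert q' T). prob (X j -` A j \<inter> space M))"
        using new distinct finT by (simp add: T_def mult_ac)
    qed
  qed (use fin in \<open>auto simp: T_def\<close>)
qed

section \<open>Independence of the increments along down-right paths\<close>

lemma (in prob_space) indep_vars_reindex:
  assumes X: "indep_vars N X (f ` I)" and "inj_on f I"
  shows "indep_vars (\<lambda>i. N (f i)) (\<lambda>i. X (f i)) I"
proof -
  have "disjoint_family_on (\<lambda>i. {f i}) I"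
    using \<open>inj_on f I\<close> by (auto simp: disjoint_family_on_def inj_on_def)
  then have "indep_vars (\<lambda>i. PiM {f i} N) (\<lambda>i \<omega>. \<lambda>k\<in>{f i}. X k \<omega>) I"
    by (intro indep_vars_restrict[OF X]) auto
  then have "indep_vars (\<lambda>i. N (f i)) (\<lambda>i \<omega>. (\<lambda>k\<in>{f i}. X k \<omega>) (f i)) I"
    by (rule indep_vars_compose2) (auto intro: measurable_component_singleton)
  then show ?thesis
    by simp
qed

text \<open>\<open>Row i j\<close> and \<open>Col i j\<close> are the horizontal and vertical edges ending at \<open>(i, j)\<close>.\<close>

datatype edge = Row nat nat | Col nat nat | Site nat nat

fun edge_var :: "(nat \<times> nat \<Rightarrow> 'a \<Rightarrow> real) \<Rightarrow> edge \<Rightarrow> 'a \<Rightarrow> real" where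
  "edge_var v (Row i j) \<omega> = passage (\<lambda>p. v p \<omega>) i j - passage (\<lambda>p. v p \<omega>) (i - 1) j"
| "edge_var v (Col i j) \<omega> = passage (\<lambda>p. v p \<omega>) i j - passage (\<lambda>p. v p \<omega>) i (j - 1)"
| "edge_var v (Site i j) \<omega> = v (i, j) \<omega>"

fun edge_rate :: "real \<Rightarrow> real \<Rightarrow> edge \<Rightarrow> real" where
  "edge_rate a c (Row i j) = c"
| "edge_rate a c (Col i j) = a"
| "edge_rate a c (Site i j) = 1"

text \<open>The variables that remain after the sites in \<open>U\<close> have been processed: the edges on the outer
  boundary of \<open>U\<close> and the weights of the other sites. The sites on the diagonal are not processed,
  as their weights are themselves increments along vertical edges.\<close>

fun live_edge :: "nat \<Rightarrow> (nat \<times> nat) set \<Rightarrow> edge \<Rightarrow> bool" where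
  "live_edge n U (Row i j) \<longleftrightarrow> j < i \<and> i \<le> n \<and> ((i, j) \<in> U \<or> j = 0) \<and> (i, Suc j) \<notin> U"
| "live_edge n U (Col i j) \<longleftrightarrow> 0 < j \<and> j \<le> i \<and> i \<le> n \<and> ((i, j) \<in> U \<or> i = j) \<and> (Suc i, j) \<notin> U"
| "live_edge n U (Site i j) \<longleftrightarrow> 0 < j \<and> j < i \<and> i \<le> n \<and> (i, j) \<notin> U"

text \<open>The side conditions stop the closure at the diagonal and at the bottom row, whose
  weights serve as boundary edges from the beginning.\<close>

definition order_ideal :: "nat \<Rightarrow> (nat \<times> nat) set \<Rightarrow> bool" where
  "order_ideal n U \<longleftrightarrow> U \<subseteq> {(i, j). 0 < j \<and> j < i \<and> i \<le> n} \<and>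
     (\<forall>i j. (Suc i, j) \<in> U \<longrightarrow> j < i \<longrightarrow> (i, j) \<in> U) \<and>
     (\<forall>i j. (i, Suc j) \<in> U \<longrightarrow> 0 < j \<longrightarrow> (i, j) \<in> U)"

lemma order_idealD:
  assumes "order_ideal n U"
  shows order_ideal_mem: "(i, j) \<in> U \<Longrightarrow> 0 < j \<and> j < i \<and> i \<le> n"
    and order_ideal_left: "(Suc i, j) \<in> U \<Longrightarrow> j < i \<Longrightarrow> (i, j) \<in> U"
    and order_ideal_below: "(i, Suc j) \<in> U \<Longrightarrow> 0 < j \<Longrightarrow> (i, j) \<in> U"
  using assms unfolding order_ideal_def by blast+

lemma order_ideal_finite: "order_ideal n U \<Longrightarrow> finite U"
  by (rule finite_subset[of _ "{..n} \<times> {..n}"]) (auto dest: order_ideal_mem)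

lemma live_edge_finite: "finite {e. live_edge n U e}"
proof (rule finite_subset)
  show "{e. live_edge n U e} \<subseteq> (\<lambda>(i, j). Row i j) ` ({..n} \<times> {..n}) \<union>
      (\<lambda>(i, j). Col i j) ` ({..n} \<times> {..n}) \<union> (\<lambda>(i, j). Site i j) ` ({..n} \<times> {..n})"
  proof
    fix e assume "e \<in> {e. live_edge n U e}"
    then show "e \<in> (\<lambda>(i, j). Row i j) ` ({..n} \<times> {..n}) \<union>
      (\<lambda>(i, j). Col i j) ` ({..n} \<times> {..n}) \<union> (\<lambda>(i, j). Site i j) ` ({..n} \<times> {..n})"
      by (cases e) (auto simp: image_iff)
  qed
qed auto

text \<open>The combinatorial side of one Burke step, on the unit square with upper right corner
  \<open>(Suc i, Suc j)\<close>: its left and lower edges and the weight of the corner are exchanged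
  for its right and upper edges. Maximality of the corner in \<open>U\<close> guarantees that the
  new edges have not been used up already.\<close>

lemma live_edge_insert:
  assumes U: "order_ideal n U" and x: "(Suc i, Suc j) \<in> U"
    and "(Suc (Suc i), Suc j) \<notin> U" "(Suc i, Suc (Suc j)) \<notin> U"
  shows "order_ideal n (U - {(Suc i, Suc j)})"
    and "{e. live_edge n U e} = insert (Col (Suc i) (Suc j)) (insert (Row (Suc i) (Suc j))
      ({e. live_edge n (U - {(Suc i, Suc j)}) e} - {Col i (Suc j), Row (Suc i) j, Site (Suc i) (Suc j)}))"
    and "{Col i (Suc j), Row (Suc i) j, Site (Suc i) (Suc j)} \<subseteq> {e. live_edge n (U - {(Suc i, Suc j)}) e}"
    and "\<not> live_edge n (U - {(Suc i, Suc j)}) (Col (Suc i) (Suc j))"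
    and "\<not> live_edge n (U - {(Suc i, Suc j)}) (Row (Suc i) (Suc j))"
proof -
  have ij: "j < i" "Suc i \<le> n"
    using order_ideal_mem[OF U x] by auto
  have left: "Suc j < i \<Longrightarrow> (i, Suc j) \<in> U" and below: "0 < j \<Longrightarrow> (Suc i, j) \<in> U"
    using order_ideal_left[OF U x] order_ideal_below[OF U x] by auto
  show "order_ideal n (U - {(Suc i, Suc j)})"
    using U assms(3,4) unfolding order_ideal_def by blast
  show "{e. live_edge n U e} = insert (Col (Suc i) (Suc j)) (insert (Row (Suc i) (Suc j))
      ({e. live_edge n (U - {(Suc i, Suc j)}) e} - {Col i (Suc j), Row (Suc i) j, Site (Suc i) (Suc j)}))"
  proof (rule set_eqI)
    fix e
    show "e \<in> {e. live_edge n U e} \<longleftrightarrow> e \<in> insert (Col (Suc i) (Suc j)) (insert (Row (Suc i) (Suc j))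
      ({e. live_edge n (U - {(Suc i, Suc j)}) e} - {Col i (Suc j), Row (Suc i) j, Site (Suc i) (Suc j)}))"
      using ij x assms(3,4) by (cases e) auto
  qed
  show "{Col i (Suc j), Row (Suc i) j, Site (Suc i) (Suc j)} \<subseteq> {e. live_edge n (U - {(Suc i, Suc j)}) e}"
    using ij x left below by (cases "Suc j < i"; cases "0 < j") auto
  show "\<not> live_edge n (U - {(Suc i, Suc j)}) (Col (Suc i) (Suc j))"
    "\<not> live_edge n (U - {(Suc i, Suc j)}) (Row (Suc i) (Suc j))"
    using ij by auto
qed

definition sites :: "nat \<Rightarrow> (nat \<times> nat) set" where
  "sites n = {(i, j). j \<le> i \<and> 0 < i \<and> i \<le> n}"

lemma finite_sites: "finite (sites n)"
  by (rule finite_subset[of _ "{..n} \<times> {..n}"]) (auto simp: sites_def)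

definition site_rate :: "real \<Rightarrow> real \<Rightarrow> nat \<times> nat \<Rightarrow> real" where
  "site_rate a c p = (if snd p = 0 then c else if snd p = fst p then a else 1)"

definition exponential_weights :: "'a measure \<Rightarrow> real \<Rightarrow> real \<Rightarrow> nat \<Rightarrow> (nat \<times> nat \<Rightarrow> 'a \<Rightarrow> real) \<Rightarrow> bool" where
  "exponential_weights M a c n v \<longleftrightarrow>
     prob_space.indep_vars M (\<lambda>_. borel) v (sites n) \<and>
     (\<forall>p \<in> sites n. distributed M lborel (v p) (exponential_density (site_rate a c p)))"

text \<open>Induction on the number of processed sites, removing a maximal one. A diagonal point is
  entered only from below, so its weight is itself a vertical increment. This is why rate
  \<open>a\<close> on the diagonal matches rate \<open>a\<close> on all vertical edges and the
  half-space model is stationary.\<close>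

lemma (in prob_space) live_edge_indep:
  assumes v: "exponential_weights M a c n v" and rates: "0 < a" "0 < c" "a + c = 1"
    and U: "order_ideal n U"
  shows "indep_vars (\<lambda>_. borel) (edge_var v) {e. live_edge n U e} \<and>
    (\<forall>e. live_edge n U e \<longrightarrow> distributed M lborel (edge_var v e) (exponential_density (edge_rate a c e)))"
  using U
proof (induction "card U" arbitrary: U)
  case 0
  then have "U = {}"
    using order_ideal_finite by auto
  define f where "f e = (case e of Row i j \<Rightarrow> (i, j) | Col i j \<Rightarrow> (i, j) | Site i j \<Rightarrow> (i, j))" for e
  have eq: "edge_var v e \<omega> = v (f e) \<omega>" if "live_edge n {} e" for e \<omega>
    using that
  proof (cases e)
    case (Row i j)
    with that obtain i' where "i = Suc i'"
      by (cases i) auto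
    with Row that show ?thesis
      by (auto simp: f_def)
  next
    case (Col i j)
    with that obtain i' where "i = Suc i'"
      by (cases i) auto
    with Col that show ?thesis
      by (auto simp: f_def)
  qed (auto simp: f_def)
  have inj: "inj_on f {e. live_edge n {} e}"
    by (auto simp: inj_on_def f_def split: edge.splits)
  have sub: "f ` {e. live_edge n {} e} \<subseteq> sites n"
    by (auto simp: f_def sites_def split: edge.splits)
  have "indep_vars (\<lambda>_. borel) v (sites n)"
    using v by (simp add: exponential_weights_def)
  then have "indep_vars (\<lambda>_. borel) (\<lambda>e. v (f e)) {e. live_edge n {} e}"
    by (intro indep_vars_reindex[OF indep_vars_subset[OF _ sub] inj])
  then have "indep_vars (\<lambda>_. borel) (edge_var v) {e. live_edge n {} e}"
    by (rule indep_vars_cong[THEN iffD1, rotated -1]) (auto simp: eq fun_eq_iff)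
  moreover have "distributed M lborel (edge_var v e) (exponential_density (edge_rate a c e))"
    if "live_edge n {} e" for e
  proof -
    have "edge_var v e = v (f e)"
      using eq[OF that] by auto
    moreover have "f e \<in> sites n" "site_rate a c (f e) = edge_rate a c e"
      using that by (cases e; auto simp: f_def sites_def site_rate_def)+
    ultimately show ?thesis
      using v by (auto simp: exponential_weights_def)
  qed
  ultimately show ?case
    using \<open>U = {}\<close> by simp
next
  case (Suc k)
  have fin: "finite U" and "U \<noteq> {}"
    using Suc order_ideal_finite by auto
  \<comment> \<open>A site of maximal coordinate sum has neither its right nor its upper neighbour
    in \<open>U\<close>.\<close>
  then obtain p where p: "p \<in> U" "\<And>q. q \<in> U \<Longrightarrow> fst q + snd q \<le> fst p + snd p"
    using Max_in[of "(\<lambda>q. fst q + snd q) ` U"] Max_ge[of "(\<lambda>q. fst q + snd q) ` U"] by fastforce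
  moreover have "0 < snd p \<and> snd p < fst p"
    using p(1) order_ideal_mem[OF Suc.prems, of "fst p" "snd p"] by auto
  ultimately obtain i j where ij: "p = (Suc i, Suc j)" "j < i"
    by (cases p) (metis Suc_less_eq fst_conv less_imp_Suc_add snd_conv)
  have max: "(Suc (Suc i), Suc j) \<notin> U" "(Suc i, Suc (Suc j)) \<notin> U"
    using p(2)[of "(Suc (Suc i), Suc j)"] p(2)[of "(Suc i, Suc (Suc j))"] ij by auto
  have mem: "(Suc i, Suc j) \<in> U"
    using p ij by simp
  let ?U = "U - {(Suc i, Suc j)}"
  note front = live_edge_insert[OF Suc.prems mem max]
  have "card ?U = k"
    using Suc.hyps(2) mem fin by simp
  then have IH: "indep_vars (\<lambda>_. borel) (edge_var v) {e. live_edge n ?U e}"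
      "\<And>e. live_edge n ?U e \<Longrightarrow> distributed M lborel (edge_var v e) (exponential_density (edge_rate a c e))"
    using Suc.hyps(1)[OF _ front(1)] by auto
  have new: "distributed M lborel (edge_var v (Col i (Suc j))) (exponential_density a)"
      "distributed M lborel (edge_var v (Row (Suc i) j)) (exponential_density c)"
      "distributed M lborel (edge_var v (Site (Suc i) (Suc j))) (exponential_density 1)"
    using IH(2)[of "Col i (Suc j)"] IH(2)[of "Row (Suc i) j"] IH(2)[of "Site (Suc i) (Suc j)"] front(3)
    by auto
  have flip: "edge_var v (Col (Suc i) (Suc j)) \<omega> =
        max 0 (edge_var v (Col i (Suc j)) \<omega> - edge_var v (Row (Suc i) j) \<omega>) + edge_var v (Site (Suc i) (Suc j)) \<omega>"
      "edge_var v (Row (Suc i) (Suc j)) \<omega> =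
        max 0 (edge_var v (Row (Suc i) j) \<omega> - edge_var v (Col i (Suc j)) \<omega>) + edge_var v (Site (Suc i) (Suc j)) \<omega>"
    for \<omega>
    using ij by (auto simp: max_def)
  note burke = burke_flip[OF live_edge_finite IH(1) front(3) _ _ _ _ new rates flip]
  have "distributed M lborel (edge_var v (Col (Suc i) (Suc j))) (exponential_density a)"
    by (rule burke(2)) (use front in auto)
  moreover have "distributed M lborel (edge_var v (Row (Suc i) (Suc j))) (exponential_density c)"
    by (rule burke(3)) (use front in auto)
  moreover have "indep_vars (\<lambda>_. borel) (edge_var v) {e. live_edge n U e}"
    unfolding front(2) by (rule burke(1)) (use front in auto)
  moreover have "distributed M lborel (edge_var v e) (exponential_density (edge_rate a c e))"
    if "live_edge n U e" for e
  proof -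
    have "e = Col (Suc i) (Suc j) \<or> e = Row (Suc i) (Suc j) \<or> live_edge n ?U e"
      using that front(2) by blast
    then show ?thesis
      using calculation(1,2) IH(2) by auto
  qed
  ultimately show ?case
    by blast
qed

text \<open>After the whole triangle has been processed, the vertical edges of column
  \<open>n\<close> are on its outer boundary.\<close>

lemma (in prob_space) column_increments_indep:
  assumes v: "exponential_weights M a c n v" and rates: "0 < a" "0 < c" "a + c = 1"
  shows "indep_vars (\<lambda>_. borel) (\<lambda>j. edge_var v (Col n j)) {1..n}"
    and "j \<in> {1..n} \<Longrightarrow> distributed M lborel (edge_var v (Col n j)) (exponential_density a)"
proof -
  let ?U = "{(i, j). 0 < j \<and> j < i \<and> i \<le> n}"
  have U: "order_ideal n ?U"
    by (auto simp: order_ideal_def)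
  have front: "live_edge n ?U (Col n j)" if "j \<in> {1..n}" for j
    using that by auto
  have "indep_vars (\<lambda>_. borel) (edge_var v) (Col n ` {1..n})"
    using live_edge_indep[OF v rates U] front by (blast intro: indep_vars_subset)
  then show "indep_vars (\<lambda>_. borel) (\<lambda>j. edge_var v (Col n j)) {1..n}"
    using indep_vars_reindex[of "\<lambda>_. borel" "edge_var v" "Col n"] by (auto simp: inj_on_def)
  show "distributed M lborel (edge_var v (Col n j)) (exponential_density a)" if "j \<in> {1..n}"
    using live_edge_indep[OF v rates U, THEN conjunct2, rule_format, OF front[OF that]] by simp
qed

text \<open>The points with coordinate sum \<open>2 * n + 1\<close> are the upper corners of the
  staircase that joins consecutive points \<open>(n + k, n - k)\<close>; the two edges ending at
  each of them form this staircase. It reaches column \<open>2 * n\<close>, hence the size of the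
  model.\<close>

lemma (in prob_space) antidiagonal_increments_indep:
  assumes v: "exponential_weights M a c (2 * n) v" and rates: "0 < a" "0 < c" "a + c = 1"
  shows "indep_vars (\<lambda>_. borel)
      (\<lambda>(b, k). edge_var v (if b then Row (n + k + 1) (n - k) else Col (n + k + 1) (n - k))) (UNIV \<times> {..<n})"
    and "k < n \<Longrightarrow> distributed M lborel (edge_var v (Row (n + k + 1) (n - k))) (exponential_density c)"
    and "k < n \<Longrightarrow> distributed M lborel (edge_var v (Col (n + k + 1) (n - k))) (exponential_density a)"
proof -
  let ?U = "{(i, j). 0 < j \<and> j < i \<and> i + j \<le> 2 * n + 1}"
  have U: "order_ideal (2 * n) ?U"
    by (auto simp: order_ideal_def)
  have front: "live_edge (2 * n) ?U (Row (n + k + 1) (n - k))" "live_edge (2 * n) ?U (Col (n + k + 1) (n - k))"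
    if "k < n" for k
    using that by auto
  define f where "f = (\<lambda>(b, k). if b then Row (n + k + 1) (n - k) else Col (n + k + 1) (n - k))"
  have sub: "f ` (UNIV \<times> {..<n}) \<subseteq> {e. live_edge (2 * n) ?U e}"
  proof
    fix e assume "e \<in> f ` (UNIV \<times> {..<n})"
    then obtain b k where "e = f (b, k)" "k < n"
      by blast
    then show "e \<in> {e. live_edge (2 * n) ?U e}"
      using front[of k] by (cases b) (simp_all only: f_def prod.case if_True if_False mem_Collect_eq)
  qed
  have "indep_vars (\<lambda>_. borel) (edge_var v) (f ` (UNIV \<times> {..<n}))"
    by (rule indep_vars_subset[OF conjunct1[OF live_edge_indep[OF v rates U]] sub])
  then have "indep_vars (\<lambda>_. borel) (\<lambda>p. edge_var v (f p)) (UNIV \<times> {..<n})"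
    by (rule indep_vars_reindex) (auto simp: inj_on_def f_def split: if_splits)
  then show "indep_vars (\<lambda>_. borel)
      (\<lambda>(b, k). edge_var v (if b then Row (n + k + 1) (n - k) else Col (n + k + 1) (n - k))) (UNIV \<times> {..<n})"
    by (simp add: f_def case_prod_beta')
  note distr = live_edge_indep[OF v rates U, THEN conjunct2, rule_format]
  show "distributed M lborel (edge_var v (Row (n + k + 1) (n - k))) (exponential_density c)" if "k < n"
    using distr[OF front(1)[OF that]] by simp
  show "distributed M lborel (edge_var v (Col (n + k + 1) (n - k))) (exponential_density a)" if "k < n"
    using distr[OF front(2)[OF that]] by simp
qed

section \<open>Exponential moments and a maximal inequality\<close>

lemma pred_const_le:
  fixes f :: "'a \<Rightarrow> real"
  assumes [measurable]: "f \<in> borel_measurable M"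
  shows "Measurable.pred M (\<lambda>x. c \<le> f x)"
  by measurable

text \<open>Doob's argument for the exponential of the walk: stopped when the level is first
  reached, it grows in mean at most by the factor \<open>\<rho>\<close> per step, and it is at least
  \<open>exp (\<theta> * x)\<close> if the level has been reached.\<close>

lemma (in prob_space) walk_maximal_inequality:
  fixes X :: "nat \<Rightarrow> 'a \<Rightarrow> real"
  assumes indep: "indep_vars (\<lambda>_. borel) X {..<n}"
    and mgf: "\<And>k. k < n \<Longrightarrow> (\<integral>\<^sup>+\<omega>. ennreal (exp (\<theta> * X k \<omega>)) \<partial>M) \<le> ennreal \<rho>"
    and "1 \<le> \<rho>" "0 \<le> \<theta>"
  shows "prob {\<omega> \<in> space M. \<exists>k\<le>n. x \<le> (\<Sum>i<k. X i \<omega>)} \<le> exp (- \<theta> * x) * \<rho> ^ n"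
proof -
  define S where "S k v = (\<Sum>i<k. v i)" for k and v :: "nat \<Rightarrow> real"
  define hit where "hit k v \<longleftrightarrow> (\<exists>j\<le>k. x \<le> S j v)" for k v
  \<comment> \<open>\<open>f k\<close> is the exponential on the event that the level has not been
    reached; it depends on the first \<open>k\<close> steps only. \<open>T\<close> is the
    exponential frozen at the first time at which the walk is at or above the level.\<close>
  define f where "f k v = (if hit k v then 0 else ennreal (exp (\<theta> * S k v)))" for k v
  define T where "T = rec_nat (\<lambda>v. 1) (\<lambda>k t v. if hit k v then t v else ennreal (exp (\<theta> * S (Suc k) v)))"
  have T0: "T 0 v = 1" and T_Suc: "T (Suc k) v = (if hit k v then T k v else ennreal (exp (\<theta> * S (Suc k) v)))"
    for k v by (simp_all add: T_def)
  have hit_Bex: "hit k v \<longleftrightarrow> (\<exists>j\<in>{..k}. x \<le> S j v)" for k v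
    by (auto simp: hit_def)
  have T_not_hit: "T k v = ennreal (exp (\<theta> * S k v))" if "\<not> hit k v" for k v
    using that by (cases k) (auto simp: T0 T_Suc S_def hit_def le_Suc_eq)
  have T_hit: "ennreal (exp (\<theta> * x)) \<le> T k v" if "hit k v" for k v
    using that
  proof (induction k)
    case 0
    then have "exp (\<theta> * x) \<le> 1"
      using \<open>0 \<le> \<theta>\<close> by (simp add: hit_def S_def mult_nonneg_nonpos)
    then show ?case
      by (simp add: T0)
  next
    case (Suc k)
    then show ?case
      using \<open>0 \<le> \<theta>\<close> by (auto simp: T_Suc hit_def le_Suc_eq intro!: ennreal_leI mult_left_mono)
  qed
  have rv[measurable]: "X i \<in> borel_measurable M" if "i < n" for i
    using indep that by (auto simp: indep_vars_def)
  have S_measurable: "(\<lambda>\<omega>. S k (\<lambda>i. X i \<omega>)) \<in> borel_measurable M" if "k \<le> n" for k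
    unfolding S_def using that by (intro borel_measurable_sum rv) auto
  have hit_measurable: "Measurable.pred M (\<lambda>\<omega>. hit k (\<lambda>i. X i \<omega>))" if "k \<le> n" for k
    unfolding hit_Bex using that by (intro pred_intros_finite pred_const_le S_measurable) auto
  have T_measurable: "(\<lambda>\<omega>. T k (\<lambda>i. X i \<omega>)) \<in> borel_measurable M" if "k \<le> n" for k
    using that
  proof (induction k)
    case (Suc k)
    note [measurable] = hit_measurable[of k] S_measurable[of "Suc k"]
    show ?case
      using Suc by (simp add: T_Suc)
  qed (simp add: T0)
  have step: "(\<integral>\<^sup>+\<omega>. T (Suc k) (\<lambda>i. X i \<omega>) \<partial>M) \<le> ennreal \<rho> * (\<integral>\<^sup>+\<omega>. T k (\<lambda>i. X i \<omega>) \<partial>M)" if "k < n" for k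
  proof -
    have S_fin: "S j (\<lambda>i\<in>{..<k}. v i) = S j v" if "j \<le> k" for j v
      using that by (auto simp: S_def intro!: sum.cong)
    then have f_fin: "f k (\<lambda>i\<in>{..<k}. v i) = f k v" for v
      by (auto simp: f_def hit_def)
    have S_PiM: "S j \<in> borel_measurable (PiM {..<k} (\<lambda>_. borel))" if "j \<le> k" for j
      unfolding S_def[abs_def] using that by (intro borel_measurable_sum measurable_component_singleton) auto
    have [measurable]: "Measurable.pred (PiM {..<k} (\<lambda>_. borel)) (hit k)"
      unfolding hit_Bex[abs_def] by (intro pred_intros_finite pred_const_le S_PiM) auto
    have "f k \<in> borel_measurable (PiM {..<k} (\<lambda>_. borel))"
      unfolding f_def[abs_def] using S_PiM[of k] by measurable
    then have "indep_pair borel (\<lambda>\<omega>. f k (\<lambda>i\<in>{..<k}. X i \<omega>)) borel (\<lambda>\<omega>. (\<lambda>v. v k) (\<lambda>i\<in>{k}. X i \<omega>))"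
      using that by (intro indep_pair_restrict[OF indep]) auto
    then have pair: "indep_pair borel (\<lambda>\<omega>. f k (\<lambda>i. X i \<omega>)) borel (X k)"
      by (simp add: f_fin)
    note [measurable] = hit_measurable[of k] S_measurable[of k] T_measurable[of k] rv[OF that]
    let ?H = "\<lambda>\<omega>. T k (\<lambda>i. X i \<omega>) * indicator {v. hit k v} (\<lambda>i. X i \<omega>)"
    have H: "?H \<in> borel_measurable M"
    proof -
      have "?H = (\<lambda>\<omega>. if hit k (\<lambda>i. X i \<omega>) then T k (\<lambda>i. X i \<omega>) else 0)"
        by auto
      then show ?thesis
        using that by simp
    qed
    have F: "(\<lambda>\<omega>. f k (\<lambda>i. X i \<omega>)) \<in> borel_measurable M"
      using pair by (simp add: indep_pair_def)
    have "(\<integral>\<^sup>+\<omega>. T (Suc k) (\<lambda>i. X i \<omega>) \<partial>M) =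
        (\<integral>\<^sup>+\<omega>. ?H \<omega> + f k (\<lambda>i. X i \<omega>) * ennreal (exp (\<theta> * X k \<omega>)) \<partial>M)"
      by (intro nn_integral_cong)
        (auto simp: T_Suc f_def S_def ring_distribs exp_add ennreal_mult)
    also have "\<dots> = (\<integral>\<^sup>+\<omega>. ?H \<omega> \<partial>M) + (\<integral>\<^sup>+\<omega>. f k (\<lambda>i. X i \<omega>) * ennreal (exp (\<theta> * X k \<omega>)) \<partial>M)"
      using H F by (intro nn_integral_add) auto
    also have "(\<integral>\<^sup>+\<omega>. f k (\<lambda>i. X i \<omega>) * ennreal (exp (\<theta> * X k \<omega>)) \<partial>M) =
        (\<integral>\<^sup>+\<omega>. f k (\<lambda>i. X i \<omega>) \<partial>M) * (\<integral>\<^sup>+\<omega>. ennreal (exp (\<theta> * X k \<omega>)) \<partial>M)"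
      by (rule indep_pair_nn_integral[OF pair, of "\<lambda>x. x"]) simp_all
    also have "\<dots> \<le> ennreal \<rho> * (\<integral>\<^sup>+\<omega>. f k (\<lambda>i. X i \<omega>) \<partial>M)"
      using mgf[OF that] by (subst mult.commute) (rule mult_right_mono, simp_all)
    also have "(\<integral>\<^sup>+\<omega>. ?H \<omega> \<partial>M) \<le> ennreal \<rho> * (\<integral>\<^sup>+\<omega>. ?H \<omega> \<partial>M)"
    proof -
      have "1 \<le> ennreal \<rho>"
        using \<open>1 \<le> \<rho>\<close> by simp
      then show ?thesis
        using mult_right_mono[of 1 "ennreal \<rho>" "\<integral>\<^sup>+\<omega>. ?H \<omega> \<partial>M"] by simp
    qed
    also have "ennreal \<rho> * (\<integral>\<^sup>+\<omega>. ?H \<omega> \<partial>M) + ennreal \<rho> * (\<integral>\<^sup>+\<omega>. f k (\<lambda>i. X i \<omega>) \<partial>M) =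
        ennreal \<rho> * (\<integral>\<^sup>+\<omega>. ?H \<omega> + f k (\<lambda>i. X i \<omega>) \<partial>M)"
      using H F by (subst nn_integral_add) (auto simp: distrib_left)
    also have "(\<integral>\<^sup>+\<omega>. ?H \<omega> + f k (\<lambda>i. X i \<omega>) \<partial>M) = (\<integral>\<^sup>+\<omega>. T k (\<lambda>i. X i \<omega>) \<partial>M)"
      by (intro nn_integral_cong) (auto simp: f_def T_not_hit)
    finally show ?thesis
      by (simp add: add_mono)
  qed
  have T_le: "(\<integral>\<^sup>+\<omega>. T k (\<lambda>i. X i \<omega>) \<partial>M) \<le> ennreal (\<rho> ^ k)" if "k \<le> n" for k
    using that
  proof (induction k)
    case 0
    then show ?case
      by (simp add: T0 emeasure_space_1)
  next
    case (Suc k)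
    then have "(\<integral>\<^sup>+\<omega>. T (Suc k) (\<lambda>i. X i \<omega>) \<partial>M) \<le> ennreal \<rho> * ennreal (\<rho> ^ k)"
      by (intro order_trans[OF step] mult_left_mono) auto
    then show ?case
      using \<open>1 \<le> \<rho>\<close> by (simp add: ennreal_mult'[symmetric])
  qed
  let ?A = "{\<omega> \<in> space M. hit n (\<lambda>i. X i \<omega>)}"
  have A: "?A \<in> sets M"
    using hit_measurable[of n] by measurable
  have "ennreal (exp (\<theta> * x)) * emeasure M ?A = (\<integral>\<^sup>+\<omega>. ennreal (exp (\<theta> * x)) * indicator ?A \<omega> \<partial>M)"
    using A by (simp add: nn_integral_cmult_indicator)
  also have "\<dots> \<le> (\<integral>\<^sup>+\<omega>. T n (\<lambda>i. X i \<omega>) \<partial>M)"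
    by (intro nn_integral_mono) (auto simp: indicator_def T_hit)
  also have "\<dots> \<le> ennreal (\<rho> ^ n)"
    by (rule T_le) simp
  finally have "exp (\<theta> * x) * prob ?A \<le> \<rho> ^ n"
    using \<open>1 \<le> \<rho>\<close> by (simp add: emeasure_eq_measure ennreal_mult'[symmetric])
  then have "prob ?A \<le> exp (- \<theta> * x) * \<rho> ^ n"
    by (simp add: exp_minus field_simps)
  then show ?thesis
    by (simp add: hit_def S_def)
qed

section \<open>Change of measure and exponential moments of the passage time\<close>

lemma density_PiM:
  assumes "finite I" and M: "\<And>i. prob_space (M i)" and D: "\<And>i. prob_space (density (M i) (f i))"
    and f[measurable]: "\<And>i. i \<in> I \<Longrightarrow> f i \<in> borel_measurable (M i)"
  shows "PiM I (\<lambda>i. density (M i) (f i)) = density (PiM I M) (\<lambda>u. \<Prod>i\<in>I. f i (u i))"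
proof -
  interpret D: product_sigma_finite "\<lambda>i. density (M i) (f i)"
    unfolding product_sigma_finite_def by (intro allI prob_space_imp_sigma_finite D)
  interpret M: product_sigma_finite M
    unfolding product_sigma_finite_def by (intro allI prob_space_imp_sigma_finite M)
  have "density (PiM I M) (\<lambda>u. \<Prod>i\<in>I. f i (u i)) = PiM I (\<lambda>i. density (M i) (f i))"
  proof (rule D.PiM_eqI)
    show "sets (density (PiM I M) (\<lambda>u. \<Prod>i\<in>I. f i (u i))) = sets (PiM I (\<lambda>i. density (M i) (f i)))"
      unfolding sets_density by (intro sets_PiM_cong) simp_all
    fix A assume "\<And>i. i \<in> I \<Longrightarrow> A i \<in> sets (density (M i) (f i))"
    then have A[measurable]: "A i \<in> sets (M i)" if "i \<in> I" for i
      using that by simp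
    have box: "PiE I A \<in> sets (PiM I M)"
      by (intro sets_PiM_I_finite \<open>finite I\<close> A)
    have "emeasure (density (PiM I M) (\<lambda>u. \<Prod>i\<in>I. f i (u i))) (PiE I A) =
        (\<integral>\<^sup>+u. (\<Prod>i\<in>I. f i (u i)) * indicator (PiE I A) u \<partial>PiM I M)"
      using box by (intro emeasure_density) auto
    also have "\<dots> = (\<integral>\<^sup>+u. (\<Prod>i\<in>I. f i (u i) * indicator (A i) (u i)) \<partial>PiM I M)"
    proof (intro nn_integral_cong)
      fix u assume "u \<in> space (PiM I M)"
      then have "indicator (PiE I A) u = (\<Prod>i\<in>I. indicator (A i) (u i) :: ennreal)"
        using \<open>finite I\<close> by (auto simp: indicator_def space_PiM PiE_iff prod_zero_iff)
      then show "(\<Prod>i\<in>I. f i (u i)) * indicator (PiE I A) u = (\<Prod>i\<in>I. f i (u i) * indicator (A i) (u i))"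
        by (simp add: prod.distrib)
    qed
    also have "\<dots> = (\<Prod>i\<in>I. \<integral>\<^sup>+x. f i x * indicator (A i) x \<partial>M i)"
      using \<open>finite I\<close> by (intro M.product_nn_integral_prod) auto
    also have "\<dots> = (\<Prod>i\<in>I. emeasure (density (M i) (f i)) (A i))"
      by (intro prod.cong refl) (simp add: emeasure_density)
    finally show "emeasure (density (PiM I M) (\<lambda>u. \<Prod>i\<in>I. f i (u i))) (PiE I A) =
        (\<Prod>i\<in>I. emeasure (density (M i) (f i)) (A i))" .
  qed fact
  then show ?thesis
    by simp
qed

lemma passage_measurable[measurable]:
  assumes "\<And>p. p \<in> sites n \<Longrightarrow> v p \<in> borel_measurable M" "j \<le> i" "i \<le> n"
  shows "(\<lambda>\<omega>. passage (\<lambda>p. v p \<omega>) i j) \<in> borel_measurable M"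
  using assms(2,3)
proof (induction "i + j" arbitrary: i j rule: less_induct)
  case less
  show ?case
  proof (cases i)
    case (Suc i')
    note i = Suc
    have v: "v (i, j) \<in> borel_measurable M"
      using less.prems i by (intro assms) (auto simp: sites_def)
    show ?thesis
    proof (cases j)
      case 0
      then show ?thesis
        using less.hyps[of i' 0] less.prems i v by simp
    next
      case (Suc j')
      then have "(\<lambda>\<omega>. passage (\<lambda>p. v p \<omega>) i j') \<in> borel_measurable M"
        using less.hyps[of i j'] less.prems i by simp
      moreover have "(\<lambda>\<omega>. passage (\<lambda>p. v p \<omega>) i' j) \<in> borel_measurable M" if "j' < i'"
        using less.hyps[of i' j] less.prems i Suc that by simp
      ultimately show ?thesis
        using i Suc v by (cases "j' < i'") simp_all
    qed
  qed simp
qed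

text \<open>On the coordinate space two choices of rates differ by a density, which permits the
  change of measure.\<close>

definition exponential_product :: "real \<Rightarrow> real \<Rightarrow> nat \<Rightarrow> (nat \<times> nat \<Rightarrow> real) measure" where
  "exponential_product a c n =
     PiM (sites n) (\<lambda>p. density lborel (exponential_density (site_rate a c p)))"

lemma site_rate_pos: "0 < a \<Longrightarrow> 0 < c \<Longrightarrow> 0 < site_rate a c p"
  by (simp add: site_rate_def)

lemma exponential_product:
  assumes "0 < a" "0 < c"
  shows prob_space_exponential_product: "prob_space (exponential_product a c n)"
    and exponential_weights_product: "0 < n \<Longrightarrow> exponential_weights (exponential_product a c n) a c n (\<lambda>p u. u p)"
proof -
  let ?E = "\<lambda>p. density lborel (exponential_density (site_rate a c p))"
  have E: "prob_space (?E p)" for p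
    using assms by (intro prob_space_exponential_density site_rate_pos)
  show "prob_space (exponential_product a c n)"
    unfolding exponential_product_def by (intro prob_space_PiM E)
  then interpret prob_space "PiM (sites n) ?E"
    by (simp add: exponential_product_def)
  have distr: "distr (PiM (sites n) ?E) borel (\<lambda>u. u p) = ?E p" if "p \<in> sites n" for p
  proof -
    have "distr (PiM (sites n) ?E) borel (\<lambda>u. u p) = distr (PiM (sites n) ?E) (?E p) (\<lambda>u. u p)"
      by (rule distr_cong) auto
    then show ?thesis
      using distr_PiM_component[of "sites n" ?E p, OF E that] by simp
  qed
  have indep: "indep_vars (\<lambda>_. borel) (\<lambda>p u. u p) (sites n)" if "0 < n"
  proof -
    have ne: "sites n \<noteq> {}"
      using that by (auto simp: sites_def)
    have rv: "(\<lambda>u. u p) \<in> borel_measurable (PiM (sites n) ?E)" if "p \<in> sites n" for p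
      using measurable_component_singleton[OF that, of ?E] by simp
    have "distr (PiM (sites n) ?E) (PiM (sites n) (\<lambda>_. borel)) (\<lambda>x. \<lambda>i\<in>sites n. x i) =
        distr (PiM (sites n) ?E) (PiM (sites n) ?E) (\<lambda>x. x)"
      by (rule distr_cong) (auto simp: space_PiM intro!: sets_PiM_cong)
    also have "\<dots> = PiM (sites n) (\<lambda>i. distr (PiM (sites n) ?E) borel (\<lambda>u. u i))"
      by (auto simp: distr intro!: PiM_cong)
    finally show ?thesis
      by (intro indep_vars_iff_distr_eq_PiM'[OF ne, THEN iffD2]) (rule rv)
  qed
  show "exponential_weights (exponential_product a c n) a c n (\<lambda>p u. u p)" if "0 < n"
    unfolding exponential_weights_def exponential_product_def
  proof (intro conjI ballI indep that)
    fix p assume p: "p \<in> sites n"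
    have "distr (PiM (sites n) ?E) lborel (\<lambda>u. u p) = ?E p"
      using distr[OF p] by (metis distr_cong sets_lborel)
    moreover have "(\<lambda>u. u p) \<in> borel_measurable (PiM (sites n) ?E)"
      using measurable_component_singleton[OF p, of ?E] by simp
    ultimately show "distributed (PiM (sites n) ?E) lborel (\<lambda>u. u p) (exponential_density (site_rate a c p))"
      by (simp add: distributed_def)
  qed
qed

lemma (in prob_space) distr_exponential_weights:
  assumes "exponential_weights M a c n v" "0 < n"
  shows "distr M (PiM (sites n) (\<lambda>_. borel)) (\<lambda>\<omega>. \<lambda>p\<in>sites n. v p \<omega>) = exponential_product a c n"
proof -
  have ne: "sites n \<noteq> {}"
    using \<open>0 < n\<close> by (auto simp: sites_def)
  have indep: "indep_vars (\<lambda>_. borel) v (sites n)"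
    using assms by (simp add: exponential_weights_def)
  then have rv: "v p \<in> borel_measurable M" if "p \<in> sites n" for p
    using that by (simp add: indep_vars_def)
  have "distr M (PiM (sites n) (\<lambda>_. borel)) (\<lambda>\<omega>. \<lambda>p\<in>sites n. v p \<omega>) = PiM (sites n) (\<lambda>p. distr M borel (v p))"
    by (rule indep_vars_iff_distr_eq_PiM'[OF ne, THEN iffD1, OF _ indep]) (rule rv)
  also have "\<dots> = exponential_product a c n"
    unfolding exponential_product_def
  proof (intro PiM_cong refl)
    fix p assume "p \<in> sites n"
    then have "distributed M lborel (v p) (exponential_density (site_rate a c p))"
      using assms by (simp add: exponential_weights_def)
    then have "distr M lborel (v p) = density lborel (exponential_density (site_rate a c p))"
      by (rule distributed_distr_eq_density)
    then show "distr M borel (v p) = density lborel (exponential_density (site_rate a c p))"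
      by (metis distr_cong sets_lborel)
  qed
  finally show ?thesis .
qed

lemma passage_row: "passage w n 0 = (\<Sum>i = 1..n. w (i, 0))"
  by (induction n) auto

lemma passage_column: "passage w n m = passage w n 0 + (\<Sum>j = 1..m. passage w n j - passage w n (j - 1))"
  by (induction m) auto

text \<open>Tilting the weights of the bottom row from rate \<open>b\<close> to \<open>1 - a\<close> makes the model stationary, and
  turns the exponential of the passage time into that of a sum of independent increments.\<close>

lemma (in prob_space) passage_mgf:
  assumes v: "exponential_weights M a b n v" and a: "0 < a" "a < 1" and b: "0 < b" "b < 1"
    and m: "m \<le> n" "0 < n"
  shows "(\<integral>\<^sup>+\<omega>. ennreal (exp ((a + b - 1) * passage (\<lambda>p. v p \<omega>) n m)) \<partial>M) =
    ennreal ((b / (1 - a)) ^ n * (a / (1 - b)) ^ m)"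
proof -
  define c where "c = 1 - a"
  have c: "0 < c" "a + c = 1"
    using a by (simp_all add: c_def)
  let ?P = "exponential_product a c n"
  interpret P: prob_space ?P
    by (rule prob_space_exponential_product) fact+
  note weights = exponential_weights_product[OF \<open>0 < a\<close> \<open>0 < c\<close> \<open>0 < n\<close>]
  have P_measurable: "passage_n \<in> borel_measurable ?P"
    if "passage_n = (\<lambda>u. passage u n j)" "j \<le> n" for passage_n j
    unfolding that(1)
    by (rule passage_measurable[where v = "\<lambda>p u. u p" and n = n])
      (use that(2) weights in \<open>auto simp: exponential_weights_def P.indep_vars_def\<close>)
  \<comment> \<open>The likelihood ratio of rate \<open>b\<close> against rate \<open>c\<close> on
    the bottom row, and 1 elsewhere.\<close>
  define g :: "nat \<times> nat \<Rightarrow> real \<Rightarrow> ennreal" where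
    "g p x = (if snd p = 0 then ennreal (b / c * exp ((c - b) * x)) else 1)" for p x
  have g_measurable[measurable]: "g p \<in> borel_measurable borel" for p
    unfolding g_def[abs_def] by measurable
  have tilt: "density (density lborel (exponential_density (site_rate a c p))) (g p) =
      density lborel (exponential_density (site_rate a b p))" for p
  proof (subst density_density_eq)
    have "exponential_density c x * (b / c * exp ((c - b) * x)) = exponential_density b x" for x
    proof (cases "c - b < c")
      case True
      have "exponential_density c x * (b / c * exp ((c - b) * x)) =
          b / c * (exponential_density c x * exp ((c - b) * x))"
        by (simp only: mult_ac)
      also have "\<dots> = b / c * (c / b * exponential_density b x)"
        unfolding exponential_density_tilt[OF True] by simp
      finally show ?thesis
        using b c by simp
    qed (use b in simp)
    moreover have "0 \<le> b / c * exp ((c - b) * x)" for x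
      using b c by simp
    ultimately have "ennreal (exponential_density (site_rate a c p) x) * g p x =
        ennreal (exponential_density (site_rate a b p) x)" for x
      by (auto simp: g_def site_rate_def ennreal_mult''[symmetric])
    then show "density lborel (\<lambda>x. ennreal (exponential_density (site_rate a c p) x) * g p x) =
      density lborel (exponential_density (site_rate a b p))"
      by simp
  qed simp_all
  have "exponential_product a b n = PiM (sites n)
      (\<lambda>p. density (density lborel (exponential_density (site_rate a c p))) (g p))"
    by (simp add: exponential_product_def tilt)
  also have "\<dots> = density ?P (\<lambda>u. \<Prod>p\<in>sites n. g p (u p))"
    unfolding exponential_product_def
  proof (rule density_PiM[OF finite_sites])
    show "prob_space (density (density lborel (exponential_density (site_rate a c p))) (g p))" for p
      unfolding tilt by (intro prob_space_exponential_density site_rate_pos) fact+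
    show "prob_space (density lborel (exponential_density (site_rate a c p)))" for p
      by (intro prob_space_exponential_density site_rate_pos) fact+
  qed simp
  finally have density: "exponential_product a b n = density ?P (\<lambda>u. \<Prod>p\<in>sites n. g p (u p))" .
  have g_prod: "(\<Prod>p\<in>sites n. g p (u p)) = ennreal ((b / c) ^ n * exp ((c - b) * passage u n 0))" for u
  proof -
    have "(\<Prod>p\<in>sites n. g p (u p)) = (\<Prod>p\<in>(\<lambda>i. (i, 0)) ` {1..n}. g p (u p))"
      by (intro prod.mono_neutral_right finite_sites) (auto simp: sites_def g_def)
    also have "\<dots> = (\<Prod>i = 1..n. ennreal (b / c * exp ((c - b) * u (i, 0))))"
      by (subst prod.reindex) (auto simp: inj_on_def g_def)
    also have "\<dots> = ennreal (\<Prod>i = 1..n. b / c * exp ((c - b) * u (i, 0)))"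
      using b c by (intro prod_ennreal) simp
    also have "(\<Prod>i = 1..n. b / c * exp ((c - b) * u (i, 0))) = (b / c) ^ n * exp ((c - b) * passage u n 0)"
      by (simp only: prod.distrib passage_row sum_distrib_left exp_sum[OF finite_atLeastAtMost]) simp
    finally show ?thesis .
  qed
  have sites_n: "passage (\<lambda>p\<in>sites n. w p) n m = passage w n m" for w
    using m by (intro passage_cong) (auto simp: sites_def)
  have rv: "v p \<in> borel_measurable M" if "p \<in> sites n" for p
    using v that by (simp add: exponential_weights_def indep_vars_def)
  have vec: "(\<lambda>\<omega>. \<lambda>p\<in>sites n. v p \<omega>) \<in> measurable M (PiM (sites n) (\<lambda>_. borel))"
    by (intro measurable_restrict rv)
  have fm: "(\<lambda>u. ennreal (exp ((a + b - 1) * passage u n m))) \<in> borel_measurable (PiM (sites n) (\<lambda>_. borel))"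
    using passage_measurable[where v = "\<lambda>p u. u p" and n = n and i = n and j = m] m by measurable
  have gm: "(\<lambda>u. \<Prod>p\<in>sites n. g p (u p)) \<in> borel_measurable ?P"
    unfolding g_prod using P_measurable[OF refl, of 0] by measurable
  have "(\<integral>\<^sup>+\<omega>. ennreal (exp ((a + b - 1) * passage (\<lambda>p. v p \<omega>) n m)) \<partial>M) =
      (\<integral>\<^sup>+u. ennreal (exp ((a + b - 1) * passage u n m))
         \<partial>distr M (PiM (sites n) (\<lambda>_. borel)) (\<lambda>\<omega>. \<lambda>p\<in>sites n. v p \<omega>))"
    using fm by (subst nn_integral_distr[OF vec]) (simp_all add: sites_n)
  also have "\<dots> = (\<integral>\<^sup>+u. ennreal (exp ((a + b - 1) * passage u n m))
      \<partial>density ?P (\<lambda>u. \<Prod>p\<in>sites n. g p (u p)))"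
    by (simp add: distr_exponential_weights[OF v] m density)
  also have "\<dots> = (\<integral>\<^sup>+u. (\<Prod>p\<in>sites n. g p (u p)) * ennreal (exp ((a + b - 1) * passage u n m)) \<partial>?P)"
    by (rule nn_integral_density[OF gm]) (use P_measurable[OF refl, of m] m in measurable)
  also have "\<dots> = (\<integral>\<^sup>+u. ennreal ((b / c) ^ n) *
      (\<Prod>j\<in>{1..m}. ennreal (exp ((a + b - 1) * edge_var (\<lambda>p u. u p) (Col n j) u))) \<partial>?P)"
  proof (intro nn_integral_cong)
    fix u
    \<comment> \<open>The exponent is chosen for this cancellation:
      \<open>c - b = - (a + b - 1)\<close>, so the bottom row disappears and only the increments up
      column \<open>n\<close> remain, which are independent under the stationary law.\<close>
    have "exp ((c - b) * passage u n 0) * exp ((a + b - 1) * passage u n m) =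
        exp ((a + b - 1) * (\<Sum>j = 1..m. passage u n j - passage u n (j - 1)))"
      unfolding exp_add[symmetric] passage_column[of u n m] by (simp add: c_def algebra_simps)
    also have "\<dots> = (\<Prod>j = 1..m. exp ((a + b - 1) * (passage u n j - passage u n (j - 1))))"
      by (simp only: sum_distrib_left exp_sum[OF finite_atLeastAtMost])
    finally have eq: "(b / c) ^ n * exp ((c - b) * passage u n 0) * exp ((a + b - 1) * passage u n m) =
        (b / c) ^ n * (\<Prod>j = 1..m. exp ((a + b - 1) * (passage u n j - passage u n (j - 1))))"
      by (simp only: mult.assoc)
    have "(\<Prod>p\<in>sites n. g p (u p)) * ennreal (exp ((a + b - 1) * passage u n m)) =
        ennreal ((b / c) ^ n * exp ((c - b) * passage u n 0) * exp ((a + b - 1) * passage u n m))"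
      unfolding g_prod using b c by (intro ennreal_mult[symmetric]) auto
    also have "\<dots> = ennreal ((b / c) ^ n) *
        ennreal (\<Prod>j = 1..m. exp ((a + b - 1) * (passage u n j - passage u n (j - 1))))"
      unfolding eq using b c by (intro ennreal_mult prod_nonneg) auto
    also have "ennreal (\<Prod>j = 1..m. exp ((a + b - 1) * (passage u n j - passage u n (j - 1)))) =
        (\<Prod>j\<in>{1..m}. ennreal (exp ((a + b - 1) * edge_var (\<lambda>p u. u p) (Col n j) u)))"
      unfolding edge_var.simps by (intro prod_ennreal[symmetric]) simp
    finally show "(\<Prod>p\<in>sites n. g p (u p)) * ennreal (exp ((a + b - 1) * passage u n m)) = ennreal ((b / c) ^ n) *
      (\<Prod>j\<in>{1..m}. ennreal (exp ((a + b - 1) * edge_var (\<lambda>p u. u p) (Col n j) u)))" .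
  qed
  also have "\<dots> = ennreal ((b / c) ^ n) *
      (\<integral>\<^sup>+u. (\<Prod>j\<in>{1..m}. ennreal (exp ((a + b - 1) * edge_var (\<lambda>p u. u p) (Col n j) u))) \<partial>?P)"
  proof (rule nn_integral_cmult)
    have "edge_var (\<lambda>p u. u p) (Col n j) \<in> borel_measurable ?P" if "j \<in> {1..m}" for j
      using P.column_increments_indep(1)[OF weights \<open>0 < a\<close> c] that m by (auto simp: P.indep_vars_def)
    then show "(\<lambda>u. \<Prod>j\<in>{1..m}. ennreal (exp ((a + b - 1) * edge_var (\<lambda>p u. u p) (Col n j) u))) \<in> borel_measurable ?P"
      by (intro borel_measurable_prod_ennreal) measurable
  qed
  also have "(\<integral>\<^sup>+u. (\<Prod>j\<in>{1..m}. ennreal (exp ((a + b - 1) * edge_var (\<lambda>p u. u p) (Col n j) u))) \<partial>?P) =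
      (\<Prod>j\<in>{1..m}. \<integral>\<^sup>+u. ennreal (exp ((a + b - 1) * edge_var (\<lambda>p u. u p) (Col n j) u)) \<partial>?P)"
  proof (rule P.indep_vars_nn_integral)
    have "P.indep_vars (\<lambda>_. borel) (\<lambda>j. edge_var (\<lambda>p u. u p) (Col n j)) {1..m}"
      using P.column_increments_indep(1)[OF weights \<open>0 < a\<close> c] m by (rule_tac P.indep_vars_subset) auto
    then show "P.indep_vars (\<lambda>_. borel) (\<lambda>j u. ennreal (exp ((a + b - 1) * edge_var (\<lambda>p u. u p) (Col n j) u))) {1..m}"
      by (rule P.indep_vars_compose2) simp
  qed auto
  also have "\<dots> = (\<Prod>j\<in>{1..m}. ennreal (a / (1 - b)))"
  proof (intro prod.cong refl)
    fix j assume "j \<in> {1..m}"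
    then have "distributed ?P lborel (edge_var (\<lambda>p u. u p) (Col n j)) (exponential_density a)"
      using m by (intro P.column_increments_indep(2)[OF weights \<open>0 < a\<close> c]) auto
    from exponential_mgf[OF this \<open>0 < a\<close>, of "a + b - 1"]
    show "(\<integral>\<^sup>+u. ennreal (exp ((a + b - 1) * edge_var (\<lambda>p u. u p) (Col n j) u)) \<partial>?P) = ennreal (a / (1 - b))"
      using b by (simp add: algebra_simps)
  qed
  also have "ennreal ((b / c) ^ n) * (\<Prod>j\<in>{1..m}. ennreal (a / (1 - b))) =
      ennreal ((b / (1 - a)) ^ n * (a / (1 - b)) ^ m)"
    using a b by (simp add: c_def ennreal_power ennreal_mult''[symmetric])
  finally show ?thesis .
qed

section \<open>Moduli of continuity at finite size\<close>

text \<open>Chernoff's bound. The factor \<open>a + b - 1\<close> on both sides makes this an upper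
  tail if it is positive and a lower tail if it is negative.\<close>

lemma (in prob_space) passage_tail:
  assumes v: "exponential_weights M a b n v" and a: "0 < a" "a < 1" and b: "0 < b" "b < 1"
    and m: "m \<le> n" "0 < n"
  shows "prob {\<omega> \<in> space M. (a + b - 1) * y \<le> (a + b - 1) * passage (\<lambda>p. v p \<omega>) n m} \<le>
    exp (- (a + b - 1) * y) * ((b / (1 - a)) ^ n * (a / (1 - b)) ^ m)"
proof -
  define s where "s = a + b - 1"
  let ?L = "\<lambda>\<omega>. passage (\<lambda>p. v p \<omega>) n m"
  have rv: "v p \<in> borel_measurable M" if "p \<in> sites n" for p
    using v that by (simp add: exponential_weights_def indep_vars_def)
  have [measurable]: "?L \<in> borel_measurable M"
    by (rule passage_measurable[OF rv m(1)]) auto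
  let ?A = "{\<omega> \<in> space M. s * y \<le> s * ?L \<omega>}"
  have "ennreal (exp (s * y)) * emeasure M ?A = (\<integral>\<^sup>+\<omega>. ennreal (exp (s * y)) * indicator ?A \<omega> \<partial>M)"
    by (simp add: nn_integral_cmult_indicator)
  also have "\<dots> \<le> (\<integral>\<^sup>+\<omega>. ennreal (exp (s * ?L \<omega>)) \<partial>M)"
    by (intro nn_integral_mono) (auto simp: indicator_def intro!: ennreal_leI)
  also have "\<dots> = ennreal ((b / (1 - a)) ^ n * (a / (1 - b)) ^ m)"
    unfolding s_def by (rule passage_mgf[OF v a b m])
  finally have "exp (s * y) * prob ?A \<le> (b / (1 - a)) ^ n * (a / (1 - b)) ^ m"
    using a b by (simp add: emeasure_eq_measure ennreal_mult'[symmetric] mult_nonneg_nonneg)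
  moreover have "p \<le> exp (- s * y) * C" if "exp (s * y) * p \<le> C" for p C
    using that by (simp add: exp_minus field_simps)
  ultimately have "prob ?A \<le> exp (- s * y) * ((b / (1 - a)) ^ n * (a / (1 - b)) ^ m)"
    by blast
  then show ?thesis
    by (simp only: s_def)
qed

text \<open>Both \<open>k\<close> and \<open>l\<close> lie within \<open>2 * m\<close> of the last
  multiple of \<open>m\<close> below \<open>k\<close>. An increment above \<open>x\<close> between
  them forces the walk started at that multiple to rise or to fall by \<open>x / 2\<close>. There
  are \<open>K div m + 1\<close> multiples and two signs.\<close>

lemma (in prob_space) walk_window_bound:
  fixes X :: "nat \<Rightarrow> 'a \<Rightarrow> real"
  assumes indep: "indep_vars (\<lambda>_. borel) X {..<n}"
    and mgf: "\<And>k. k < n \<Longrightarrow> (\<integral>\<^sup>+\<omega>. ennreal (exp (\<theta> * X k \<omega>)) \<partial>M) \<le> ennreal \<rho>"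
      "\<And>k. k < n \<Longrightarrow> (\<integral>\<^sup>+\<omega>. ennreal (exp (\<theta> * - X k \<omega>)) \<partial>M) \<le> ennreal \<rho>"
    and "1 \<le> \<rho>" "0 \<le> \<theta>" and m: "0 < m" "K + 2 * m \<le> n"
  shows "prob {\<omega> \<in> space M. \<exists>k l. k \<le> l \<and> l \<le> k + m \<and> l \<le> K \<and> x < (\<Sum>i<l. X i \<omega>) - (\<Sum>i<k. X i \<omega>)} \<le>
    2 * (real (K div m) + 1) * (exp (- \<theta> * (x / 2)) * \<rho> ^ (2 * m))"
proof -
  let ?A = "\<lambda>c q. {\<omega> \<in> space M. \<exists>j\<le>2 * m. x / 2 \<le> (\<Sum>i<j. c * X (q * m + i) \<omega>)}"
  have rv[measurable]: "X i \<in> borel_measurable M" if "i < n" for i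
    using indep that by (auto simp: indep_vars_def)
  have room: "q * m + 2 * m \<le> n" if "q \<le> K div m" for q
  proof -
    have "q * m \<le> K div m * m"
      using that by simp
    also have "\<dots> \<le> K"
      by simp
    finally show ?thesis
      using m by simp
  qed
  have A_sets: "?A c q \<in> sets M" if "q \<le> K div m" for c q
  proof -
    have "?A c q = {\<omega> \<in> space M. \<exists>j\<in>{..2 * m}. x / 2 \<le> (\<Sum>i<j. c * X (q * m + i) \<omega>)}"
      by auto
    also have "\<dots> \<in> sets M"
      using room[OF that]
      by (intro predE pred_intros_finite pred_const_le borel_measurable_sum borel_measurable_times rv) auto
    finally show ?thesis .
  qed
  have A_prob: "prob (?A c q) \<le> exp (- \<theta> * (x / 2)) * \<rho> ^ (2 * m)" if q: "q \<le> K div m" and c: "c = 1 \<or> c = - 1" for c q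
  proof (rule walk_maximal_inequality)
    have "indep_vars (\<lambda>_. borel) X ((\<lambda>i. q * m + i) ` {..<2 * m})"
      using room[OF q] by (intro indep_vars_subset[OF indep]) auto
    then have "indep_vars (\<lambda>_. borel) (\<lambda>i. X (q * m + i)) {..<2 * m}"
      by (rule indep_vars_reindex) (auto simp: inj_on_def)
    then show "indep_vars (\<lambda>_. borel) (\<lambda>i \<omega>. c * X (q * m + i) \<omega>) {..<2 * m}"
      by (rule indep_vars_compose2) simp
    show "(\<integral>\<^sup>+\<omega>. ennreal (exp (\<theta> * (c * X (q * m + k) \<omega>))) \<partial>M) \<le> ennreal \<rho>" if "k < 2 * m" for k
      using mgf[of "q * m + k"] room[OF q] that c by auto
  qed fact+
  let ?B = "\<Union>q\<in>{..K div m}. ?A 1 q \<union> ?A (- 1) q"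
  have sum_shift: "(\<Sum>i<l. X i \<omega>) = (\<Sum>i<p. X i \<omega>) + (\<Sum>i<l - p. X (p + i) \<omega>)" if "p \<le> l" for p l \<omega>
  proof -
    have "(\<Sum>i<p + d. X i \<omega>) = (\<Sum>i<p. X i \<omega>) + (\<Sum>i<d. X (p + i) \<omega>)" for d
      by (induction d) auto
    from this[of "l - p"] that show ?thesis
      by simp
  qed
  have "{\<omega> \<in> space M. \<exists>k l. k \<le> l \<and> l \<le> k + m \<and> l \<le> K \<and> x < (\<Sum>i<l. X i \<omega>) - (\<Sum>i<k. X i \<omega>)} \<subseteq> ?B"
  proof safe
    fix \<omega> k l assume \<omega>: "\<omega> \<in> space M" and kl: "k \<le> l" "l \<le> k + m" "l \<le> K"
      and x: "x < (\<Sum>i<l. X i \<omega>) - (\<Sum>i<k. X i \<omega>)"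
    define q where "q = k div m"
    have q: "q * m \<le> k" "k < q * m + m" "q \<le> K div m"
      using div_mult_mod_eq[of k m] mod_less_divisor[OF m(1), of k] kl
      unfolding q_def by (linarith, linarith, intro div_le_mono, linarith)
    have "(\<Sum>i<l. X i \<omega>) - (\<Sum>i<k. X i \<omega>) = (\<Sum>i<l - q * m. X (q * m + i) \<omega>) - (\<Sum>i<k - q * m. X (q * m + i) \<omega>)"
      using sum_shift[of "q * m" l] sum_shift[of "q * m" k] q kl by simp
    with x have "x / 2 \<le> (\<Sum>i<l - q * m. 1 * X (q * m + i) \<omega>) \<or> x / 2 \<le> (\<Sum>i<k - q * m. - 1 * X (q * m + i) \<omega>)"
      by (simp add: sum_negf) linarith
    moreover have "l - q * m \<le> 2 * m" "k - q * m \<le> 2 * m"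
      using q kl by auto
    ultimately have "\<omega> \<in> ?A 1 q \<union> ?A (- 1) q"
      using \<omega> by blast
    then show "\<omega> \<in> ?B"
      using q(3) by blast
  qed
  then have "prob {\<omega> \<in> space M. \<exists>k l. k \<le> l \<and> l \<le> k + m \<and> l \<le> K \<and> x < (\<Sum>i<l. X i \<omega>) - (\<Sum>i<k. X i \<omega>)} \<le> prob ?B"
    by (rule finite_measure_mono) (intro sets.finite_UN sets.Un A_sets finite_atMost; simp)
  also have "\<dots> \<le> (\<Sum>q\<in>{..K div m}. prob (?A 1 q \<union> ?A (- 1) q))"
    by (intro finite_measure_subadditive_finite finite_atMost image_subsetI sets.Un A_sets) simp_all
  also have "\<dots> \<le> (\<Sum>q\<in>{..K div m}. 2 * (exp (- \<theta> * (x / 2)) * \<rho> ^ (2 * m)))"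
  proof (rule sum_mono)
    fix q assume "q \<in> {..K div m}"
    then have q: "q \<le> K div m"
      by simp
    have "prob (?A 1 q \<union> ?A (- 1) q) \<le> prob (?A 1 q) + prob (?A (- 1) q)"
      by (intro measure_Un_le A_sets q)
    then show "prob (?A 1 q \<union> ?A (- 1) q) \<le> 2 * (exp (- \<theta> * (x / 2)) * \<rho> ^ (2 * m))"
      using A_prob[OF q, of 1] A_prob[OF q, of "- 1"] by linarith
  qed
  also have "\<dots> = 2 * (real (K div m) + 1) * (exp (- \<theta> * (x / 2)) * \<rho> ^ (2 * m))"
    by simp
  finally show ?thesis .
qed

section \<open>Coupling of models with different rates\<close>

definition scaled_weights :: "real \<Rightarrow> real \<Rightarrow> (nat \<times> nat \<Rightarrow> 'a \<Rightarrow> real) \<Rightarrow> nat \<times> nat \<Rightarrow> 'a \<Rightarrow> real" where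
  "scaled_weights x y g p \<omega> = site_rate x y p * g p \<omega>"

lemma (in prob_space) exponential_scale:
  assumes X: "distributed M lborel X (exponential_density 1)" and "0 < l"
  shows "distributed M lborel (\<lambda>\<omega>. 1 / l * X \<omega>) (exponential_density l)"
  unfolding exponential_distributed_iff[OF \<open>0 < l\<close>]
proof (intro conjI allI impI)
  have "X \<in> borel_measurable M"
    using distributed_measurable[OF X] by simp
  then show "(\<lambda>\<omega>. 1 / l * X \<omega>) \<in> borel_measurable M"
    by simp
  fix t :: real assume "0 \<le> t"
  then show "prob {\<omega> \<in> space M. 1 / l * X \<omega> \<le> t} = 1 - exp (- t * l)"
    using exponential_distributedD_le[OF X, of "t * l"] \<open>0 < l\<close> by (simp add: field_simps)
qed

text \<open>One driving family \<open>g\<close> realises all rates at once. As the multipliers are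
  the reciprocal rates, boundary weights are pointwise monotone in the rates, and the bulk is
  shared.\<close>

lemma (in prob_space) exponential_scaled_weights:
  assumes "exponential_weights M 1 1 n g" "0 < a" "0 < b"
  shows "exponential_weights M a b n (scaled_weights (1 / a) (1 / b) g)"
  unfolding exponential_weights_def
proof (intro conjI ballI)
  have "indep_vars (\<lambda>_. borel) (\<lambda>p \<omega>. site_rate (1 / a) (1 / b) p * g p \<omega>) (sites n)"
    by (rule indep_vars_compose2[where M' = "\<lambda>_. borel"])
      (use assms in \<open>auto simp: exponential_weights_def\<close>)
  then show "indep_vars (\<lambda>_. borel) (scaled_weights (1 / a) (1 / b) g) (sites n)"
    by (simp add: scaled_weights_def[abs_def])
  fix p assume "p \<in> sites n"
  then have "distributed M lborel (g p) (exponential_density 1)"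
    using assms by (auto simp: exponential_weights_def site_rate_def split: if_splits)
  then have "distributed M lborel (\<lambda>\<omega>. 1 / site_rate a b p * g p \<omega>) (exponential_density (site_rate a b p))"
    using assms by (intro exponential_scale site_rate_pos)
  moreover have "1 / site_rate a b p = site_rate (1 / a) (1 / b) p"
    by (simp add: site_rate_def)
  ultimately show "distributed M lborel (scaled_weights (1 / a) (1 / b) g p) (exponential_density (site_rate a b p))"
    by (simp add: scaled_weights_def[abs_def])
qed

text \<open>Along the antidiagonal the stationary passage time is a random walk whose steps are a
  variable of rate \<open>c\<close> minus an independent one of rate \<open>a\<close>. The two
  conditions on \<open>\<rho>\<close> bound the moments of a step and of its negative.\<close>

lemma (in prob_space) stationary_window_bound:
  assumes v: "exponential_weights M a c (2 * n) v" and rates: "0 < a" "0 < c" "a + c = 1"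
    and \<theta>: "0 \<le> \<theta>" "\<theta> < a" "\<theta> < c" and "1 \<le> \<rho>"
    and \<rho>: "c / (c - \<theta>) * (a / (a + \<theta>)) \<le> \<rho>" "c / (c + \<theta>) * (a / (a - \<theta>)) \<le> \<rho>"
    and m: "0 < m" "K + 2 * m \<le> n"
  defines "H \<equiv> \<lambda>k \<omega>. passage (\<lambda>p. v p \<omega>) (n + k) (n - k)"
  shows "prob {\<omega> \<in> space M. \<exists>k l. k \<le> l \<and> l \<le> k + m \<and> l \<le> K \<and> x < H l \<omega> - H k \<omega>} \<le>
      2 * (real (K div m) + 1) * (exp (- \<theta> * (x / 2)) * \<rho> ^ (2 * m))" (is ?up)
    and "prob {\<omega> \<in> space M. \<exists>k l. k \<le> l \<and> l \<le> k + m \<and> l \<le> K \<and> x < H k \<omega> - H l \<omega>} \<le>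
      2 * (real (K div m) + 1) * (exp (- \<theta> * (x / 2)) * \<rho> ^ (2 * m))" (is ?down)
proof -
  let ?I = "\<lambda>k. edge_var v (Row (n + k + 1) (n - k))" and ?J = "\<lambda>k. edge_var v (Col (n + k + 1) (n - k))"
  note anti = antidiagonal_increments_indep[OF v rates]
  \<comment> \<open>The increments are grouped in pairs, one right and one up edge for each step of
    the walk.\<close>
  have indep: "indep_vars (\<lambda>_. borel) (\<lambda>k \<omega>. ?I k \<omega> - ?J k \<omega>) {..<n}"
  proof -
    let ?e = "\<lambda>(b, k). edge_var v (if b then Row (n + k + 1) (n - k) else Col (n + k + 1) (n - k))"
    have "indep_vars (\<lambda>k. PiM (UNIV \<times> {k}) (\<lambda>_. borel)) (\<lambda>k \<omega>. \<lambda>p\<in>UNIV \<times> {k}. ?e p \<omega>) {..<n}"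
      by (rule indep_vars_restrict[OF anti(1)]) (auto simp: disjoint_family_on_def)
    then have "indep_vars (\<lambda>_. borel) (\<lambda>k \<omega>. (\<lambda>p\<in>UNIV \<times> {k}. ?e p \<omega>) (True, k) - (\<lambda>p\<in>UNIV \<times> {k}. ?e p \<omega>) (False, k)) {..<n}"
      by (rule indep_vars_compose2[where Y = "\<lambda>k u. u (True, k) - u (False, k)"]) simp
    then show ?thesis
      by (simp del: edge_var.simps)
  qed
  have pair: "indep_pair borel (?I k) borel (?J k)" if "k < n" for k
    using indep_pair_restrict[OF anti(1), of "{(True, k)}" "{(False, k)}" "\<lambda>u. u (True, k)" borel
        "\<lambda>u. u (False, k)" borel] that by (simp del: edge_var.simps)
  have mgf: "(\<integral>\<^sup>+\<omega>. ennreal (exp (t * (?I k \<omega> - ?J k \<omega>))) \<partial>M) = ennreal (c / (c - t) * (a / (a + t)))"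
    if "k < n" "t < c" "- t < a" for k t
  proof -
    have "(\<integral>\<^sup>+\<omega>. ennreal (exp (t * (?I k \<omega> - ?J k \<omega>))) \<partial>M) =
        (\<integral>\<^sup>+\<omega>. ennreal (exp (t * ?I k \<omega>)) * ennreal (exp (- t * ?J k \<omega>)) \<partial>M)"
      by (intro nn_integral_cong) (simp add: ennreal_mult[symmetric] exp_add[symmetric] algebra_simps)
    also have "\<dots> = (\<integral>\<^sup>+\<omega>. ennreal (exp (t * ?I k \<omega>)) \<partial>M) * (\<integral>\<^sup>+\<omega>. ennreal (exp (- t * ?J k \<omega>)) \<partial>M)"
      by (rule indep_pair_nn_integral[OF pair[OF that(1)]]) simp_all
    also have "(\<integral>\<^sup>+\<omega>. ennreal (exp (t * ?I k \<omega>)) \<partial>M) = ennreal (c / (c - t))"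
      by (rule exponential_mgf[OF anti(2)[OF that(1)] rates(2) that(2)])
    also have "(\<integral>\<^sup>+\<omega>. ennreal (exp (- t * ?J k \<omega>)) \<partial>M) = ennreal (a / (a - - t))"
      by (rule exponential_mgf[OF anti(3)[OF that(1)] rates(1) that(3)])
    finally show ?thesis
      using that rates by (simp add: ennreal_mult[symmetric])
  qed
  have H_sum: "H k \<omega> = H 0 \<omega> + (\<Sum>i<k. ?I i \<omega> - ?J i \<omega>)" if "k \<le> n" for k \<omega>
    using that
  proof (induction k)
    case (Suc k)
    then show ?case
      using antidiagonal_step[of k n "passage (\<lambda>p. v p \<omega>)"] by (simp add: H_def Suc_diff_Suc)
  qed simp
  have H_diff: "H l \<omega> - H k \<omega> = (\<Sum>i<l. ?I i \<omega> - ?J i \<omega>) - (\<Sum>i<k. ?I i \<omega> - ?J i \<omega>)" if "k \<le> l" "l \<le> K" for k l \<omega>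
    using H_sum[of k \<omega>] H_sum[of l \<omega>] that m by simp
  have mgf_le: "(\<integral>\<^sup>+\<omega>. ennreal (exp (\<theta> * (?I k \<omega> - ?J k \<omega>))) \<partial>M) \<le> ennreal \<rho>"
      "(\<integral>\<^sup>+\<omega>. ennreal (exp (\<theta> * - (?I k \<omega> - ?J k \<omega>))) \<partial>M) \<le> ennreal \<rho>" if "k < n" for k
  proof -
    have "(\<integral>\<^sup>+\<omega>. ennreal (exp (\<theta> * (?I k \<omega> - ?J k \<omega>))) \<partial>M) = ennreal (c / (c - \<theta>) * (a / (a + \<theta>)))"
      using \<theta> rates by (intro mgf that) auto
    also have "\<dots> \<le> ennreal \<rho>"
      by (intro ennreal_leI \<rho>)
    finally show "(\<integral>\<^sup>+\<omega>. ennreal (exp (\<theta> * (?I k \<omega> - ?J k \<omega>))) \<partial>M) \<le> ennreal \<rho>" .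
    have "(\<integral>\<^sup>+\<omega>. ennreal (exp (\<theta> * - (?I k \<omega> - ?J k \<omega>))) \<partial>M) =
        (\<integral>\<^sup>+\<omega>. ennreal (exp (- \<theta> * (?I k \<omega> - ?J k \<omega>))) \<partial>M)"
      by (simp only: minus_mult_commute)
    also have "\<dots> = ennreal (c / (c - - \<theta>) * (a / (a + - \<theta>)))"
      using \<theta> rates by (intro mgf that) auto
    also have "\<dots> \<le> ennreal \<rho>"
      using \<rho>(2) by (intro ennreal_leI) simp
    finally show "(\<integral>\<^sup>+\<omega>. ennreal (exp (\<theta> * - (?I k \<omega> - ?J k \<omega>))) \<partial>M) \<le> ennreal \<rho>" .
  qed
  have eq: "k \<le> l \<and> l \<le> k + m \<and> l \<le> K \<and> x < H l \<omega> - H k \<omega> \<longleftrightarrow> k \<le> l \<and> l \<le> k + m \<and> l \<le> K \<and>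
      x < (\<Sum>i<l. ?I i \<omega> - ?J i \<omega>) - (\<Sum>i<k. ?I i \<omega> - ?J i \<omega>)" for k l \<omega>
  proof (cases "k \<le> l \<and> l \<le> K")
    case True
    then show ?thesis
      using H_diff[of k l \<omega>] by (simp del: edge_var.simps)
  qed auto
  show ?up
    unfolding eq by (rule walk_window_bound[OF indep mgf_le \<open>1 \<le> \<rho>\<close> \<theta>(1) m])
  have indep': "indep_vars (\<lambda>_. borel) (\<lambda>k \<omega>. - (?I k \<omega> - ?J k \<omega>)) {..<n}"
    by (rule indep_vars_compose2[OF indep]) simp
  have mgf_le': "(\<integral>\<^sup>+\<omega>. ennreal (exp (\<theta> * - (- (?I k \<omega> - ?J k \<omega>)))) \<partial>M) \<le> ennreal \<rho>" if "k < n" for k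
    using mgf_le(1)[OF that] by simp
  have eq': "k \<le> l \<and> l \<le> k + m \<and> l \<le> K \<and> x < H k \<omega> - H l \<omega> \<longleftrightarrow> k \<le> l \<and> l \<le> k + m \<and> l \<le> K \<and>
      x < (\<Sum>i<l. - (?I i \<omega> - ?J i \<omega>)) - (\<Sum>i<k. - (?I i \<omega> - ?J i \<omega>))" for k l \<omega>
  proof (cases "k \<le> l \<and> l \<le> K")
    case True
    then have "H l \<omega> - H k \<omega> = (\<Sum>i<l. ?I i \<omega> - ?J i \<omega>) - (\<Sum>i<k. ?I i \<omega> - ?J i \<omega>)"
      by (intro H_diff) auto
    then have "H k \<omega> - H l \<omega> = (\<Sum>i<l. - (?I i \<omega> - ?J i \<omega>)) - (\<Sum>i<k. - (?I i \<omega> - ?J i \<omega>))"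
      unfolding sum_negf by linarith
    then show ?thesis
      by (simp only:)
  qed auto
  show ?down
    unfolding eq' by (rule walk_window_bound[OF indep' mgf_le(2) mgf_le' \<open>1 \<le> \<rho>\<close> \<theta>(1) m])
qed

text \<open>The factor \<open>0\<close> removes the weights of the bottom row, as in the point-to-point model.\<close>

definition pp_scaled :: "real \<Rightarrow> (nat \<times> nat \<Rightarrow> 'a \<Rightarrow> real) \<Rightarrow> nat \<Rightarrow> nat \<Rightarrow> 'a \<Rightarrow> real" where
  "pp_scaled r g n k \<omega> = passage (\<lambda>p. scaled_weights (1 / r) 0 g p \<omega>) (n + k) (n - k)"

text \<open>Upwards increments are dominated by those of the stationary model with the same diagonal rate
  \<open>r\<close>, downwards increments by those of the stationary model with a smaller diagonal rate \<open>a\<close>,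
  provided that the maximal paths of the model with rates \<open>a\<close>, \<open>b\<close> visit the diagonal. The model with
  rates \<open>e\<close>, \<open>e\<close> dominates the paths that do not.\<close>

lemma (in prob_space) pp_window_bound:
  assumes g: "exponential_weights M 1 1 (2 * n) g" and nonneg: "\<And>p \<omega>. 0 \<le> g p \<omega>"
    and r: "0 < r" "r < 1" and a: "0 < a" "a < 1" "a \<le> r" and b: "0 < b" "a + b < 1"
    and e: "1/2 < e" "e < 1" "e \<le> b"
    and \<theta>: "0 \<le> \<theta>" "1 \<le> \<rho>"
      "\<And>t. t \<in> {a, r} \<Longrightarrow> \<theta> < t \<and> \<theta> < 1 - t \<and> (1 - t) / (1 - t - \<theta>) * (t / (t + \<theta>)) \<le> \<rho> \<and>
         (1 - t) / (1 - t + \<theta>) * (t / (t - \<theta>)) \<le> \<rho>"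
    and m: "0 < m" "K + 2 * m \<le> n" "0 < n"
  shows "prob {\<omega> \<in> space M. \<exists>k l. k \<le> l \<and> l \<le> k + m \<and> l \<le> K \<and>
            x < \<bar>pp_scaled r g n l \<omega> - pp_scaled r g n k \<omega>\<bar>} \<le>
      exp ((1 - a - b) * y) * ((b / (1 - a)) ^ (n + K) * (a / (1 - b)) ^ (n - K)) +
      exp (- (2 * e - 1) * y) * (e / (1 - e)) ^ (2 * n) +
      4 * (real (K div m) + 1) * (exp (- \<theta> * (x / 2)) * \<rho> ^ (2 * m))"
proof -
  define W where "W u v k \<omega> = passage (\<lambda>p. scaled_weights (1 / u) (1 / v) g p \<omega>) (n + k) (n - k)" for u v k \<omega>
  have weights: "exponential_weights M u v (2 * n) (scaled_weights (1 / u) (1 / v) g)" if "0 < u" "0 < v" for u v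
    using that by (intro exponential_scaled_weights g)
  have W_measurable: "W u v k \<in> borel_measurable M" if "0 < u" "0 < v" "k \<le> n" for u v k
    unfolding W_def[abs_def]
    by (rule passage_measurable[where n = "2 * n"])
      (use weights[OF that(1,2)] that in \<open>auto simp: exponential_weights_def indep_vars_def\<close>)
  have bulk: "scaled_weights u v g (i, j) \<omega> = scaled_weights u' v' g (i, j) \<omega>" if "0 < j" "j < i" for u v u' v' i j \<omega>
    using that by (simp add: scaled_weights_def site_rate_def)
  have row: "scaled_weights u v g (i, 0) \<omega> \<le> scaled_weights u' v' g (i, 0) \<omega>" if "v \<le> v'" for u v u' v' i \<omega>
    using that nonneg[of "(i, 0)" \<omega>] by (simp add: scaled_weights_def site_rate_def mult_right_mono)
  have diag: "scaled_weights u v g (i, i) \<omega> \<le> scaled_weights u' v' g (i, i) \<omega>" if "u \<le> u'" "0 < i" for u v u' v' i \<omega>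
    using that nonneg[of "(i, i)" \<omega>] by (simp add: scaled_weights_def site_rate_def mult_right_mono)
  \<comment> \<open>As \<open>a + b < 1\<close> and \<open>e > 1/2\<close>, these are a lower and an
    upper tail. Outside both, the threshold \<open>y\<close> separates the two passage times at the
    far end \<open>K\<close>, which is the strict inequality that certifies a visit to the
    diagonal.\<close>
  define Low where "Low = {\<omega> \<in> space M. (a + b - 1) * y \<le> (a + b - 1) * passage (\<lambda>p. scaled_weights (1 / a) (1 / b) g p \<omega>) (n + K) (n - K)}"
  define High where "High = {\<omega> \<in> space M. (e + e - 1) * y \<le> (e + e - 1) * passage (\<lambda>p. scaled_weights (1 / e) (1 / e) g p \<omega>) (n + K) (n - K)}"
  define Up where "Up = {\<omega> \<in> space M. \<exists>k l. k \<le> l \<and> l \<le> k + m \<and> l \<le> K \<and> x < W r (1 - r) l \<omega> - W r (1 - r) k \<omega>}"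
  define Down where "Down = {\<omega> \<in> space M. \<exists>k l. k \<le> l \<and> l \<le> k + m \<and> l \<le> K \<and> x < W a (1 - a) k \<omega> - W a (1 - a) l \<omega>}"
  define Bad where "Bad = {\<omega> \<in> space M. \<exists>k l. k \<le> l \<and> l \<le> k + m \<and> l \<le> K \<and>
            x < \<bar>pp_scaled r g n l \<omega> - pp_scaled r g n k \<omega>\<bar>}"
  have windows: "{\<omega> \<in> space M. \<exists>k l. k \<le> l \<and> l \<le> k + m \<and> l \<le> K \<and> x < F l k \<omega>} \<in> sets M"
    if [measurable]: "\<And>l k. l \<le> K \<Longrightarrow> k \<le> K \<Longrightarrow> F l k \<in> borel_measurable M" for F
  proof -
    have "{\<omega> \<in> space M. \<exists>k l. k \<le> l \<and> l \<le> k + m \<and> l \<le> K \<and> x < F l k \<omega>} =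
        (\<Union>k\<in>{..K}. \<Union>l\<in>{k..min K (k + m)}. {\<omega> \<in> space M. x < F l k \<omega>})" (is "?L = ?R")
    proof (intro equalityI subsetI)
      fix \<omega> assume "\<omega> \<in> ?L"
      then obtain k l where "k \<le> l" "l \<le> k + m" "l \<le> K" "x < F l k \<omega>" "\<omega> \<in> space M"
        by blast
      then show "\<omega> \<in> ?R"
        by (intro UN_I[of k] UN_I[of l]) auto
    next
      fix \<omega> assume "\<omega> \<in> ?R"
      then obtain k l where "k \<le> l" "l \<le> min K (k + m)" "x < F l k \<omega>" "\<omega> \<in> space M"
        by auto
      then show "\<omega> \<in> ?L"
        by auto
    qed
    also have "\<dots> \<in> sets M"
      by (intro sets.finite_UN) auto
    finally show ?thesis .
  qed
  have sets: "Up \<in> sets M" "Down \<in> sets M"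
    unfolding Up_def Down_def using r a m by (intro windows borel_measurable_diff W_measurable; simp)+
  have lh_sets: "Low \<in> sets M" "High \<in> sets M"
  proof -
    have [measurable]: "W a b K \<in> borel_measurable M" "W e e K \<in> borel_measurable M"
      using a b e m by (simp_all add: W_measurable)
    have "{\<omega> \<in> space M. (a + b - 1) * y \<le> (a + b - 1) * W a b K \<omega>} \<in> sets M"
      "{\<omega> \<in> space M. (e + e - 1) * y \<le> (e + e - 1) * W e e K \<omega>} \<in> sets M"
      by measurable
    then show "Low \<in> sets M" "High \<in> sets M"
      by (simp_all only: W_def Low_def High_def)
  qed
  have "Bad \<subseteq> Low \<union> High \<union> (Up \<union> Down)"
  proof
    fix \<omega> assume "\<omega> \<in> Bad"
    then obtain k l where \<omega>: "\<omega> \<in> space M" and kl: "k \<le> l" "l \<le> k + m" "l \<le> K"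
      and x: "x < \<bar>pp_scaled r g n l \<omega> - pp_scaled r g n k \<omega>\<bar>"
      unfolding Bad_def by blast
    \<comment> \<open>Same diagonal, and a bottom row of zeros against a nonnegative one.\<close>
    have up: "pp_scaled r g n l \<omega> - pp_scaled r g n k \<omega> \<le> W r (1 - r) l \<omega> - W r (1 - r) k \<omega>"
      unfolding pp_scaled_def W_def
      using kl m r by (intro passage_compare_antidiagonal bulk row diag) auto
    have down: "W a (1 - a) l \<omega> - W a (1 - a) k \<omega> \<le> pp_scaled r g n l \<omega> - pp_scaled r g n k \<omega>"
      if "\<omega> \<notin> Low \<union> High"
    proof -
      have "passage (\<lambda>p. scaled_weights (1 / e) (1 / e) g p \<omega>) (n + K) (n - K) < y"
        using that \<omega> e by (auto simp: High_def not_le mult_less_cancel_left)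
      moreover have "y < passage (\<lambda>p. scaled_weights (1 / a) (1 / b) g p \<omega>) (n + K) (n - K)"
        using that \<omega> a b by (auto simp: Low_def not_le mult_less_cancel_left)
      ultimately have less: "passage (\<lambda>p. scaled_weights (1 / e) (1 / e) g p \<omega>) (n + K) (n - K) <
          passage (\<lambda>p. scaled_weights (1 / a) (1 / b) g p \<omega>) (n + K) (n - K)"
        by linarith
      \<comment> \<open>The bulk is shared, and \<open>e \<le> b\<close> makes the bottom row of the
        model with rates \<open>e\<close> the larger one.\<close>
      have off_diagonal: "scaled_weights (1 / a) (1 / b) g (i, j) \<omega> \<le> scaled_weights (1 / e) (1 / e) g (i, j) \<omega>"
        if "j < i" for i j
      proof (cases "j = 0")
        case True
        then show ?thesis
          using b e by (simp add: row frac_le)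
      qed (use that bulk[of j i "1 / a" "1 / b" \<omega> "1 / e" "1 / e"] in simp)
      \<comment> \<open>First the bottom row is enlarged from rate \<open>1 - a\<close> to
        \<open>b < 1 - a\<close>, which only increases the increments. Then the model with rates
        \<open>a\<close> and \<open>b\<close> is compared with the point-to-point model across the
        visited diagonal, where \<open>1 / r \<le> 1 / a\<close> is the ordering required.\<close>
      have "W a (1 - a) l \<omega> - W a (1 - a) k \<omega> \<le> W a b l \<omega> - W a b k \<omega>"
        unfolding W_def using kl m a b
        by (intro passage_compare_antidiagonal bulk row diag) (auto intro: frac_le)
      also have "\<dots> \<le> pp_scaled r g n l \<omega> - pp_scaled r g n k \<omega>"
        unfolding W_def pp_scaled_def
      proof (rule passage_compare_antidiagonal_diag[OF bulk diag off_diagonal less kl(1,3)])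
        show "1 / r \<le> 1 / a"
          using a by (intro frac_le) auto
      qed (use m in auto)
      finally show ?thesis .
    qed
    show "\<omega> \<in> Low \<union> High \<union> (Up \<union> Down)"
    proof (cases "\<omega> \<in> Low \<union> High")
      case False
      have "x < W r (1 - r) l \<omega> - W r (1 - r) k \<omega> \<or> x < W a (1 - a) k \<omega> - W a (1 - a) l \<omega>"
        using up down[OF False] x by linarith
      then show ?thesis
        using \<omega> kl unfolding Up_def Down_def by blast
    qed blast
  qed
  then have "prob Bad \<le> prob (Low \<union> High \<union> (Up \<union> Down))"
    using sets lh_sets by (intro finite_measure_mono) auto
  also have "\<dots> \<le> (prob Low + prob High) + (prob Up + prob Down)"
    using sets lh_sets
    by (intro order_trans[OF measure_Un_le] add_mono measure_Un_le) auto
  also have "prob Low \<le> exp (- (a + b - 1) * y) * ((b / (1 - a)) ^ (n + K) * (a / (1 - b)) ^ (n - K))"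
    unfolding Low_def
  proof (rule passage_tail)
    show "exponential_weights M a b (n + K) (scaled_weights (1 / a) (1 / b) g)"
      using weights[OF a(1) b(1)] m unfolding exponential_weights_def
      by (auto intro: indep_vars_subset simp: sites_def)
  qed (use a b m in auto)
  also have "prob High \<le> exp (- (e + e - 1) * y) * ((e / (1 - e)) ^ (n + K) * (e / (1 - e)) ^ (n - K))"
    unfolding High_def
  proof (rule passage_tail)
    show "exponential_weights M e e (n + K) (scaled_weights (1 / e) (1 / e) g)"
      using weights[of e e] e m unfolding exponential_weights_def
      by (auto intro: indep_vars_subset simp: sites_def)
  qed (use e m in auto)
  also have "(e / (1 - e)) ^ (n + K) * (e / (1 - e)) ^ (n - K) = (e / (1 - e)) ^ (2 * n)"
    unfolding power_add[symmetric] using m by (intro arg_cong[where f = "power _"]) simp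
  also have "prob Up \<le> 2 * (real (K div m) + 1) * (exp (- \<theta> * (x / 2)) * \<rho> ^ (2 * m))"
    unfolding Up_def W_def using r \<theta>(3)[of r] m
    by (intro stationary_window_bound(1)[OF weights _ _ _ \<theta>(1) _ _ \<theta>(2)]) auto
  also have "prob Down \<le> 2 * (real (K div m) + 1) * (exp (- \<theta> * (x / 2)) * \<rho> ^ (2 * m))"
    unfolding Down_def W_def using a \<theta>(3)[of a] m
    by (intro stationary_window_bound(2)[OF weights _ _ _ \<theta>(1) _ _ \<theta>(2)]) auto
  finally show ?thesis
    by (simp add: Bad_def algebra_simps)
qed

section \<open>Estimates for rates close to one half\<close>

lemma ln_ratio_diff_ge:
  fixes x y :: real
  assumes "0 \<le> y" "y \<le> x" "x < 1"
  shows "2 * (x - y) + 2 / 3 * (x ^ 3 - y ^ 3) \<le> (ln (1 + x) - ln (1 - x)) - (ln (1 + y) - ln (1 - y))"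
proof -
  \<comment> \<open>The odd power series of the logarithm without its first two terms, which has
    positive coefficients. The cubic term is kept in the bound because it contributes at order one
    when \<open>n * s ^ 3 = 1\<close>.\<close>
  let ?f = "\<lambda>x. ln (1 + x) - ln (1 - x) - 2 * x - 2 / 3 * x ^ 3"
  have "?f y \<le> ?f x"
  proof (rule DERIV_nonneg_imp_nondecreasing[OF \<open>y \<le> x\<close>])
    fix t assume t: "y \<le> t" "t \<le> x"
    then have t': "0 \<le> t" "t < 1"
      using assms by auto
    then have t2: "t\<^sup>2 < 1"
      by (simp add: power_less_one_iff abs_square_less_1)
    have deriv: "(?f has_real_derivative 1 / (1 + t) - (- 1) / (1 - t) - 2 - 2 / 3 * (3 * t\<^sup>2)) (at t)"
      using t' by (auto intro!: derivative_eq_intros simp: power2_eq_square)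
    have eq: "1 / (1 + t) - (- 1) / (1 - t) - 2 - 2 / 3 * (3 * t\<^sup>2) = 2 * (t\<^sup>2)\<^sup>2 / (1 - t\<^sup>2)"
      using t' t2 by (simp add: field_simps) (simp add: power2_eq_square algebra_simps)
    have nonneg: "0 \<le> 2 * (t\<^sup>2)\<^sup>2 / (1 - t\<^sup>2)"
      using t2 by simp
    show "\<exists>d. (?f has_real_derivative d) (at t) \<and> 0 \<le> d"
      using deriv nonneg unfolding eq by blast
  qed
  then show ?thesis
    by (simp add: algebra_simps)
qed

text \<open>The cubic coefficient is raised from \<open>2/3\<close> to 1 to absorb all higher terms
  on the given range.\<close>

lemma ln_ratio_le:
  fixes x :: real
  assumes "0 \<le> x" "x \<le> 1/2"
  shows "ln (1 + x) - ln (1 - x) \<le> 2 * x + x ^ 3"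
proof -
  let ?f = "\<lambda>x. 2 * x + x ^ 3 - (ln (1 + x) - ln (1 - x))"
  have "?f 0 \<le> ?f x"
  proof (rule DERIV_nonneg_imp_nondecreasing[OF \<open>0 \<le> x\<close>])
    fix t assume t: "0 \<le> t" "t \<le> x"
    have "t * t \<le> 1/2 * (1/2)"
      using t assms by (intro mult_mono) auto
    then have t2: "t\<^sup>2 \<le> 1/4"
      by (simp add: power2_eq_square)
    have deriv: "(?f has_real_derivative 2 + 3 * t\<^sup>2 - (1 / (1 + t) - (- 1) / (1 - t))) (at t)"
      using t assms by (auto intro!: derivative_eq_intros simp: power2_eq_square)
    have eq: "2 + 3 * t\<^sup>2 - (1 / (1 + t) - (- 1) / (1 - t)) = t\<^sup>2 * (1 - 3 * t\<^sup>2) / (1 - t\<^sup>2)"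
    proof -
      have "1 / (1 + t) - (- 1) / (1 - t) = 2 / ((1 + t) * (1 - t))"
        using t assms by (simp add: field_simps)
      also have "(1 + t) * (1 - t) = 1 - t\<^sup>2"
        by (simp add: power2_eq_square algebra_simps)
      finally have *: "1 / (1 + t) - (- 1) / (1 - t) = 2 / (1 - t\<^sup>2)" .
      have "2 + 3 * w - 2 / (1 - w) = w * (1 - 3 * w) / (1 - w)" if "w < 1" for w :: real
        using that by (simp add: field_simps)
      from this[of "t\<^sup>2"] t2 show ?thesis
        unfolding * by simp
    qed
    have nonneg: "0 \<le> t\<^sup>2 * (1 - 3 * t\<^sup>2) / (1 - t\<^sup>2)"
      using t2 by (intro divide_nonneg_nonneg mult_nonneg_nonneg) auto
    show "\<exists>d. (?f has_real_derivative d) (at t) \<and> 0 \<le> d"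
      using deriv nonneg unfolding eq by blast
  qed
  then show ?thesis
    by simp
qed

lemma inverse_le_exp:
  fixes u :: real
  assumes "0 \<le> u" "u \<le> 1/2"
  shows "1 / (1 - u) \<le> exp (2 * u)"
proof -
  have "u * u \<le> u * (1/2)"
    using assms by (intro mult_left_mono) auto
  then have "1 \<le> (1 - u) * (1 + 2 * u)"
    by (simp add: algebra_simps)
  also have "\<dots> \<le> (1 - u) * exp (2 * u)"
    using assms exp_ge_add_one_self[of "2 * u"] by (intro mult_left_mono) auto
  finally show ?thesis
    using assms by (simp add: divide_le_eq mult.commute)
qed

text \<open>Both products have the form \<open>D / (D - E)\<close> with
  \<open>D = t * (1 - t)\<close>, bounded away from 0, and \<open>E\<close> equal to
  \<open>\<theta>\<^sup>2\<close> plus or minus \<open>\<theta> * (2 * t - 1)\<close>. Near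
  \<open>t = 1/2\<close> the steps are almost centred, so the linear part is small too.\<close>

lemma increment_mgf_le:
  fixes t \<theta> z :: real
  assumes t: "3/8 \<le> t" "t \<le> 5/8" and \<theta>: "0 \<le> \<theta>" "\<theta> \<le> 1/8"
    and z: "\<theta> * \<bar>2 * t - 1\<bar> + \<theta>\<^sup>2 \<le> z" "z \<le> 1/16"
  shows "(1 - t) / (1 - t - \<theta>) * (t / (t + \<theta>)) \<le> exp (16 * z)"
    and "(1 - t) / (1 - t + \<theta>) * (t / (t - \<theta>)) \<le> exp (16 * z)"
proof -
  define D where "D = t * (1 - t)"
  have "0 \<le> (t - 3/8) * (5/8 - t)"
    using t by simp
  then have D: "1/8 \<le> D"
    by (simp add: D_def algebra_simps)
  have z0: "0 \<le> z"
    using z(1) \<theta> by (smt (verit) mult_nonneg_nonneg zero_le_power2)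
  have main: "D / (D - E) \<le> exp (16 * z)" if "E \<le> z" for E
  proof -
    have "z \<le> 8 * z * D"
      using mult_left_mono[OF D, of "8 * z"] z0 by simp
    then have "D * (1 - 8 * z) \<le> D - E"
      using that by (simp add: algebra_simps)
    moreover have "0 < D * (1 - 8 * z)"
      using D z by simp
    ultimately have "D / (D - E) \<le> D / (D * (1 - 8 * z))"
      using D z that by (intro divide_left_mono mult_pos_pos) auto
    also have "\<dots> = 1 / (1 - 8 * z)"
      using D by simp
    also have "\<dots> \<le> exp (2 * (8 * z))"
      using z z0 by (intro inverse_le_exp) auto
    finally show ?thesis
      by simp
  qed
  have abs: "\<theta> * (2 * t - 1) \<le> \<theta> * \<bar>2 * t - 1\<bar>" "\<theta> * (1 - 2 * t) \<le> \<theta> * \<bar>2 * t - 1\<bar>"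
    using \<theta> by (intro mult_left_mono; simp)+
  have "(1 - t) / (1 - t - \<theta>) * (t / (t + \<theta>)) = D / (D - (\<theta> * (2 * t - 1) + \<theta>\<^sup>2))"
    unfolding times_divide_times_eq D_def
    by (rule arg_cong2[where f = "(/)"]) (simp_all add: algebra_simps power2_eq_square)
  also have "\<dots> \<le> exp (16 * z)"
    using abs z by (intro main) linarith
  finally show "(1 - t) / (1 - t - \<theta>) * (t / (t + \<theta>)) \<le> exp (16 * z)" .
  have "(1 - t) / (1 - t + \<theta>) * (t / (t - \<theta>)) = D / (D - (\<theta> * (1 - 2 * t) + \<theta>\<^sup>2))"
    unfolding times_divide_times_eq D_def
    by (rule arg_cong2[where f = "(/)"]) (simp_all add: algebra_simps power2_eq_square)
  also have "\<dots> \<le> exp (16 * z)"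
    using abs z by (intro main) linarith
  finally show "(1 - t) / (1 - t + \<theta>) * (t / (t - \<theta>)) \<le> exp (16 * z)" .
qed

text \<open>The linear term \<open>- 4 * n * s\<close> offsets the centring \<open>4 * n\<close> at
  exponent \<open>- s\<close>. The cubic term carries the gain, since
  \<open>R ^ 3 - (R - 1) ^ 3 = 3 * R\<^sup>2 - 3 * R + 1\<close> is quadratic in \<open>R\<close>,
  while the displacement \<open>K\<close> from the diagonal costs only a multiple of
  \<open>R * T\<close>.\<close>

lemma lower_tail_factor_le:
  fixes s R T :: real
  assumes s: "0 < s" "real n * s ^ 3 = 1" and R: "2 \<le> R" "R * s \<le> 1/8"
    and K: "K \<le> n" "real K * s\<^sup>2 \<le> T"
  defines "a \<equiv> 1/2 - R * s" and "b \<equiv> 1/2 + (R - 1) * s"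
  shows "(b / (1 - a)) ^ (n + K) * (a / (1 - b)) ^ (n - K) \<le>
    exp (- 4 * real n * s - 16/3 * (3 * R\<^sup>2 - 3 * R + 1) + 8 * (2 * R - 1) * T)"
proof -
  define x y where "x = 2 * R * s" and "y = 2 * (R - 1) * s"
  have s8: "s \<le> R * s"
    using R s mult_right_mono[of 1 R s] by simp
  have xy: "0 \<le> y" "y \<le> x" "x \<le> 1/4"
    using R s by (auto simp: x_def y_def algebra_simps)
  have ab: "b / (1 - a) = (1 + y) / (1 + x)" "a / (1 - b) = (1 - x) / (1 - y)"
    using xy unfolding a_def b_def x_def y_def by (auto simp: divide_simps) (simp_all add: algebra_simps)
  let ?P = "b / (1 - a)" and ?Q = "a / (1 - b)"
  have pos: "0 < ?P" "0 < ?Q"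
    unfolding ab using xy by auto
  have "P ^ (n + K) * Q ^ (n - K) = (P * Q) ^ n * (P / Q) ^ K" if "0 < P" "0 < Q" for P Q :: real
  proof -
    obtain d where "n = K + d"
      using K le_Suc_ex by blast
    then show ?thesis
      using that by (simp add: power_add power_mult_distrib power_divide field_simps)
  qed
  \<comment> \<open>This separates the diagonal direction, of length \<open>n\<close>, from the
    displacement \<open>K\<close>.\<close>
  then have eq: "?P ^ (n + K) * ?Q ^ (n - K) = (?P * ?Q) ^ n * (?P / ?Q) ^ K"
    using pos by blast
  have n_le: "(?P * ?Q) ^ n \<le> exp (- 4 * real n * s - 16/3 * (3 * R\<^sup>2 - 3 * R + 1))"
  proof -
    have "ln (?P * ?Q) = (ln (1 + y) - ln (1 - y)) - (ln (1 + x) - ln (1 - x))"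
      unfolding ab using xy by (simp add: ln_mult ln_div)
    also have "\<dots> \<le> - (2 * (x - y) + 2 / 3 * (x ^ 3 - y ^ 3))"
      using ln_ratio_diff_ge[of y x] xy by simp
    also have "\<dots> = - (4 * s + 16/3 * (3 * R\<^sup>2 - 3 * R + 1) * s ^ 3)"
      by (simp add: x_def y_def power3_eq_cube power2_eq_square algebra_simps)
    finally have "real n * ln (?P * ?Q) \<le> real n * - (4 * s + 16/3 * (3 * R\<^sup>2 - 3 * R + 1) * s ^ 3)"
      by (intro mult_left_mono) auto
    also have "\<dots> = - 4 * real n * s - 16/3 * (3 * R\<^sup>2 - 3 * R + 1) * (real n * s ^ 3)"
      by (simp add: algebra_simps)
    finally have le: "real n * ln (?P * ?Q) \<le> - 4 * real n * s - 16/3 * (3 * R\<^sup>2 - 3 * R + 1)"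
      unfolding s(2) by simp
    have "x ^ n = exp (real n * ln x)" if "0 < x" for x :: real
      using that by (simp add: exp_of_nat_mult)
    then have "(?P * ?Q) ^ n = exp (real n * ln (?P * ?Q))"
      using mult_pos_pos[OF pos] by blast
    then show ?thesis
      using le by simp
  qed
  have K_le: "(?P / ?Q) ^ K \<le> exp (8 * (2 * R - 1) * T)"
  proof -
    have x2: "x\<^sup>2 \<le> 1/2"
    proof -
      have "x * x \<le> 1/4 * (1/4)"
        using xy by (intro mult_mono) auto
      then show ?thesis
        by (simp add: power2_eq_square)
    qed
    have "?P / ?Q = (1 - y\<^sup>2) / (1 - x\<^sup>2)"
      unfolding ab using xy by (simp add: power2_eq_square algebra_simps)
    also have "\<dots> = 1 + (x\<^sup>2 - y\<^sup>2) / (1 - x\<^sup>2)"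
      using x2 by (simp add: field_simps)
    also have "(x\<^sup>2 - y\<^sup>2) / (1 - x\<^sup>2) \<le> (x\<^sup>2 - y\<^sup>2) / (1/2)"
      using x2 xy by (intro divide_left_mono) (auto intro: power_mono)
    also have "\<dots> = 8 * (2 * R - 1) * s\<^sup>2"
      by (simp add: x_def y_def power2_eq_square algebra_simps)
    finally have "?P / ?Q \<le> 1 + 8 * (2 * R - 1) * s\<^sup>2"
      by simp
    also have "\<dots> \<le> exp (8 * (2 * R - 1) * s\<^sup>2)"
      by (rule exp_ge_add_one_self)
    finally have "(?P / ?Q) ^ K \<le> exp (8 * (2 * R - 1) * s\<^sup>2) ^ K"
      by (rule power_mono[OF _ less_imp_le[OF divide_pos_pos[OF pos]]])
    also have "\<dots> = exp (8 * (2 * R - 1) * (real K * s\<^sup>2))"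
      by (simp add: exp_of_nat_mult[symmetric] mult_ac)
    also have "\<dots> \<le> exp (8 * (2 * R - 1) * T)"
      using K R by (intro iffD2[OF exp_le_cancel_iff] mult_left_mono) auto
    finally show ?thesis .
  qed
  show ?thesis
    unfolding eq exp_add
    by (intro mult_mono n_le K_le exp_ge_zero zero_le_power less_imp_le[OF divide_pos_pos[OF pos]])
qed

text \<open>The exponent is \<open>2 * n\<close> times \<open>4 * s + 8 * s ^ 3\<close>, and
  \<open>n * s ^ 3 = 1\<close> turns the cubic part into the constant 16.\<close>

lemma upper_tail_factor_le:
  fixes s :: real
  assumes s: "0 < s" "s \<le> 1/16" "real n * s ^ 3 = 1"
  defines "e \<equiv> 1/2 + s"
  shows "(e / (1 - e)) ^ (2 * n) \<le> exp (8 * real n * s + 16)"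
proof -
  have e: "e / (1 - e) = (1 + 2 * s) / (1 - 2 * s)"
    using s by (simp add: e_def field_simps)
  have pos: "0 < e / (1 - e)"
    unfolding e using s by simp
  have "ln (e / (1 - e)) \<le> 2 * (2 * s) + (2 * s) ^ 3"
    unfolding e using ln_ratio_le[of "2 * s"] s by (simp add: ln_div)
  then have "real (2 * n) * ln (e / (1 - e)) \<le> real (2 * n) * (2 * (2 * s) + (2 * s) ^ 3)"
    by (intro mult_left_mono) auto
  also have "\<dots> = 8 * real n * s + 16 * (real n * s ^ 3)"
    by (simp add: power3_eq_cube algebra_simps)
  finally have "real (2 * n) * ln (e / (1 - e)) \<le> 8 * real n * s + 16"
    unfolding s(3) by simp
  moreover have "(e / (1 - e)) ^ (2 * n) = exp (real (2 * n) * ln (e / (1 - e)))"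
    using pos by (subst exp_of_nat_mult) simp
  ultimately show ?thesis
    by simp
qed

text \<open>With \<open>s = n\<^sup>-\<^sup>1\<^sup>/\<^sup>3\<close>, the window bound is applied at the level \<open>y = 4 n + Y / s\<close>. Paths that avoid the
  diagonal rarely exceed it for large \<open>Y\<close>, whereas the passage time with rates \<open>a = 1/2 - R s\<close> and
  \<open>b = 1/2 + (R - 1) s\<close> exceeds \<open>4 n\<close> by the order \<open>R\<^sup>2 / s\<close>. Finally \<open>q\<close> makes the windows short.\<close>

lemma pp_modulus_small:
  fixes \<sigma> T \<epsilon> \<eta> :: real
  assumes "0 \<le> T" "0 < \<epsilon>" "0 < \<eta>"
  shows "\<exists>q\<ge>1. \<forall>\<^sub>F n in sequentially. let s = real n powr (- 1/3) in nat \<lceil>T / s\<^sup>2\<rceil> \<le> n \<and> (\<forall>(M :: 'a measure) g.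
    prob_space M \<longrightarrow> exponential_weights M 1 1 (2 * n) g \<longrightarrow> (\<forall>p \<omega>. 0 \<le> g p \<omega>) \<longrightarrow>
    measure M {\<omega> \<in> space M. \<exists>k l. k \<le> l \<and> l \<le> k + nat \<lceil>1 / (q * s)\<^sup>2\<rceil> \<and> l \<le> nat \<lceil>T / s\<^sup>2\<rceil> \<and>
      \<epsilon> / s < \<bar>pp_scaled (1/2 + \<sigma> * s) g n l \<omega> - pp_scaled (1/2 + \<sigma> * s) g n k \<omega>\<bar>} \<le> \<eta>)"
proof -
  \<comment> \<open>At level \<open>4 * n + Y / s\<close> and exponent \<open>2 * s\<close>, the
    upper tail is bounded by \<open>exp (16 - 2 * Y)\<close>.\<close>
  define Y where "Y = 8 - ln (\<eta> / 3) / 2"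
  have Y: "exp (16 - 2 * Y) = \<eta> / 3"
    using assms by (simp add: Y_def)
  \<comment> \<open>After expansion the exponent of the lower tail is
    \<open>Y - 16 * R * (R - T - 2)\<close> minus positive constants. The summand
    \<open>T + 3\<close> makes the last factor at least 1; the next two absorb \<open>Y\<close> and
    the target \<open>ln (\<eta> / 3)\<close>; the last one puts \<open>a\<close> below the diagonal
    rate of the model.\<close>
  define R where "R = T + 3 + \<bar>Y\<bar> + \<bar>ln (\<eta> / 3)\<bar> + \<bar>\<sigma>\<bar>"
  have R: "2 \<le> R" "\<bar>\<sigma>\<bar> \<le> R"
    using assms by (auto simp: R_def)
  have R_small: "exp (Y - 16/3 * (3 * R\<^sup>2 - 3 * R + 1) + 8 * (2 * R - 1) * (T + 1)) \<le> \<eta> / 3"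
  proof -
    have "R * 1 \<le> R * (R - T - 2)"
      using R by (intro mult_left_mono) (auto simp: R_def)
    then have "Y - 16/3 * (3 * R\<^sup>2 - 3 * R + 1) + 8 * (2 * R - 1) * (T + 1) \<le> Y - 16 * R"
    proof -
      have "Y - 16/3 * (3 * R\<^sup>2 - 3 * R + 1) + 8 * (2 * R - 1) * (T + 1) =
          Y - 16 * (R * (R - T - 2)) - 16/3 - 8 * T - 8"
        by (simp add: power2_eq_square algebra_simps)
      then show ?thesis
        using \<open>R * 1 \<le> R * (R - T - 2)\<close> assms by linarith
    qed
    also have "\<dots> \<le> ln (\<eta> / 3)"
      using assms by (simp add: R_def)
    finally have "exp (Y - 16/3 * (3 * R\<^sup>2 - 3 * R + 1) + 8 * (2 * R - 1) * (T + 1)) \<le> exp (ln (\<eta> / 3))"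
      by simp
    then show ?thesis
      using assms by simp
  qed
  \<comment> \<open>Bounds \<open>exp (32 * (z * m))\<close> below, where
    \<open>z * m \<le> 2 * (2 * R + 1)\<close>.\<close>
  define C where "C = exp (64 + 128 * R)"
  \<comment> \<open>The number of windows grows like \<open>q\<^sup>2\<close>, whereas the
    probability of each decays exponentially in \<open>q\<close>, uniformly in \<open>n\<close>. The
    substitution \<open>x = q * \<epsilon> / 2\<close> reduces this to a standard limit.\<close>
  obtain q where q: "1 \<le> q" and q_small: "4 * ((T + 1) * q\<^sup>2 + 1) * (exp (- q * (\<epsilon> / 2)) * C) \<le> \<eta> / 3"
  proof -
    have "((\<lambda>x. 4 * C * ((T + 1) * (2 / \<epsilon>)\<^sup>2) * (x ^ 2 / exp x) + 4 * C * (x ^ 0 / exp x)) \<longlongrightarrow>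
        4 * C * ((T + 1) * (2 / \<epsilon>)\<^sup>2) * 0 + 4 * C * 0) at_top"
      by (intro tendsto_intros tendsto_power_div_exp_0)
    then have "\<forall>\<^sub>F x in at_top. 4 * C * ((T + 1) * (2 / \<epsilon>)\<^sup>2) * (x ^ 2 / exp x) + 4 * C * (x ^ 0 / exp x) < \<eta> / 3"
      using assms by (intro order_tendstoD) auto
    moreover have "\<forall>\<^sub>F x in at_top. \<epsilon> / 2 \<le> x"
      by (rule eventually_ge_at_top)
    ultimately have "\<forall>\<^sub>F x in at_top. 4 * C * ((T + 1) * (2 / \<epsilon>)\<^sup>2) * (x ^ 2 / exp x) + 4 * C * (x ^ 0 / exp x) < \<eta> / 3 \<and> \<epsilon> / 2 \<le> x"
      by (rule eventually_conj)
    then obtain x where x: "4 * C * ((T + 1) * (2 / \<epsilon>)\<^sup>2) * (x ^ 2 / exp x) + 4 * C * (x ^ 0 / exp x) < \<eta> / 3" "\<epsilon> / 2 \<le> x"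
      by (auto simp: eventually_at_top_linorder)
    let ?q = "2 / \<epsilon> * x"
    have "4 * ((T + 1) * ?q\<^sup>2 + 1) * (exp (- ?q * (\<epsilon> / 2)) * C) =
        4 * C * ((T + 1) * (2 / \<epsilon>)\<^sup>2) * (x ^ 2 / exp x) + 4 * C * (x ^ 0 / exp x)"
      using assms by (simp add: exp_minus field_simps)
    with x(1) have "4 * ((T + 1) * ?q\<^sup>2 + 1) * (exp (- ?q * (\<epsilon> / 2)) * C) \<le> \<eta> / 3"
      by linarith
    moreover have "1 \<le> ?q"
      using x(2) assms by (simp add: field_simps)
    ultimately show ?thesis
      using that by blast
  qed
  \<comment> \<open>In this order: \<open>a\<close> and the diagonal rate stay near
    \<open>1/2\<close>, the exponent \<open>\<theta>\<close> stays at most \<open>1/8\<close>,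
    \<open>z\<close> stays at most \<open>1/16\<close>, and the windows fit below
    \<open>n\<close>.\<close>
  define s0 where "s0 = min (1 / (8 * R)) (min (1 / (8 * q)) (min (1 / (16 * (q * (2 * R + q)))) (1 / (T + 8))))"
  have "0 < s0"
    using R q assms by (auto simp: s0_def)
  have "(\<lambda>n. real n powr (- 1/3)) \<longlonglongrightarrow> 0"
    by (intro tendsto_neg_powr filterlim_real_sequentially) auto
  then have "\<forall>\<^sub>F n in sequentially. real n powr (- 1/3) < s0"
    by (rule order_tendstoD) fact
  moreover have "\<forall>\<^sub>F n in sequentially. 0 < n"
    by (rule eventually_gt_at_top)
  ultimately have "\<forall>\<^sub>F n in sequentially. let s = real n powr (- 1/3) in nat \<lceil>T / s\<^sup>2\<rceil> \<le> n \<and> (\<forall>(M :: 'a measure) g.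
    prob_space M \<longrightarrow> exponential_weights M 1 1 (2 * n) g \<longrightarrow> (\<forall>p \<omega>. 0 \<le> g p \<omega>) \<longrightarrow>
    measure M {\<omega> \<in> space M. \<exists>k l. k \<le> l \<and> l \<le> k + nat \<lceil>1 / (q * s)\<^sup>2\<rceil> \<and> l \<le> nat \<lceil>T / s\<^sup>2\<rceil> \<and>
      \<epsilon> / s < \<bar>pp_scaled (1/2 + \<sigma> * s) g n l \<omega> - pp_scaled (1/2 + \<sigma> * s) g n k \<omega>\<bar>} \<le> \<eta>)"
  proof eventually_elim
    case (elim n)
    define s where "s = real n powr (- 1/3)"
    have s: "0 < s"
      using elim by (simp add: s_def)
    have ns: "real n * s ^ 3 = 1"
    proof -
      have "s ^ 3 = s powr 3"
        using s powr_realpow[of s 3] by simp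
      also have "\<dots> = real n powr (- 1)"
        unfolding s_def powr_powr by simp
      also have "\<dots> = 1 / real n"
        using elim by (simp add: powr_minus_divide)
      finally show ?thesis
        using elim by simp
    qed
    have "s < 1 / (8 * R)" "s < 1 / (8 * q)" "s < 1 / (16 * (q * (2 * R + q)))" "s < 1 / (T + 8)"
      using elim by (simp_all add: s_def s0_def)
    moreover have "x * s \<le> 1" if "s < 1 / x" "0 < x" for x
      using that by (simp add: field_simps)
    moreover have "0 < q * (2 * R + q)"
      using R q by simp
    ultimately have "8 * R * s \<le> 1" "8 * q * s \<le> 1" "16 * (q * (2 * R + q)) * s \<le> 1" and Ts: "(T + 8) * s \<le> 1"
      using R q assms by (auto simp del: mult.assoc)
    then have Rs: "R * s \<le> 1/8" and qs: "q * s \<le> 1/8" and zs: "q * (2 * R + q) * s \<le> 1/16"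
      by linarith+
    have s16: "s \<le> 1/16"
    proof -
      have "2 * s \<le> R * s"
        using R s by (intro mult_right_mono) auto
      with Rs show ?thesis
        by linarith
    qed
    have s2: "s\<^sup>2 \<le> s"
      using s s16 mult_left_mono[of s 1 s] by (simp add: power2_eq_square)
    define m K where "m = nat \<lceil>1 / (q * s)\<^sup>2\<rceil>" and "K = nat \<lceil>T / s\<^sup>2\<rceil>"
    have qs2: "0 < (q * s)\<^sup>2" "(q * s)\<^sup>2 \<le> 1"
      using q s qs by (auto intro!: power_le_one)
    have ceil: "x \<le> real (nat \<lceil>x\<rceil>) \<and> real (nat \<lceil>x\<rceil>) \<le> x + 1" if "0 \<le> x" for x :: real
    proof -
      have "0 \<le> \<lceil>x\<rceil>"
        using that by simp
      then have "real (nat \<lceil>x\<rceil>) = of_int \<lceil>x\<rceil>"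
        by simp
      then show ?thesis
        using le_of_int_ceiling[of x] of_int_ceiling_le_add_one[of x] by simp
    qed
    have m: "1 / (q * s)\<^sup>2 \<le> real m" "real m \<le> 1 / (q * s)\<^sup>2 + 1"
      unfolding m_def using ceil[of "1 / (q * s)\<^sup>2"] by simp_all
    have K: "T / s\<^sup>2 \<le> real K" "real K \<le> T / s\<^sup>2 + 1"
      unfolding K_def using ceil[of "T / s\<^sup>2"] assms by simp_all
    have m_pos: "0 < m"
    proof -
      have "0 < 1 / (q * s)\<^sup>2"
        using qs2 by simp
      with m(1) show ?thesis
        by linarith
    qed
    have qm: "(q * s)\<^sup>2 * real m \<le> 2"
    proof -
      have "(q * s)\<^sup>2 * real m \<le> (q * s)\<^sup>2 * (1 / (q * s)\<^sup>2 + 1)"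
        using m(2) by (intro mult_left_mono) auto
      also have "\<dots> = 1 + (q * s)\<^sup>2"
        using q s by (simp add: distrib_left)
      finally show ?thesis
        using qs2 by simp
    qed
    have Ks: "real K * s\<^sup>2 \<le> T + 1"
    proof -
      have "real K * s\<^sup>2 \<le> (T / s\<^sup>2 + 1) * s\<^sup>2"
        using K(2) by (intro mult_right_mono) auto
      also have "\<dots> = T + s\<^sup>2"
        using s by (simp add: algebra_simps)
      finally show ?thesis
        using s2 s16 by simp
    qed
    \<comment> \<open>Both lengths are of order \<open>1 / s\<^sup>2\<close>, and
      \<open>n = 1 / s ^ 3\<close>. The slack between 5 and 8 in the bound by \<open>T\<close> is
      harmless.\<close>
    have room: "K + 2 * m \<le> n"
    proof -
      have "1 \<le> q * q"
        using q mult_mono[of 1 q 1 q] by simp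
      then have "s\<^sup>2 \<le> (q * s)\<^sup>2"
        using mult_right_mono[of 1 "q * q" "s * s"] s by (simp add: power2_eq_square mult_ac)
      then have "s\<^sup>2 * real m \<le> 2"
        using qm mult_right_mono[of "s\<^sup>2" "(q * s)\<^sup>2" "real m"] by simp
      then have "(real K + 2 * real m) * s\<^sup>2 \<le> T + 5"
        using Ks by (simp add: algebra_simps)
      then have "(real K + 2 * real m) * s\<^sup>2 * s \<le> (T + 5) * s"
        using s by (intro mult_right_mono) auto
      also have "\<dots> \<le> real n * s ^ 3"
        using Ts s unfolding ns by (simp add: algebra_simps)
      finally have "(real K + 2 * real m) * s ^ 3 \<le> real n * s ^ 3"
        by (simp add: power3_eq_cube power2_eq_square mult_ac)
      then have "real K + 2 * real m \<le> real n"
        using s by (simp add: mult_le_cancel_right)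
      then show ?thesis
        by linarith
    qed
    \<comment> \<open>\<open>z\<close> is \<open>\<theta> * 2 * R * s + \<theta>\<^sup>2\<close>,
      with \<open>2 * R * s\<close> bounding \<open>\<bar>2 * t - 1\<bar>\<close> for both rates
      \<open>t\<close>. A window has length about \<open>1 / \<theta>\<^sup>2\<close>, the diffusive
      scale of the exponent \<open>\<theta>\<close>, so the moments over a window remain
      bounded.\<close>
    define a b e \<theta> z where "a = 1/2 - R * s" and "b = 1/2 + (R - 1) * s" and "e = 1/2 + s" and "\<theta> = q * s"
      and "z = q * (2 * R + q) * s\<^sup>2"
    have \<sigma>s: "\<bar>\<sigma> * s\<bar> \<le> R * s"
      using R s by (simp add: abs_mult mult_right_mono)
    have z: "0 \<le> z" "z \<le> 1/16"
    proof -
      show "0 \<le> z"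
        using q R by (simp add: z_def)
      have "z \<le> q * (2 * R + q) * s"
        unfolding z_def using s2 q R by (intro mult_left_mono) auto
      with zs show "z \<le> 1/16"
        by simp
    qed
    have mgf: "\<theta> < t \<and> \<theta> < 1 - t \<and> (1 - t) / (1 - t - \<theta>) * (t / (t + \<theta>)) \<le> exp (16 * z) \<and>
         (1 - t) / (1 - t + \<theta>) * (t / (t - \<theta>)) \<le> exp (16 * z)" if "t \<in> {a, 1/2 + \<sigma> * s}" for t
    proof -
      have t: "\<bar>2 * t - 1\<bar> \<le> 2 * (R * s)"
        using that \<sigma>s R s by (auto simp: a_def)
      have "\<theta> * \<bar>2 * t - 1\<bar> + \<theta>\<^sup>2 \<le> \<theta> * (2 * (R * s)) + \<theta>\<^sup>2"
        using t q s by (intro add_right_mono mult_left_mono) (auto simp: \<theta>_def)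
      also have "\<dots> = z"
        by (simp add: z_def \<theta>_def power2_eq_square algebra_simps)
      finally have "\<theta> * \<bar>2 * t - 1\<bar> + \<theta>\<^sup>2 \<le> z" .
      moreover have "3/8 \<le> t" "t \<le> 5/8" "0 \<le> \<theta>" "\<theta> \<le> 1/8"
        using t Rs qs q s by (auto simp: \<theta>_def)
      ultimately show ?thesis
        using increment_mgf_le[of t \<theta> z] z by auto
    qed
    have "measure M {\<omega> \<in> space M. \<exists>k l. k \<le> l \<and> l \<le> k + m \<and> l \<le> K \<and>
      \<epsilon> / s < \<bar>pp_scaled (1/2 + \<sigma> * s) g n l \<omega> - pp_scaled (1/2 + \<sigma> * s) g n k \<omega>\<bar>} \<le> \<eta>"
      if "prob_space M" and g: "exponential_weights M 1 1 (2 * n) g" "\<And>p \<omega>. 0 \<le> g p \<omega>"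
      for M :: "'a measure" and g
    proof -
      interpret prob_space M
        by fact
      let ?y = "4 * real n + Y / s"
      have "prob {\<omega> \<in> space M. \<exists>k l. k \<le> l \<and> l \<le> k + m \<and> l \<le> K \<and>
            \<epsilon> / s < \<bar>pp_scaled (1/2 + \<sigma> * s) g n l \<omega> - pp_scaled (1/2 + \<sigma> * s) g n k \<omega>\<bar>} \<le>
        exp ((1 - a - b) * ?y) * ((b / (1 - a)) ^ (n + K) * (a / (1 - b)) ^ (n - K)) +
        exp (- (2 * e - 1) * ?y) * (e / (1 - e)) ^ (2 * n) +
        4 * (real (K div m) + 1) * (exp (- \<theta> * (\<epsilon> / s / 2)) * exp (16 * z) ^ (2 * m))"
      proof (rule pp_window_bound[OF g _ _ _ _ _ _ _ _ _ _ _ _ mgf m_pos room])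
        show "e \<le> b"
          using R s mult_right_mono[of 1 "R - 1" s] by (simp add: e_def b_def)
        show "a \<le> 1/2 + \<sigma> * s"
          using \<sigma>s by (simp add: a_def)
        show "0 < 1/2 + \<sigma> * s" "1/2 + \<sigma> * s < 1" "0 < a" "a < 1" "e < 1" "1/2 < e"
          using \<sigma>s Rs s16 s R by (auto simp: a_def e_def)
        show "0 < b"
          using R s by (simp add: b_def add_pos_nonneg)
        show "a + b < 1"
          using s by (simp add: a_def b_def algebra_simps)
        show "0 \<le> \<theta>"
          using q s by (simp add: \<theta>_def)
        show "1 \<le> exp (16 * z)"
          using z by simp
        show "0 < n"
          using elim by simp
      qed
      also have "\<dots> \<le> \<eta> / 3 + \<eta> / 3 + \<eta> / 3"
      proof (intro add_mono)
        have "(1 - a - b) * ?y = 4 * real n * s + Y"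
          using s by (simp add: a_def b_def field_simps)
        moreover have "(b / (1 - a)) ^ (n + K) * (a / (1 - b)) ^ (n - K) \<le>
            exp (- 4 * real n * s - 16/3 * (3 * R\<^sup>2 - 3 * R + 1) + 8 * (2 * R - 1) * (T + 1))"
          unfolding a_def b_def using s ns R Rs room Ks by (intro lower_tail_factor_le) auto
        ultimately have "exp ((1 - a - b) * ?y) * ((b / (1 - a)) ^ (n + K) * (a / (1 - b)) ^ (n - K)) \<le>
            exp (4 * real n * s + Y) * exp (- 4 * real n * s - 16/3 * (3 * R\<^sup>2 - 3 * R + 1) + 8 * (2 * R - 1) * (T + 1))"
          by simp
        also have "\<dots> = exp (Y - 16/3 * (3 * R\<^sup>2 - 3 * R + 1) + 8 * (2 * R - 1) * (T + 1))"
          unfolding exp_add[symmetric] by simp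
        also note R_small
        finally show "exp ((1 - a - b) * ?y) * ((b / (1 - a)) ^ (n + K) * (a / (1 - b)) ^ (n - K)) \<le> \<eta> / 3" .
        have "- (2 * e - 1) * ?y = - 8 * real n * s - 2 * Y"
          using s by (simp add: e_def field_simps)
        moreover have "(e / (1 - e)) ^ (2 * n) \<le> exp (8 * real n * s + 16)"
          unfolding e_def using s s16 ns by (intro upper_tail_factor_le) auto
        ultimately have "exp (- (2 * e - 1) * ?y) * (e / (1 - e)) ^ (2 * n) \<le> exp (- 8 * real n * s - 2 * Y) * exp (8 * real n * s + 16)"
          by simp
        also have "\<dots> = exp (16 - 2 * Y)"
          unfolding exp_add[symmetric] by simp
        finally show "exp (- (2 * e - 1) * ?y) * (e / (1 - e)) ^ (2 * n) \<le> \<eta> / 3"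
          using Y by simp
        have "real (K div m) \<le> real K / real m"
          by (rule of_nat_div_le_of_nat)
        also have "\<dots> \<le> real K * (q * s)\<^sup>2"
        proof -
          have "1 / real m \<le> (q * s)\<^sup>2"
            using m(1) m_pos qs2 by (simp add: field_simps)
          then show ?thesis
            using mult_left_mono[of "1 / real m" "(q * s)\<^sup>2" "real K"] by simp
        qed
        also have "\<dots> = (real K * s\<^sup>2) * q\<^sup>2"
          by (simp add: power_mult_distrib)
        also have "\<dots> \<le> (T + 1) * q\<^sup>2"
          using Ks by (intro mult_right_mono) auto
        finally have blocks: "real (K div m) \<le> (T + 1) * q\<^sup>2" .
        have "exp (16 * z) ^ (2 * m) = exp (32 * (z * real m))"
          by (simp add: exp_of_nat_mult[symmetric] mult_ac)
        also have "\<dots> \<le> C"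
        proof -
          have "z * real m = (2 * R / q + 1) * ((q * s)\<^sup>2 * real m)"
            using q by (simp add: z_def field_simps power2_eq_square)
          also have "\<dots> \<le> (2 * R + 1) * 2"
            using qm q R by (intro mult_mono) (auto simp: divide_le_eq mult_le_cancel_left1)
          finally show ?thesis
            by (simp add: C_def)
        qed
        finally have C: "exp (16 * z) ^ (2 * m) \<le> C" .
        have "- \<theta> * (\<epsilon> / s / 2) = - q * (\<epsilon> / 2)"
          using s by (simp add: \<theta>_def)
        then have "4 * (real (K div m) + 1) * (exp (- \<theta> * (\<epsilon> / s / 2)) * exp (16 * z) ^ (2 * m)) \<le>
            4 * ((T + 1) * q\<^sup>2 + 1) * (exp (- q * (\<epsilon> / 2)) * C)"
          using blocks C assms by (intro mult_mono) auto
        also note q_small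
        finally show "4 * (real (K div m) + 1) * (exp (- \<theta> * (\<epsilon> / s / 2)) * exp (16 * z) ^ (2 * m)) \<le> \<eta> / 3" .
      qed
      finally show ?thesis
        by simp
    qed
    moreover have "K \<le> n"
      using room by simp
    ultimately show ?case
      unfolding Let_def s_def[symmetric] m_def[symmetric] K_def[symmetric] by blast
  qed
  with q show ?thesis
    by blast
qed

section \<open>Weak convergence in metric spaces\<close>

lemma space_borel_of[simp]: "space (borel_of T) = topspace T"
  unfolding borel_of_def by (rule space_measure_of) (auto dest: openin_subset)

lemma sets_borel_of: "sets (borel_of T) = sigma_sets (topspace T) {U. openin T U}"
  unfolding borel_of_def by (rule sets_measure_of) (auto dest: openin_subset)

lemma measurable_borel_ofI:
  assumes "f \<in> space M \<rightarrow> topspace T" "\<And>U. openin T U \<Longrightarrow> f -` U \<inter> space M \<in> sets M"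
  shows "f \<in> measurable M (borel_of T)"
  by (rule measurable_sigma_sets[OF sets_borel_of]) (use assms in \<open>auto dest: openin_subset\<close>)

lemma borel_of_openin: "openin T U \<Longrightarrow> U \<in> sets (borel_of T)"
  by (simp add: sets_borel_of)

lemma continuous_map_measurable:
  assumes "continuous_map T euclideanreal F"
  shows "F \<in> borel_measurable (borel_of T)"
proof (rule borel_measurableI)
  fix U :: "real set" assume "open U"
  then have "openin T {x \<in> topspace T. F x \<in> U}"
    using assms by (simp add: continuous_map_def)
  moreover have "F -` U \<inter> space (borel_of T) = {x \<in> topspace T. F x \<in> U}"
    by auto
  ultimately show "F -` U \<inter> space (borel_of T) \<in> sets (borel_of T)"
    by (simp add: borel_of_openin)
qed

lemma openin_mtopology_of_ball:
  assumes "openin (mtopology_of m) U" "f \<in> U"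
  obtains d where "0 < d" "mball_of m f d \<subseteq> U"
  using assms by (auto simp: mtopology_of_def mball_of_def Metric_space.openin_mtopology)

section \<open>Lipschitz test functions\<close>

definition lipschitz_map :: "'s metric \<Rightarrow> real \<Rightarrow> ('s \<Rightarrow> real) \<Rightarrow> bool" where
  "lipschitz_map m L F \<longleftrightarrow> 0 \<le> L \<and> (\<forall>f\<in>mspace m. \<forall>g\<in>mspace m. \<bar>F f - F g\<bar> \<le> L * mdist m f g)"

lemma lipschitz_map_continuous:
  assumes "lipschitz_map m L F"
  shows "continuous_map (mtopology_of m) euclideanreal F"
proof -
  have "Lipschitz_continuous_map m euclidean_metric F"
    using assms by (auto simp: Lipschitz_continuous_map_def lipschitz_map_def dist_real_def)
  then show ?thesis
    using Lipschitz_continuous_imp_continuous_map by fastforce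
qed

text \<open>The Pasch-Hausdorff envelope: the inf-convolution of \<open>F\<close> with
  \<open>k\<close> times the distance.\<close>

definition lipschitz_minorant :: "'s metric \<Rightarrow> ('s \<Rightarrow> real) \<Rightarrow> real \<Rightarrow> 's \<Rightarrow> real" where
  "lipschitz_minorant m F k f = (INF g\<in>mspace m. F g + k * mdist m f g)"

context
  fixes m :: "'s metric" and F :: "'s \<Rightarrow> real" and c k :: real
  assumes F: "\<And>f. f \<in> mspace m \<Longrightarrow> \<bar>F f\<bar> \<le> c" and k: "0 \<le> k"
begin

lemma lipschitz_minorant_bdd: "bdd_below ((\<lambda>g. F g + k * mdist m f g) ` mspace m)"
proof (rule bdd_belowI2)
  fix g assume "g \<in> mspace m"
  then have "- c \<le> F g"
    using F[of g] by auto
  moreover have "0 \<le> k * mdist m f g"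
    using k by simp
  ultimately show "- c \<le> F g + k * mdist m f g"
    by linarith
qed

lemma lipschitz_minorant_le:
  "g \<in> mspace m \<Longrightarrow> lipschitz_minorant m F k f \<le> F g + k * mdist m f g"
  unfolding lipschitz_minorant_def by (rule cINF_lower[OF lipschitz_minorant_bdd])

lemma lipschitz_minorant_le_self:
  assumes "f \<in> mspace m"
  shows "lipschitz_minorant m F k f \<le> F f"
proof -
  have "mdist m f f = 0"
    using assms by (simp only: mdist_zero)
  then show ?thesis
    using lipschitz_minorant_le[OF assms, of f] by simp
qed

lemma lipschitz_minorant_bounded:
  assumes "f \<in> mspace m"
  shows "\<bar>lipschitz_minorant m F k f\<bar> \<le> c"
proof -
  have "- c \<le> lipschitz_minorant m F k f"
    unfolding lipschitz_minorant_def
  proof (rule cINF_greatest)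
    show "mspace m \<noteq> {}"
      using assms by auto
    show "- c \<le> F g + k * mdist m f g" if "g \<in> mspace m" for g
    proof -
      have "- c \<le> F g" "0 \<le> k * mdist m f g"
        using F[OF that] k by auto
      then show ?thesis
        by linarith
    qed
  qed
  then show ?thesis
    using lipschitz_minorant_le_self[OF assms] F[OF assms] by (simp add: abs_le_iff)
qed

lemma lipschitz_minorant_lipschitz: "lipschitz_map m k (lipschitz_minorant m F k)"
proof -
  have *: "lipschitz_minorant m F k f - k * mdist m f g \<le> lipschitz_minorant m F k g"
    if "f \<in> mspace m" "g \<in> mspace m" for f g
    unfolding lipschitz_minorant_def[of m F k g]
  proof (rule cINF_greatest)
    show "mspace m \<noteq> {}"
      using that by auto
    fix h assume h: "h \<in> mspace m"
    have "mdist m f h \<le> mdist m f g + mdist m g h"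
      using that h by (intro mdist_triangle) auto
    then have "k * mdist m f h \<le> k * mdist m f g + k * mdist m g h"
      using k by (metis mult_left_mono ring_distribs(1))
    then show "lipschitz_minorant m F k f - k * mdist m f g \<le> F h + k * mdist m g h"
      using lipschitz_minorant_le[OF h, of f] by linarith
  qed
  show ?thesis
    unfolding lipschitz_map_def
  proof (intro conjI ballI k)
    fix f g assume fg: "f \<in> mspace m" "g \<in> mspace m"
    have "mdist m f g = mdist m g f"
      by (rule mdist_commute)
    then show "\<bar>lipschitz_minorant m F k f - lipschitz_minorant m F k g\<bar> \<le> k * mdist m f g"
      using *[OF fg] *[OF fg(2,1)] by (simp add: abs_le_iff)
  qed
qed

end

text \<open>Within distance \<open>d\<close> of \<open>f\<close>, continuity keeps \<open>F\<close>
  above \<open>F f - e\<close>. Further away the penalty is at least \<open>k * d\<close>, which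
  outweighs the largest possible drop \<open>2 * c\<close> once \<open>k\<close> is large.\<close>

lemma lipschitz_minorant_tendsto:
  assumes F: "\<And>f. f \<in> mspace m \<Longrightarrow> \<bar>F f\<bar> \<le> c" and cont: "continuous_map (mtopology_of m) euclideanreal F"
    and f: "f \<in> mspace m"
  shows "(\<lambda>k. lipschitz_minorant m F (real k) f) \<longlonglongrightarrow> F f"
proof (rule LIMSEQ_I)
  fix r :: real assume "0 < r"
  define e where "e = r / 2"
  have e: "0 < e" "e < r"
    using \<open>0 < r\<close> by (auto simp: e_def)
  have "openin (mtopology_of m) {g \<in> topspace (mtopology_of m). F g \<in> ball (F f) e}" (is "openin _ ?U")
    by (rule openin_continuous_map_preimage[OF cont]) simp
  moreover have "f \<in> ?U"
    using f e by simp
  ultimately obtain d where d: "0 < d" "mball_of m f d \<subseteq> ?U"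
    by (rule openin_mtopology_of_ball)
  have lower: "F f - e \<le> F g + real k * mdist m f g" if k: "2 * c / d \<le> real k" and g: "g \<in> mspace m" for k g
  proof (cases "mdist m f g < d")
    case True
    then have "F g \<in> ball (F f) e"
      using d(2) f g by auto
    then have "F f - e \<le> F g"
      by (auto simp: dist_real_def)
    moreover have "0 \<le> real k * mdist m f g"
      by simp
    ultimately show ?thesis
      by linarith
  next
    case False
    have "2 * c \<le> real k * d"
      using k d(1) by (simp add: field_simps)
    also have "\<dots> \<le> real k * mdist m f g"
      using False by (intro mult_left_mono) auto
    finally show ?thesis
      using F[OF f] F[OF g] e by (simp add: abs_le_iff)
  qed
  obtain k0 :: nat where k0: "2 * c / d \<le> real k0"
    using real_arch_simple by blast
  have "norm (lipschitz_minorant m F (real k) f - F f) < r" if "k0 \<le> k" for k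
  proof -
    have "F f - e \<le> lipschitz_minorant m F (real k) f"
      unfolding lipschitz_minorant_def
    proof (rule cINF_greatest)
      show "mspace m \<noteq> {}"
        using f by auto
      have "2 * c / d \<le> real k"
        using k0 that by (meson of_nat_mono order_trans)
      then show "F f - e \<le> F g + real k * mdist m f g" if "g \<in> mspace m" for g
        using that by (rule lower)
    qed
    moreover have "lipschitz_minorant m F (real k) f \<le> F f"
      by (rule lipschitz_minorant_le_self[OF F _ f]) auto
    ultimately show ?thesis
      using e by (simp add: abs_if)
  qed
  then show "\<exists>no. \<forall>k\<ge>no. norm (lipschitz_minorant m F (real k) f - F f) < r"
    by blast
qed

lemma (in prob_space) integrable_bounded_borel_of:
  assumes X: "X \<in> measurable M (borel_of T)" and F: "continuous_map T euclideanreal F"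
    and c: "\<And>f. f \<in> topspace T \<Longrightarrow> \<bar>F f\<bar> \<le> c"
  shows "integrable M (\<lambda>x. F (X x))"
proof (rule integrable_const_bound)
  show "AE x in M. norm (F (X x)) \<le> c"
    using measurable_space[OF X] c by auto
  show "(\<lambda>x. F (X x)) \<in> borel_measurable M"
    by (rule measurable_compose[OF X continuous_map_measurable[OF F]])
qed

text \<open>Lipschitz minorants approximate \<open>F\<close> from below, which gives the lower half
  of the limit. The upper half is the lower half for \<open>- F\<close>.\<close>

lemma converges_weakly_lipschitzI:
  fixes m :: "'s metric"
  assumes X: "\<forall>\<^sub>F n in sequentially. prob_space (M n) \<and> X n \<in> M n \<rightarrow>\<^sub>M borel_of (mtopology_of m)"
    and Q: "prob_space Q" and Y: "Y \<in> Q \<rightarrow>\<^sub>M borel_of (mtopology_of m)"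
    and lim: "\<And>F L c. lipschitz_map m L F \<Longrightarrow> (\<And>f. f \<in> mspace m \<Longrightarrow> \<bar>F f\<bar> \<le> c) \<Longrightarrow>
      (\<lambda>n. \<integral>x. F (X n x) \<partial>M n) \<longlonglongrightarrow> (\<integral>x. F (Y x) \<partial>Q)"
  shows "converges_weakly (mtopology_of m) M X Q Y"
  unfolding converges_weakly_def
proof (intro conjI X Q Y allI impI)
  interpret Q: prob_space Q
    by (rule Q)
  have lower: "\<forall>\<^sub>F n in sequentially. (\<integral>x. F (Y x) \<partial>Q) - e < (\<integral>x. F (X n x) \<partial>M n)"
    if cont: "continuous_map (mtopology_of m) euclideanreal F" and c: "\<And>f. f \<in> mspace m \<Longrightarrow> \<bar>F f\<bar> \<le> c" and "0 < e"
    for F c e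
  proof -
    let ?G = "\<lambda>k::nat. lipschitz_minorant m F (real k)"
    have lip: "lipschitz_map m (real k) (?G k)" for k
      by (rule lipschitz_minorant_lipschitz[OF c]) auto
    note G_cont = lipschitz_map_continuous[OF lip]
    have G_bound: "\<bar>?G k f\<bar> \<le> c" if "f \<in> mspace m" for k f
      by (rule lipschitz_minorant_bounded[OF c _ that]) auto
    have G_le: "?G k f \<le> F f" if "f \<in> mspace m" for k f
      by (rule lipschitz_minorant_le_self[OF c _ that]) auto
    have Y_space: "Y x \<in> mspace m" if "x \<in> space Q" for x
      using measurable_space[OF Y that] by simp
    have "(\<lambda>k. \<integral>x. ?G k (Y x) \<partial>Q) \<longlonglongrightarrow> (\<integral>x. F (Y x) \<partial>Q)"
    proof (rule integral_dominated_convergence[where w = "\<lambda>_. c"])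
      show "(\<lambda>x. F (Y x)) \<in> borel_measurable Q"
        by (rule measurable_compose[OF Y continuous_map_measurable[OF cont]])
      show "(\<lambda>x. ?G k (Y x)) \<in> borel_measurable Q" for k
        by (rule measurable_compose[OF Y continuous_map_measurable[OF G_cont]])
      show "AE x in Q. (\<lambda>k. ?G k (Y x)) \<longlonglongrightarrow> F (Y x)"
        using lipschitz_minorant_tendsto[OF c cont Y_space] by auto
      show "AE x in Q. norm (?G k (Y x)) \<le> c" for k
        using G_bound[OF Y_space] by auto
    qed simp
    then have "\<forall>\<^sub>F k in sequentially. (\<integral>x. F (Y x) \<partial>Q) - e < (\<integral>x. ?G k (Y x) \<partial>Q)"
      using \<open>0 < e\<close> by (intro order_tendstoD) auto
    then obtain k where k: "(\<integral>x. F (Y x) \<partial>Q) - e < (\<integral>x. ?G k (Y x) \<partial>Q)"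
      by (auto simp: eventually_sequentially)
    have "\<forall>\<^sub>F n in sequentially. (\<integral>x. F (Y x) \<partial>Q) - e < (\<integral>x. ?G k (X n x) \<partial>M n)"
      by (rule order_tendstoD(1)[OF lim[OF lip G_bound] k])
    with X show ?thesis
    proof eventually_elim
      case (elim n)
      interpret Mn: prob_space "M n"
        using elim by simp
      have Xn: "X n \<in> M n \<rightarrow>\<^sub>M borel_of (mtopology_of m)"
        using elim by simp
      have "(\<integral>x. ?G k (X n x) \<partial>M n) \<le> (\<integral>x. F (X n x) \<partial>M n)"
      proof (rule integral_mono)
        show "integrable (M n) (\<lambda>x. ?G k (X n x))"
          by (rule Mn.integrable_bounded_borel_of[OF Xn G_cont]) (use G_bound in auto)
        show "integrable (M n) (\<lambda>x. F (X n x))"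
          by (rule Mn.integrable_bounded_borel_of[OF Xn cont]) (use c in auto)
        show "?G k (X n x) \<le> F (X n x)" if "x \<in> space (M n)" for x
          using measurable_space[OF Xn that] by (intro G_le) simp
      qed
      with elim show ?case
        by linarith
    qed
  qed
  fix F assume F: "continuous_map (mtopology_of m) euclideanreal F \<and> bounded (F ` topspace (mtopology_of m))"
  then obtain c where c: "\<bar>F f\<bar> \<le> c" if "f \<in> mspace m" for f
    by (auto simp: bounded_iff)
  show "(\<lambda>n. \<integral>x. F (X n x) \<partial>M n) \<longlonglongrightarrow> (\<integral>x. F (Y x) \<partial>Q)"
  proof (rule tendstoI)
    fix e :: real assume "0 < e"
    have "\<forall>\<^sub>F n in sequentially. (\<integral>x. F (Y x) \<partial>Q) - e < (\<integral>x. F (X n x) \<partial>M n)"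
      using F c \<open>0 < e\<close> by (intro lower) auto
    moreover have "\<forall>\<^sub>F n in sequentially. (\<integral>x. - F (Y x) \<partial>Q) - e < (\<integral>x. - F (X n x) \<partial>M n)"
      using F c \<open>0 < e\<close> by (intro lower[of "\<lambda>x. - F x" c e] continuous_map_minus) auto
    ultimately show "\<forall>\<^sub>F n in sequentially. dist (\<integral>x. F (X n x) \<partial>M n) (\<integral>x. F (Y x) \<partial>Q) < e"
      by eventually_elim (auto simp: dist_real_def)
  qed
qed

text \<open>An open set is where the envelope of its indicator function is positive. The envelope is
  Lipschitz, so its values along \<open>f n\<close> converge to those along \<open>g\<close>, and
  measurability reduces to real-valued limits.\<close>

lemma borel_of_metric_limit:
  fixes m :: "'s metric"
  assumes f: "\<And>n. f n \<in> M \<rightarrow>\<^sub>M borel_of (mtopology_of m)"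
    and g: "\<And>x. x \<in> space M \<Longrightarrow> g x \<in> mspace m"
    and lim: "\<And>x. x \<in> space M \<Longrightarrow> (\<lambda>n. mdist m (f n x) (g x)) \<longlonglongrightarrow> 0"
  shows "g \<in> M \<rightarrow>\<^sub>M borel_of (mtopology_of m)"
proof (rule measurable_borel_ofI)
  show "g \<in> space M \<rightarrow> topspace (mtopology_of m)"
    using g by simp
  fix U assume U: "openin (mtopology_of m) U"
  define F :: "'s \<Rightarrow> real" where "F f = (if f \<in> U then 1 else 0)" for f
  let ?G = "lipschitz_minorant m F 1"
  have F: "\<bar>F f\<bar> \<le> 1" for f
    by (simp add: F_def)
  have lip: "lipschitz_map m 1 ?G"
    by (rule lipschitz_minorant_lipschitz[OF F]) simp
  have G_pos: "f \<in> U \<longleftrightarrow> 0 < ?G f" if "f \<in> mspace m" for f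
  proof
    assume "f \<in> U"
    with U obtain d where d: "0 < d" "mball_of m f d \<subseteq> U"
      by (rule openin_mtopology_of_ball)
    have "min 1 d \<le> ?G f"
      unfolding lipschitz_minorant_def
    proof (rule cINF_greatest)
      show "mspace m \<noteq> {}"
        using that by auto
      fix h assume h: "h \<in> mspace m"
      show "min 1 d \<le> F h + 1 * mdist m f h"
      proof (cases "h \<in> U")
        case False
        then have "\<not> mdist m f h < d"
          using d(2) that h by auto
        then show ?thesis
          by (simp add: F_def min_le_iff_disj)
      qed (simp add: F_def min_le_iff_disj)
    qed
    then show "0 < ?G f"
      using d(1) by linarith
  next
    assume "0 < ?G f"
    moreover have "?G f \<le> F f"
      by (rule lipschitz_minorant_le_self[OF F _ that]) simp
    ultimately show "f \<in> U"
      by (simp add: F_def split: if_splits)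
  qed
  have f_space: "f n x \<in> mspace m" if "x \<in> space M" for n x
    using measurable_space[OF f that] by simp
  have "(\<lambda>x. ?G (g x)) \<in> borel_measurable M"
  proof (rule borel_measurable_LIMSEQ_real)
    show "(\<lambda>x. ?G (f n x)) \<in> borel_measurable M" for n
      by (rule measurable_compose[OF f continuous_map_measurable[OF lipschitz_map_continuous[OF lip]]])
    fix x assume x: "x \<in> space M"
    show "(\<lambda>n. ?G (f n x)) \<longlonglongrightarrow> ?G (g x)"
    proof (rule LIM_zero_cancel, rule Lim_null_comparison)
      show "\<forall>\<^sub>F n in sequentially. norm (?G (f n x) - ?G (g x)) \<le> mdist m (f n x) (g x)"
        using lip f_space[OF x] g[OF x] by (auto simp: lipschitz_map_def)
    qed (rule lim[OF x])
  qed
  moreover have "g -` U \<inter> space M = {x \<in> space M. 0 < ?G (g x)}"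
    using G_pos g by auto
  ultimately show "g -` U \<inter> space M \<in> sets M"
    by simp
qed

section \<open>Random continuous functions on a compact interval\<close>

lemma mspace_C_top:
  "mspace (cfunspace (top_of_set {a..b}) euclidean_metric) = {f. f \<in> extensional {a..b} \<and> continuous_on {a..b} f}"
  for a b :: real
proof -
  have "compactin (top_of_set {a..b}) (topspace (top_of_set {a..b}))"
    by (simp add: compactin_subtopology)
  from compactin_mspace_cfunspace[OF this, of euclidean_metric] show ?thesis
    by auto
qed

lemma mdist_C_top_le:
  fixes f g :: "real \<Rightarrow> real"
  assumes "0 \<le> e" "\<And>u. u \<in> {a..b} \<Longrightarrow> \<bar>f u - g u\<bar> \<le> e"
  shows "mdist (cfunspace (top_of_set {a..b}) euclidean_metric) f g \<le> e"
  using assms by (intro mdist_cfunspace_le) (auto simp: dist_real_def)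

lemma restrict_in_mspace_C_top:
  fixes f :: "real \<Rightarrow> real"
  assumes "continuous_on {a..b} f"
  shows "restrict f {a..b} \<in> mspace (cfunspace (top_of_set {a..b}) euclidean_metric)"
proof -
  have "continuous_on {a..b} (restrict f {a..b})"
    by (rule continuous_on_eq[OF assms]) simp
  then show ?thesis
    unfolding mspace_C_top by simp
qed

text \<open>The interpolated processes depend on the randomness through finitely many coefficients
  of fixed continuous functions. Measurability and continuity into \<open>C_top\<close> are proved
  once in this form.\<close>

definition combination :: "(nat \<Rightarrow> real \<Rightarrow> real) \<Rightarrow> nat \<Rightarrow> real \<Rightarrow> real \<Rightarrow> (nat \<Rightarrow> real) \<Rightarrow> real \<Rightarrow> real" where
  "combination \<phi> K a b v = restrict (\<lambda>u. \<Sum>k<K. v k * \<phi> k u) {a..b}"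

text \<open>The uniform distance of two combinations is at most the sum of the differences of the
  first \<open>K\<close> coefficients, which is continuous for the product topology.\<close>

lemma combination_continuous_map:
  assumes cont: "\<And>k. continuous_on {a..b} (\<phi> k)" and bound: "\<And>k u. u \<in> {a..b} \<Longrightarrow> \<bar>\<phi> k u\<bar> \<le> 1"
  shows "continuous_map euclidean (C_top a b) (combination \<phi> K a b)"
  unfolding continuous_map_def
proof (intro conjI allI impI)
  let ?m = "cfunspace (top_of_set {a..b}) euclidean_metric :: (real \<Rightarrow> real) metric"
  have space: "combination \<phi> K a b v \<in> mspace ?m" for v
    unfolding combination_def by (intro restrict_in_mspace_C_top continuous_intros cont)
  then show "combination \<phi> K a b \<in> topspace euclidean \<rightarrow> topspace (C_top a b)"
    by (simp add: C_top_def del: mspace_cfunspace)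
  fix U assume U: "openin (C_top a b) U"
  have dist: "mdist ?m (combination \<phi> K a b v) (combination \<phi> K a b v') \<le> (\<Sum>k<K. \<bar>v k - v' k\<bar>)" for v v'
  proof (rule mdist_C_top_le)
    fix u assume u: "u \<in> {a..b}"
    have "\<bar>combination \<phi> K a b v u - combination \<phi> K a b v' u\<bar> = \<bar>\<Sum>k<K. (v k - v' k) * \<phi> k u\<bar>"
      using u by (simp add: combination_def sum_subtractf left_diff_distrib)
    also have "\<dots> \<le> (\<Sum>k<K. \<bar>(v k - v' k) * \<phi> k u\<bar>)"
      by (rule sum_abs)
    also have "\<dots> \<le> (\<Sum>k<K. \<bar>v k - v' k\<bar>)"
      unfolding abs_mult using bound[OF u] by (intro sum_mono mult_left_le) auto
    finally show "\<bar>combination \<phi> K a b v u - combination \<phi> K a b v' u\<bar> \<le> (\<Sum>k<K. \<bar>v k - v' k\<bar>)" .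
  qed (simp add: sum_nonneg)
  have "open {v. combination \<phi> K a b v \<in> U}"
  proof (subst open_subopen, safe)
    fix v assume v: "combination \<phi> K a b v \<in> U"
    obtain d where d: "0 < d" "mball_of ?m (combination \<phi> K a b v) d \<subseteq> U"
      using openin_mtopology_of_ball[OF U[unfolded C_top_def] v] .
    let ?V = "{v'. (\<Sum>k<K. \<bar>v k - v' k\<bar>) < d}"
    have "open ?V"
      by (intro open_Collect_less continuous_intros) (auto intro: continuous_on_product_coordinates)
    moreover have "v \<in> ?V"
      using d(1) by simp
    moreover have "?V \<subseteq> {v. combination \<phi> K a b v \<in> U}"
    proof safe
      fix v' assume "(\<Sum>k<K. \<bar>v k - v' k\<bar>) < d"
      then have "combination \<phi> K a b v' \<in> mball_of ?m (combination \<phi> K a b v) d"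
        using dist[of v v'] space by (simp del: mspace_cfunspace)
      with d(2) show "combination \<phi> K a b v' \<in> U"
        by blast
    qed
    ultimately show "\<exists>V. open V \<and> v \<in> V \<and> V \<subseteq> {v. combination \<phi> K a b v \<in> U}"
      by blast
  qed
  then show "openin euclidean {v \<in> topspace euclidean. combination \<phi> K a b v \<in> U}"
    by simp
qed

lemma combination_measurable:
  assumes "\<And>k. continuous_on {a..b} (\<phi> k)" "\<And>k u. u \<in> {a..b} \<Longrightarrow> \<bar>\<phi> k u\<bar> \<le> 1"
    and V: "\<And>k. (\<lambda>x. V x k) \<in> borel_measurable M"
  shows "(\<lambda>x. combination \<phi> K a b (V x)) \<in> M \<rightarrow>\<^sub>M borel_of (C_top a b)"
proof (rule measurable_borel_ofI)
  note cont = combination_continuous_map[of a b \<phi> K, OF assms(1,2)]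
  show "(\<lambda>x. combination \<phi> K a b (V x)) \<in> space M \<rightarrow> topspace (C_top a b)"
    using cont by (auto simp: continuous_map_def)
  fix U assume "openin (C_top a b) U"
  then have "open {v. combination \<phi> K a b v \<in> U}"
    using cont by (simp add: continuous_map_def)
  moreover have "V \<in> borel_measurable M"
    using V by (rule measurable_coordinatewise_then_product)
  ultimately have "V -` {v. combination \<phi> K a b v \<in> U} \<inter> space M \<in> sets M"
    by (intro measurable_sets[of V M borel]) auto
  then show "(\<lambda>x. combination \<phi> K a b (V x)) -` U \<inter> space M \<in> sets M"
    by (simp add: vimage_def)
qed

definition hat :: "real \<Rightarrow> real" where
  "hat t = max 0 (1 - \<bar>t\<bar>)"

lemma hat_continuous[continuous_intros]:
  "continuous_on S f \<Longrightarrow> continuous_on S (\<lambda>x. hat (f x))"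
  unfolding hat_def by (intro continuous_intros)

lemma hat_bounded: "\<bar>hat t\<bar> \<le> 1"
  by (simp add: hat_def)

lemma hat_sum:
  assumes "0 \<le> x" "x \<le> real n"
  shows "(\<Sum>k<Suc n. v k * hat (x - real k)) =
    (1 - frac x) * v (nat \<lfloor>x\<rfloor>) + frac x * v (Suc (nat \<lfloor>x\<rfloor>))"
proof -
  define p where "p = nat \<lfloor>x\<rfloor>"
  have x: "x = real p + frac x"
    using assms by (simp add: p_def frac_def)
  have f: "0 \<le> frac x" "frac x < 1"
    by (simp_all add: frac_lt_1)
  have hat: "hat (x - real k) = (if k = p then 1 - frac x else if k = Suc p then frac x else 0)" for k
  proof -
    consider "k < p" | "k = p" | "k = Suc p" | "Suc p < k"
      by linarith
    then show ?thesis
    proof cases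
      case 1
      then have "real k + 1 \<le> real p"
        by linarith
      then have "1 \<le> x - real k"
        using x f by linarith
      with 1 show ?thesis
        by (simp add: hat_def)
    next
      case 2
      then have "x - real k = frac x"
        using x by linarith
      with 2 f show ?thesis
        by (simp add: hat_def)
    next
      case 3
      then have "x - real k = frac x - 1"
        using x by simp
      with 3 f show ?thesis
        by (simp add: hat_def)
    next
      case 4
      then have "real p + 2 \<le> real k"
        by linarith
      then have "x - real k \<le> - 1"
        using x f by linarith
      with 4 show ?thesis
        by (simp add: hat_def)
    qed
  qed
  have "p \<le> n"
    using assms x f by linarith
  have "(\<Sum>k<Suc n. v k * hat (x - real k)) =
      (\<Sum>k<Suc n. (if k = p then (1 - frac x) * v k else 0) + (if k = Suc p then frac x * v k else 0))"
    unfolding hat by (intro sum.cong) auto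
  also have "\<dots> = (1 - frac x) * v p + (if Suc p < Suc n then frac x * v (Suc p) else 0)"
    using \<open>p \<le> n\<close> by (simp add: sum.distrib del: sum.lessThan_Suc)
  \<comment> \<open>For \<open>x = n\<close> the node \<open>Suc n\<close> is missing from the sum,
    but its coefficient \<open>frac x\<close> is then 0.\<close>
  also have "(if Suc p < Suc n then frac x * v (Suc p) else 0) = frac x * v (Suc p)"
  proof (cases "p = n")
    case True
    then have "frac x = 0"
      using assms x f by linarith
    then show ?thesis
      by simp
  qed (use \<open>p \<le> n\<close> in simp)
  finally show ?thesis
    by (simp add: p_def)
qed

lemma hat_sum_approx:
  assumes x: "0 \<le> x" "x \<le> real n"
    and v: "\<And>k. k \<le> n \<Longrightarrow> \<bar>x - real k\<bar> \<le> 1 \<Longrightarrow> \<bar>v k - y\<bar> \<le> e"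
  shows "\<bar>(\<Sum>k<Suc n. v k * hat (x - real k)) - y\<bar> \<le> e"
proof -
  define p where "p = nat \<lfloor>x\<rfloor>"
  have xp: "x = real p + frac x"
    using x by (simp add: p_def frac_def)
  have f: "0 \<le> frac x" "frac x < 1"
    by (simp_all add: frac_lt_1)
  have "p \<le> n"
  proof -
    have "real p \<le> real n"
      using x xp f by linarith
    then show ?thesis
      by simp
  qed
  moreover have "\<bar>x - real p\<bar> \<le> 1"
    using xp f by linarith
  ultimately have 1: "\<bar>v p - y\<bar> \<le> e"
    by (rule v)
  have 2: "frac x * \<bar>v (Suc p) - y\<bar> \<le> frac x * e"
  proof (cases "frac x = 0")
    case False
    then have "Suc p \<le> n"
      using x xp f by linarith
    moreover have "\<bar>x - real (Suc p)\<bar> \<le> 1"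
      using xp f unfolding of_nat_Suc by linarith
    ultimately have "\<bar>v (Suc p) - y\<bar> \<le> e"
      by (rule v)
    then show ?thesis
      using f by (intro mult_left_mono) auto
  next
    case True
    then show ?thesis
      by (simp only: True mult_zero_left order_refl)
  qed
  have "(\<Sum>k<Suc n. v k * hat (x - real k)) - y = (1 - frac x) * (v p - y) + frac x * (v (Suc p) - y)"
    unfolding hat_sum[OF x] p_def[symmetric] by (simp add: algebra_simps)
  then have "\<bar>(\<Sum>k<Suc n. v k * hat (x - real k)) - y\<bar> \<le> (1 - frac x) * \<bar>v p - y\<bar> + frac x * \<bar>v (Suc p) - y\<bar>"
    using f abs_triangle_ineq[of "(1 - frac x) * (v p - y)" "frac x * (v (Suc p) - y)"] by (simp add: abs_mult)
  also have "\<dots> \<le> (1 - frac x) * e + frac x * e"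
  proof (intro add_mono 2)
    show "(1 - frac x) * \<bar>v p - y\<bar> \<le> (1 - frac x) * e"
      using 1 f by (intro mult_left_mono) auto
  qed
  also have "\<dots> = e"
    by (simp add: algebra_simps)
  finally show ?thesis .
qed

section \<open>A continuous version of the limit\<close>

lemma fdd_converges_lim:
  assumes "fdd_converges M X Q Y" "finite I" "I \<subseteq> {0..}"
    and "continuous_map (product_topology (\<lambda>_. euclideanreal) I) euclideanreal F"
    and "\<And>v. v \<in> extensional I \<Longrightarrow> \<bar>F v\<bar> \<le> c"
  shows "(\<lambda>n. \<integral>x. F (restrict (X n x) I) \<partial>M n) \<longlonglongrightarrow> (\<integral>y. F (restrict (Y y) I) \<partial>Q)"
proof -
  have "bounded (F ` topspace (product_topology (\<lambda>_. euclideanreal) I))"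
    using assms(5) by (auto simp: bounded_iff PiE_def)
  then show ?thesis
    using assms unfolding fdd_converges_def converges_weakly_def by blast
qed

text \<open>Tightness is stated through a measurable exceptional set \<open>E\<close>, which avoids
  asking whether the modulus over uncountably many times is measurable. Control at a single time
  comes from the finite-dimensional convergence. The paths of \<open>Y\<close> carry no
  regularity.\<close>

locale tight_fdd =
  fixes M :: "nat \<Rightarrow> 'a measure" and X :: "nat \<Rightarrow> 'a \<Rightarrow> real \<Rightarrow> real"
    and Q :: "'b measure" and Y :: "'b \<Rightarrow> real \<Rightarrow> real"
  assumes fdd: "fdd_converges M X Q Y"
    and Y_measurable: "\<And>u. 0 \<le> u \<Longrightarrow> (\<lambda>y. Y y u) \<in> borel_measurable Q"
    and tight: "\<And>T e \<eta>. 0 \<le> T \<Longrightarrow> 0 < e \<Longrightarrow> 0 < \<eta> \<Longrightarrow>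
      \<exists>h>0. \<forall>\<^sub>F n in sequentially. \<exists>E\<in>sets (M n). measure (M n) E \<le> \<eta> \<and>
        (\<forall>x\<in>space (M n) - E. \<forall>s\<in>{0..T}. \<forall>t\<in>{0..T}. \<bar>s - t\<bar> \<le> h \<longrightarrow> \<bar>X n x s - X n x t\<bar> \<le> e)"
    and X_measurable: "\<And>a b. 0 \<le> a \<Longrightarrow> a \<le> b \<Longrightarrow> \<forall>\<^sub>F n in sequentially.
      (\<lambda>x. restrict (X n x) {a..b}) \<in> M n \<rightarrow>\<^sub>M borel_of (C_top a b)"
begin

lemma prob_space_Q: "prob_space Q"
  using fdd[unfolded fdd_converges_def, rule_format, of "{}"] by (simp add: converges_weakly_def)

sublocale Q: prob_space Q
  by (rule prob_space_Q)

lemma prob_space_M: "\<forall>\<^sub>F n in sequentially. prob_space (M n)"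
  using fdd[unfolded fdd_converges_def, rule_format, of "{}"]
  by (auto simp: converges_weakly_def elim: eventually_mono)

definition fluctuates :: "real \<Rightarrow> real \<Rightarrow> real set \<Rightarrow> 'b \<Rightarrow> bool" where
  "fluctuates h e I y \<longleftrightarrow> (\<exists>s\<in>I. \<exists>t\<in>I. \<bar>s - t\<bar> \<le> h \<and> e \<le> \<bar>Y y s - Y y t\<bar>)"

lemma fluctuates_mono:
  assumes "fluctuates h e I y" "I \<subseteq> J"
  shows "fluctuates h e J y"
  using assms unfolding fluctuates_def by blast

lemma fluctuates_measurable:
  assumes "countable I" "I \<subseteq> {0..}"
  shows "Measurable.pred Q (fluctuates h e I)"
proof -
  have meas: "{y \<in> space Q. \<bar>s - t\<bar> \<le> h \<and> e \<le> \<bar>Y y s - Y y t\<bar>} \<in> sets Q" if "s \<in> I" "t \<in> I" for s t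
  proof -
    have [measurable]: "(\<lambda>y. Y y s) \<in> borel_measurable Q" "(\<lambda>y. Y y t) \<in> borel_measurable Q"
      using that assms by (auto intro: Y_measurable)
    show ?thesis
      by measurable
  qed
  have "{y \<in> space Q. fluctuates h e I y} =
      (\<Union>s\<in>I. \<Union>t\<in>I. {y \<in> space Q. \<bar>s - t\<bar> \<le> h \<and> e \<le> \<bar>Y y s - Y y t\<bar>})"
    by (auto simp: fluctuates_def)
  also have "\<dots> \<in> sets Q"
    by (intro sets.countable_UN'' assms(1) meas)
  finally show ?thesis
    by (simp add: pred_def)
qed

text \<open>The event for the limit is bounded by a continuous cutoff, which vanishes if all
  oscillations are at most \<open>e\<close> and equals 1 if one of them reaches
  \<open>2 * e\<close>. Doubling \<open>e\<close> is the price for continuity.\<close>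

lemma fluctuates_finite:
  assumes T: "0 \<le> T" and e: "0 < e" and \<eta>: "0 < \<eta>" and I: "finite I" "I \<subseteq> {0..T}"
    and E: "\<forall>\<^sub>F n in sequentially. \<exists>E\<in>sets (M n). measure (M n) E \<le> \<eta> \<and>
        (\<forall>x\<in>space (M n) - E. \<forall>s\<in>{0..T}. \<forall>t\<in>{0..T}. \<bar>s - t\<bar> \<le> h \<longrightarrow> \<bar>X n x s - X n x t\<bar> \<le> e)"
  shows "measure Q {y \<in> space Q. fluctuates h (2 * e) I y} \<le> \<eta>"
proof -
  let ?P = "{(s, t). s \<in> I \<and> t \<in> I \<and> \<bar>s - t\<bar> \<le> h}"
  let ?T = "product_topology (\<lambda>_. euclideanreal) I"
  have finP: "finite ?P"
    by (rule finite_subset[of _ "I \<times> I"]) (use I in auto)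
  have finP': "finite {p. fst p \<in> I \<and> snd p \<in> I \<and> \<bar>fst p - snd p\<bar> \<le> h}"
    by (rule finite_subset[of _ "I \<times> I"]) (use I in auto)
  define F :: "(real \<Rightarrow> real) \<Rightarrow> real" where
    "F v = min 1 (\<Sum>(s, t)\<in>?P. max 0 (\<bar>v s - v t\<bar> - e) / e)" for v
  have F_cont: "continuous_map ?T euclideanreal F"
    unfolding F_def[abs_def] case_prod_beta
  proof (intro continuous_map_real_min continuous_map_sum continuous_map_real_divide continuous_map_real_max
      continuous_map_diff continuous_map_real_abs continuous_map_product_projection finP)
  qed (use e finP' in auto)
  have F_nonneg: "0 \<le> F v" and F_le: "F v \<le> 1" for v
    using e by (auto simp: F_def intro!: sum_nonneg)
  have F_abs: "\<bar>F v\<bar> \<le> 1" for v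
    using F_nonneg[of v] F_le[of v] by simp
  have lim: "(\<lambda>n. \<integral>x. F (restrict (X n x) I) \<partial>M n) \<longlonglongrightarrow> (\<integral>y. F (restrict (Y y) I) \<partial>Q)"
    using I by (intro fdd_converges_lim[OF fdd _ _ F_cont F_abs]) auto
  have meas: "\<forall>\<^sub>F n in sequentially. prob_space (M n) \<and> (\<lambda>x. restrict (X n x) I) \<in> M n \<rightarrow>\<^sub>M borel_of ?T"
    and measQ: "(\<lambda>y. restrict (Y y) I) \<in> Q \<rightarrow>\<^sub>M borel_of ?T"
    using fdd I unfolding fdd_converges_def converges_weakly_def by (auto dest!: spec[of _ I])
  have "\<forall>\<^sub>F n in sequentially. (\<integral>x. F (restrict (X n x) I) \<partial>M n) \<le> \<eta>"
    using meas E
  proof eventually_elim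
    case (elim n)
    interpret Mn: prob_space "M n"
      using elim by simp
    obtain A where A: "A \<in> sets (M n)" "measure (M n) A \<le> \<eta>"
        "\<And>x s t. x \<in> space (M n) - A \<Longrightarrow> s \<in> {0..T} \<Longrightarrow> t \<in> {0..T} \<Longrightarrow> \<bar>s - t\<bar> \<le> h \<Longrightarrow> \<bar>X n x s - X n x t\<bar> \<le> e"
      using elim by blast
    have "(\<integral>x. F (restrict (X n x) I) \<partial>M n) \<le> (\<integral>x. indicator A x \<partial>M n)"
    proof (rule integral_mono)
      show "integrable (M n) (\<lambda>x. F (restrict (X n x) I))"
        using elim by (intro Mn.integrable_bounded_borel_of[OF _ F_cont F_abs]) auto
      show "integrable (M n) (indicator A :: 'a \<Rightarrow> real)"
        using A by (simp add: Mn.emeasure_eq_measure)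
      fix x assume x: "x \<in> space (M n)"
      show "F (restrict (X n x) I) \<le> indicator A x"
      proof (cases "x \<in> A")
        case False
        have "max 0 (\<bar>restrict (X n x) I s - restrict (X n x) I t\<bar> - e) = 0" if "s \<in> I" "t \<in> I" "\<bar>s - t\<bar> \<le> h" for s t
        proof -
          have "s \<in> {0..T}" "t \<in> {0..T}"
            using that I by auto
          then have "\<bar>X n x s - X n x t\<bar> \<le> e"
            using False x that by (intro A(3)) auto
          then show ?thesis
            using that by simp
        qed
        then have "F (restrict (X n x) I) = 0"
          unfolding F_def by (subst sum.neutral) auto
        then show ?thesis
          by simp
      qed (simp add: F_le)
    qed
    also have "\<dots> = measure (M n) A"
      using A by simp
    finally show ?case
      using A(2) by simp
  qed
  with lim have F_int: "(\<integral>y. F (restrict (Y y) I) \<partial>Q) \<le> \<eta>"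
    by (intro tendsto_upperbound) auto
  have sets: "{y \<in> space Q. fluctuates h (2 * e) I y} \<in> sets Q"
    using I by (intro predE fluctuates_measurable countable_finite) auto
  then have "measure Q {y \<in> space Q. fluctuates h (2 * e) I y} = (\<integral>y. indicator {y \<in> space Q. fluctuates h (2 * e) I y} y \<partial>Q)"
    by simp
  also have "\<dots> \<le> (\<integral>y. F (restrict (Y y) I) \<partial>Q)"
  proof (rule integral_mono)
    show "integrable Q (indicator {y \<in> space Q. fluctuates h (2 * e) I y} :: 'b \<Rightarrow> real)"
      using sets by (simp add: Q.emeasure_eq_measure)
    show "integrable Q (\<lambda>y. F (restrict (Y y) I))"
      by (rule Q.integrable_bounded_borel_of[OF measQ F_cont F_abs])
    fix y assume "y \<in> space Q"
    show "indicator {y \<in> space Q. fluctuates h (2 * e) I y} y \<le> F (restrict (Y y) I)"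
    proof (cases "fluctuates h (2 * e) I y")
      case True
      then obtain s t where st: "s \<in> I" "t \<in> I" "\<bar>s - t\<bar> \<le> h" "2 * e \<le> \<bar>Y y s - Y y t\<bar>"
        unfolding fluctuates_def by blast
      have "1 \<le> max 0 (\<bar>Y y s - Y y t\<bar> - e) / e"
        using st(4) e by (simp add: le_divide_eq)
      also have "\<dots> = (\<lambda>(s, t). max 0 (\<bar>restrict (Y y) I s - restrict (Y y) I t\<bar> - e) / e) (s, t)"
        using st by simp
      also have "\<dots> \<le> (\<Sum>(s, t)\<in>?P. max 0 (\<bar>restrict (Y y) I s - restrict (Y y) I t\<bar> - e) / e)"
        using st e finP by (intro member_le_sum) auto
      finally have "F (restrict (Y y) I) = 1"
        by (simp add: F_def)
      then show ?thesis
        by (simp add: indicator_def)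
    qed (simp add: F_nonneg)
  qed
  finally show ?thesis
    using F_int by simp
qed

text \<open>Exhaust \<open>D\<close> by finite initial pieces of an enumeration. The events increase
  and their bound is uniform.\<close>

lemma fluctuates_countable:
  assumes T: "0 \<le> T" and e: "0 < e" and \<eta>: "0 < \<eta>" and D: "countable D" "D \<subseteq> {0..T}"
    and E: "\<forall>\<^sub>F n in sequentially. \<exists>E\<in>sets (M n). measure (M n) E \<le> \<eta> \<and>
        (\<forall>x\<in>space (M n) - E. \<forall>s\<in>{0..T}. \<forall>t\<in>{0..T}. \<bar>s - t\<bar> \<le> h \<longrightarrow> \<bar>X n x s - X n x t\<bar> \<le> e)"
  shows "measure Q {y \<in> space Q. fluctuates h (2 * e) D y} \<le> \<eta>"
proof (cases "D = {}")
  case True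
  then show ?thesis
    using \<eta> by (simp add: fluctuates_def)
next
  case False
  let ?I = "\<lambda>n. from_nat_into D ` {..n}"
  let ?A = "\<lambda>I. {y \<in> space Q. fluctuates h (2 * e) I y}"
  have I: "finite (?I n)" "?I n \<subseteq> {0..T}" for n
    using from_nat_into[OF False] D by auto
  have "(\<Union>n. ?A (?I n)) = ?A D"
  proof (intro equalityI subsetI)
    fix y assume "y \<in> ?A D"
    then obtain s t where st: "y \<in> space Q" "s \<in> D" "t \<in> D" "\<bar>s - t\<bar> \<le> h" "2 * e \<le> \<bar>Y y s - Y y t\<bar>"
      unfolding fluctuates_def by blast
    obtain i j where "s = from_nat_into D i" "t = from_nat_into D j"
      using from_nat_into_surj[OF D(1)] st by metis
    then have "s \<in> ?I (max i j)" "t \<in> ?I (max i j)"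
      by auto
    then have "y \<in> ?A (?I (max i j))"
      using st unfolding fluctuates_def by blast
    then show "y \<in> (\<Union>n. ?A (?I n))"
      by blast
  qed (use from_nat_into[OF False] in \<open>auto simp: fluctuates_def\<close>)
  moreover have "(\<lambda>n. measure Q (?A (?I n))) \<longlonglongrightarrow> measure Q (\<Union>n. ?A (?I n))"
  proof (rule Q.finite_Lim_measure_incseq)
    show "range (\<lambda>n. ?A (?I n)) \<subseteq> sets Q"
      using from_nat_into[OF False] D by (intro image_subsetI predE fluctuates_measurable countable_finite) (auto simp: subset_iff)
    show "incseq (\<lambda>n. ?A (?I n))"
      unfolding incseq_def
    proof (intro allI impI subsetI)
      fix m n y assume "m \<le> n" and y: "y \<in> ?A (?I m)"
      then have "?I m \<subseteq> ?I n"
        by (intro image_mono) auto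
      with y show "y \<in> ?A (?I n)"
        using fluctuates_mono by blast
    qed
  qed
  ultimately have "(\<lambda>n. measure Q (?A (?I n))) \<longlonglongrightarrow> measure Q (?A D)"
    by simp
  then show ?thesis
    by (rule LIMSEQ_le_const2) (use fluctuates_finite[OF T e \<eta> I E] in auto)
qed

text \<open>Uniform continuity on bounded parts of \<open>D\<close>. All scales run through the
  naturals, so that the event is a countable combination of measurable ones.\<close>

definition regular_on :: "real set \<Rightarrow> 'b \<Rightarrow> bool" where
  "regular_on D y \<longleftrightarrow> (\<forall>T j :: nat. \<exists>i :: nat. \<not> fluctuates (1 / Suc i) (1 / Suc j) (D \<inter> {0..real T}) y)"

lemma regular_on_measurable:
  assumes "countable D"
  shows "Measurable.pred Q (regular_on D)"
proof -
  have "Measurable.pred Q (fluctuates h e (D \<inter> {0..real T}))" for h e T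
    using assms by (intro fluctuates_measurable) auto
  then show ?thesis
    unfolding regular_on_def[abs_def] by (intro pred_intros_countable pred_intros_logic)
qed

lemma AE_regular_on:
  assumes D: "countable D"
  shows "AE y in Q. regular_on D y"
  unfolding regular_on_def AE_all_countable
proof (intro allI)
  fix T j :: nat
  let ?A = "\<lambda>i::nat. {y \<in> space Q. fluctuates (1 / Suc i) (1 / Suc j) (D \<inter> {0..real T}) y}"
  have sets: "?A i \<in> sets Q" for i
    using D by (intro predE fluctuates_measurable) auto
  have small: "measure Q (\<Inter>i. ?A i) \<le> \<eta>" if "0 < \<eta>" for \<eta>
  proof -
    \<comment> \<open>The tolerance is \<open>1 / (2 * Suc j)\<close> because the transfer to the
      limit doubles it.\<close>
    obtain h where h: "0 < h" "\<forall>\<^sub>F n in sequentially. \<exists>E\<in>sets (M n). measure (M n) E \<le> \<eta> \<and>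
        (\<forall>x\<in>space (M n) - E. \<forall>s\<in>{0..real T}. \<forall>t\<in>{0..real T}. \<bar>s - t\<bar> \<le> h \<longrightarrow> \<bar>X n x s - X n x t\<bar> \<le> 1 / (2 * Suc j))"
      using tight[of "real T" "1 / (2 * Suc j)" \<eta>] \<open>0 < \<eta>\<close> by auto
    obtain i :: nat where i: "1 / Suc i < h"
      using nat_approx_posE[OF h(1)] by blast
    have "measure Q (\<Inter>i. ?A i) \<le> measure Q {y \<in> space Q. fluctuates h (2 * (1 / (2 * Suc j))) (D \<inter> {0..real T}) y}"
    proof (rule Q.finite_measure_mono)
      show "{y \<in> space Q. fluctuates h (2 * (1 / (2 * Suc j))) (D \<inter> {0..real T}) y} \<in> sets Q"
        using D by (intro predE fluctuates_measurable) auto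
      have "?A i \<subseteq> {y \<in> space Q. fluctuates h (2 * (1 / (2 * Suc j))) (D \<inter> {0..real T}) y}"
      proof
        fix y assume "y \<in> ?A i"
        then obtain s t where st: "y \<in> space Q" "s \<in> D \<inter> {0..real T}" "t \<in> D \<inter> {0..real T}"
          "\<bar>s - t\<bar> \<le> 1 / real (Suc i)" "1 / real (Suc j) \<le> \<bar>Y y s - Y y t\<bar>"
          unfolding fluctuates_def by blast
        have "\<bar>s - t\<bar> \<le> h"
          using i st(4) by linarith
        moreover have eq: "2 * (1 / real (2 * Suc j)) = 1 / real (Suc j)"
          by (simp add: field_simps)
        ultimately show "y \<in> {y \<in> space Q. fluctuates h (2 * (1 / (2 * Suc j))) (D \<inter> {0..real T}) y}"
          unfolding fluctuates_def eq using st by blast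
      qed
      then show "(\<Inter>i. ?A i) \<subseteq> {y \<in> space Q. fluctuates h (2 * (1 / (2 * Suc j))) (D \<inter> {0..real T}) y}"
        by blast
    qed
    also have "\<dots> \<le> \<eta>"
      using D \<open>0 < \<eta>\<close> by (intro fluctuates_countable[OF _ _ _ _ _ h(2)]) auto
    finally show ?thesis .
  qed
  have "measure Q (\<Inter>i. ?A i) = 0"
  proof (rule antisym[OF field_le_epsilon measure_nonneg])
    show "measure Q (\<Inter>i. ?A i) \<le> 0 + \<eta>" if "0 < \<eta>" for \<eta>
      using small[OF that] by linarith
  qed
  then have "emeasure Q (\<Inter>i. ?A i) = 0"
    unfolding Q.emeasure_eq_measure by simp
  moreover have "(\<Inter>i. ?A i) \<in> sets Q"
    using sets by (intro sets.countable_INT) auto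
  ultimately have "AE y in Q. y \<notin> (\<Inter>i. ?A i)"
    by (intro AE_not_in null_setsI)
  then show "AE y in Q. \<exists>i::nat. \<not> fluctuates (1 / Suc i) (1 / Suc j) (D \<inter> {0..real T}) y"
    using AE_space
  proof eventually_elim
    case (elim y)
    then obtain i where "y \<notin> ?A i"
      by blast
    with elim(2) show ?case
      by blast
  qed
qed

lemma regular_on_subset: "regular_on D y \<Longrightarrow> D' \<subseteq> D \<Longrightarrow> regular_on D' y"
  unfolding regular_on_def fluctuates_def by (meson Int_mono order_refl subsetD)

lemma regular_onD:
  assumes y: "regular_on D y" and "0 < e" "0 \<le> T"
  obtains h where "0 < h" "\<And>s t. s \<in> D \<Longrightarrow> t \<in> D \<Longrightarrow> s \<in> {0..T} \<Longrightarrow> t \<in> {0..T} \<Longrightarrow> \<bar>s - t\<bar> \<le> h \<Longrightarrow> \<bar>Y y s - Y y t\<bar> < e"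
proof -
  obtain T' :: nat where T': "T \<le> real T'"
    using real_arch_simple by blast
  obtain j :: nat where j: "1 / Suc j < e"
    using nat_approx_posE[OF \<open>0 < e\<close>] by blast
  obtain i :: nat where i: "\<not> fluctuates (1 / Suc i) (1 / Suc j) (D \<inter> {0..real T'}) y"
    using y unfolding regular_on_def by blast
  show ?thesis
  proof (rule that)
    show "0 < 1 / real (Suc i)"
      by simp
    fix s t assume st: "s \<in> D" "t \<in> D" "s \<in> {0..T}" "t \<in> {0..T}" "\<bar>s - t\<bar> \<le> 1 / real (Suc i)"
    then have "s \<in> D \<inter> {0..real T'}" "t \<in> D \<inter> {0..real T'}"
      using T' by auto
    then have "\<not> 1 / real (Suc j) \<le> \<bar>Y y s - Y y t\<bar>"
      using i st(5) unfolding fluctuates_def by blast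
    then show "\<bar>Y y s - Y y t\<bar> < e"
      using j by linarith
  qed
qed

text \<open>Rational approximation from below: for \<open>0 \<le> u\<close> all grid points stay in
  \<open>{0..u}\<close>, inside the domain of the process.\<close>

definition grid :: "nat \<Rightarrow> real \<Rightarrow> real" where
  "grid n u = real_of_int \<lfloor>u * Suc n\<rfloor> / Suc n"

lemma grid:
  "grid n u \<in> \<rat>" "grid n u \<le> u" "0 \<le> grid n u - (u - 1 / Suc n)" "0 \<le> grid n u \<or> u < 0"
proof -
  show "grid n u \<in> \<rat>"
    by (simp add: grid_def)
  show "grid n u \<le> u"
    unfolding grid_def by (simp add: divide_le_eq)
  have "(u * Suc n - 1) / Suc n \<le> real_of_int \<lfloor>u * Suc n\<rfloor> / Suc n"
    by (intro divide_right_mono) linarith+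
  moreover have "(u * Suc n - 1) / Suc n = u - 1 / Suc n"
    by (simp add: diff_divide_distrib)
  ultimately show "0 \<le> grid n u - (u - 1 / Suc n)"
    by (simp add: grid_def)
  show "0 \<le> grid n u \<or> u < 0"
    by (auto simp: grid_def not_less)
qed

text \<open>The value 0 on the exceptional null set makes every path continuous, not just almost
  every one.\<close>

definition version :: "real \<Rightarrow> 'b \<Rightarrow> real" where
  "version u y = (if regular_on (\<rat> \<inter> {0..}) y then lim (\<lambda>n. Y y (grid n u)) else 0)"

lemma countable_rat_nonneg: "countable (\<rat> \<inter> {0..} :: real set)"
  by (simp add: countable_rat)

lemma version_limit:
  assumes y: "regular_on (\<rat> \<inter> {0..}) y" and u: "0 \<le> u"
  shows "(\<lambda>n. Y y (grid n u)) \<longlonglongrightarrow> version u y"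
proof -
  have "Cauchy (\<lambda>n. Y y (grid n u))"
  proof (rule CauchyI)
    fix e :: real assume "0 < e"
    obtain h where h: "0 < h" "\<And>s t. s \<in> \<rat> \<inter> {0..} \<Longrightarrow> t \<in> \<rat> \<inter> {0..} \<Longrightarrow> s \<in> {0..u} \<Longrightarrow> t \<in> {0..u} \<Longrightarrow>
        \<bar>s - t\<bar> \<le> h \<Longrightarrow> \<bar>Y y s - Y y t\<bar> < e"
      using regular_onD[OF y \<open>0 < e\<close> u] by blast
    obtain N :: nat where N: "1 / Suc N < h"
      using nat_approx_posE[OF h(1)] by blast
    have "norm (Y y (grid m u) - Y y (grid n u)) < e" if "N \<le> m" "N \<le> n" for m n
    proof -
      have "1 / real (Suc m) \<le> 1 / real (Suc N)" "1 / real (Suc n) \<le> 1 / real (Suc N)"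
        using that by (auto intro!: divide_left_mono)
      then have "\<bar>grid m u - grid n u\<bar> \<le> h"
        using grid(2,3)[of m u] grid(2,3)[of n u] grid(3)[of m u] grid(3)[of n u] N by (simp add: abs_le_iff)
      then show ?thesis
        using grid[of m u] grid[of n u] grid(2)[of m u] u by (auto intro!: h(2))
    qed
    then show "\<exists>N. \<forall>m\<ge>N. \<forall>n\<ge>N. norm (Y y (grid m u) - Y y (grid n u)) < e"
      by blast
  qed
  then have "convergent (\<lambda>n. Y y (grid n u))"
    by (rule Cauchy_convergent)
  then show ?thesis
    using y by (simp add: version_def convergent_LIMSEQ_iff)
qed

lemma version_measurable:
  assumes "0 \<le> u"
  shows "version u \<in> borel_measurable Q"
proof -
  have [measurable]: "Measurable.pred Q (regular_on (\<rat> \<inter> {0..}))"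
    by (intro regular_on_measurable countable_rat_nonneg)
  have "(\<lambda>y. if regular_on (\<rat> \<inter> {0..}) y then Y y (grid n u) else 0) \<in> borel_measurable Q" for n
  proof -
    have [measurable]: "(\<lambda>y. Y y (grid n u)) \<in> borel_measurable Q"
      using grid(4)[of n u] assms by (intro Y_measurable) auto
    show ?thesis
      by measurable
  qed
  moreover have "(\<lambda>n. if regular_on (\<rat> \<inter> {0..}) y then Y y (grid n u) else 0) \<longlonglongrightarrow> version u y" for y
    using version_limit[of y u] assms by (cases "regular_on (\<rat> \<inter> {0..}) y") (auto simp: version_def)
  ultimately show ?thesis
    by (rule borel_measurable_LIMSEQ_real[rotated])
qed

lemma version_continuous: "continuous_on {0..} (\<lambda>u. version u y)"
proof (cases "regular_on (\<rat> \<inter> {0..}) y")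
  case True
  show ?thesis
    unfolding continuous_on_iff
  proof (intro ballI allI impI)
    fix u e :: real assume u: "u \<in> {0..}" and e: "0 < e"
    obtain h where h: "0 < h" "\<And>s t. s \<in> \<rat> \<inter> {0..} \<Longrightarrow> t \<in> \<rat> \<inter> {0..} \<Longrightarrow> s \<in> {0..u + 1} \<Longrightarrow> t \<in> {0..u + 1} \<Longrightarrow>
        \<bar>s - t\<bar> \<le> h \<Longrightarrow> \<bar>Y y s - Y y t\<bar> < e / 2"
      using regular_onD[OF True, of "e / 2" "u + 1"] u e by auto
    obtain N :: nat where N: "1 / Suc N < h / 2"
      using nat_approx_posE[of "h / 2"] h(1) by auto
    have "dist (version t y) (version u y) < e" if t: "t \<in> {0..}" "dist t u < min 1 (h / 2)" for t
    proof -
      have close: "\<bar>Y y (grid n t) - Y y (grid n u)\<bar> \<le> e / 2" if "N \<le> n" for n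
      proof -
        have "1 / real (Suc n) \<le> 1 / real (Suc N)"
          using that by (auto intro!: divide_left_mono)
        moreover have "\<bar>t - u\<bar> < h / 2"
          using t(2) by (simp add: dist_real_def)
        ultimately have "\<bar>grid n t - grid n u\<bar> \<le> h"
          using grid(2,3)[of n t] grid(2,3)[of n u] N by linarith
        then have "\<bar>Y y (grid n t) - Y y (grid n u)\<bar> < e / 2"
          using grid[of n t] grid[of n u] u t by (intro h(2)) (auto simp: dist_real_def abs_less_iff)
        then show ?thesis
          by simp
      qed
      have "(\<lambda>n. \<bar>Y y (grid n t) - Y y (grid n u)\<bar>) \<longlonglongrightarrow> \<bar>version t y - version u y\<bar>"
        using t u by (intro tendsto_intros version_limit True) auto
      then have "\<bar>version t y - version u y\<bar> \<le> e / 2"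
        by (rule LIMSEQ_le_const2) (use close in blast)
      then show ?thesis
        using e by (simp add: dist_real_def)
    qed
    then show "\<exists>d>0. \<forall>t\<in>{0..}. dist t u < d \<longrightarrow> dist (version t y) (version u y) < e"
      using h(1) by (intro exI[of _ "min 1 (h / 2)"]) auto
  qed
qed (simp add: version_def)

text \<open>Regularity holds almost surely on any countable set, in particular on the rationals with
  \<open>u\<close> adjoined. There the values at the grid points converge to \<open>Y y u\<close> as
  well as to the version. The null set may depend on \<open>u\<close>.\<close>

lemma AE_version:
  assumes u: "0 \<le> u"
  shows "AE y in Q. version u y = Y y u"
proof -
  have "countable (insert u (\<rat> \<inter> {0..}))"
    using countable_rat_nonneg by simp
  from AE_regular_on[OF this] show ?thesis
  proof eventually_elim
    case (elim y)
    have "(\<lambda>n. Y y (grid n u)) \<longlonglongrightarrow> Y y u"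
    proof (rule LIMSEQ_I)
      fix e :: real assume "0 < e"
      obtain h where h: "0 < h" "\<And>s t. s \<in> insert u (\<rat> \<inter> {0..}) \<Longrightarrow> t \<in> insert u (\<rat> \<inter> {0..}) \<Longrightarrow> s \<in> {0..u} \<Longrightarrow> t \<in> {0..u} \<Longrightarrow>
          \<bar>s - t\<bar> \<le> h \<Longrightarrow> \<bar>Y y s - Y y t\<bar> < e"
        using regular_onD[OF elim \<open>0 < e\<close> u] by blast
      obtain N :: nat where N: "1 / Suc N < h"
        using nat_approx_posE[OF h(1)] by blast
      have "norm (Y y (grid n u) - Y y u) < e" if "N \<le> n" for n
      proof -
        have "1 / real (Suc n) \<le> 1 / real (Suc N)"
          using that by (auto intro!: divide_left_mono)
        then have "\<bar>grid n u - u\<bar> \<le> h"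
          using grid(2)[of n u] grid(3)[of n u] N by (simp add: abs_le_iff)
        then show ?thesis
          using grid[of n u] u by (auto intro!: h(2))
      qed
      then show "\<exists>N. \<forall>n\<ge>N. norm (Y y (grid n u) - Y y u) < e"
        by blast
    qed
    moreover have "(\<lambda>n. Y y (grid n u)) \<longlonglongrightarrow> version u y"
      using elim u by (intro version_limit) (auto intro: regular_on_subset)
    ultimately show ?case
      by (rule LIMSEQ_unique[rotated])
  qed
qed

end

section \<open>Piecewise linear interpolation and weak convergence\<close>

definition node :: "real \<Rightarrow> real \<Rightarrow> nat \<Rightarrow> nat \<Rightarrow> real" where
  "node a b p k = a + real k * ((b - a) / real p)"

text \<open>The coefficients beyond \<open>p\<close> are set to 0, so the result depends on
  \<open>f\<close> only through its values at the nodes and may be applied to a restriction of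
  \<open>f\<close>.\<close>

definition interpolate :: "real \<Rightarrow> real \<Rightarrow> nat \<Rightarrow> (real \<Rightarrow> real) \<Rightarrow> real \<Rightarrow> real" where
  "interpolate a b p f = combination (\<lambda>k u. hat ((u - a) / ((b - a) / real p) - real k)) (Suc p) a b
     (\<lambda>k. if k \<le> p then f (node a b p k) else 0)"

lemma tent:
  "continuous_on {a..b} (\<lambda>u. hat ((u - a) / ((b - a) / real p) - real k))"
  "\<bar>hat ((u - a) / ((b - a) / real p) - real k)\<bar> \<le> 1"
  by (simp only: divide_inverse[of "_ - a"], intro continuous_intros) (rule hat_bounded)

lemma node_ge: "a \<le> b \<Longrightarrow> a \<le> node a b p k"
  by (simp add: node_def)

lemma node_in:
  assumes "a \<le> b" "k \<le> p" "0 < p"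
  shows "node a b p k \<in> {a..b}"
proof -
  have "real k * ((b - a) / real p) \<le> real p * ((b - a) / real p)"
    using assms by (intro mult_right_mono) auto
  also have "\<dots> = b - a"
    using assms by simp
  finally show ?thesis
    using node_ge[OF assms(1)] by (simp add: node_def)
qed

lemma interpolate_approx:
  assumes ab: "a \<le> b" and p: "0 < p" "(b - a) / real p \<le> h"
    and f: "\<And>s t. s \<in> {a..b} \<Longrightarrow> t \<in> {a..b} \<Longrightarrow> \<bar>s - t\<bar> \<le> h \<Longrightarrow> \<bar>f s - f t\<bar> \<le> e"
    and u: "u \<in> {a..b}"
  shows "\<bar>interpolate a b p f u - f u\<bar> \<le> e"
proof -
  define d where "d = (b - a) / real p"
  define x where "x = (u - a) / d"
  have d: "0 \<le> d" "real p * d = b - a"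
    using ab p by (auto simp: d_def)
  \<comment> \<open>This also covers \<open>a = b\<close>: there \<open>d = 0\<close>,
    \<open>u = a\<close>, and division by zero gives \<open>x = 0\<close>.\<close>
  have ux: "u - a = d * x"
    using u d by (cases "d = 0") (auto simp: x_def)
  have x: "0 \<le> x" "x \<le> real p"
    using u d by (auto simp: x_def divide_le_eq mult.commute)
  have "interpolate a b p f u = (\<Sum>k<Suc p. (if k \<le> p then f (node a b p k) else 0) * hat (x - real k))"
    using u by (simp only: interpolate_def combination_def restrict_apply' x_def d_def)
  also have "\<bar>\<dots> - f u\<bar> \<le> e"
  proof (rule hat_sum_approx[OF x])
    fix k assume k: "k \<le> p" "\<bar>x - real k\<bar> \<le> 1"
    have "node a b p k - u = d * (real k - x)"
      using ux by (simp add: node_def d_def[symmetric] algebra_simps)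
    then have "\<bar>node a b p k - u\<bar> = d * \<bar>x - real k\<bar>"
      using d by (simp add: abs_mult abs_minus_commute)
    also have "\<dots> \<le> d"
      using mult_left_mono[OF k(2) d(1)] by simp
    finally have "\<bar>node a b p k - u\<bar> \<le> h"
      using p(2) by (simp add: d_def)
    then show "\<bar>(if k \<le> p then f (node a b p k) else 0) - f u\<bar> \<le> e"
      using k(1) f[OF node_in[OF ab k(1) p(1)] u] by simp
  qed
  finally show ?thesis .
qed

lemma interpolate_in_mspace:
  "interpolate a b p f \<in> mspace (cfunspace (top_of_set {a..b}) euclidean_metric)"
  unfolding interpolate_def combination_def by (intro restrict_in_mspace_C_top continuous_intros tent)

lemma interpolate_tendsto:
  assumes ab: "a \<le> b" and cont: "continuous_on {a..b} f"
  shows "(\<lambda>p. mdist (cfunspace (top_of_set {a..b}) euclidean_metric) (interpolate a b (Suc p) f) (restrict f {a..b})) \<longlonglongrightarrow> 0"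
proof (rule LIMSEQ_I)
  fix e :: real assume "0 < e"
  have "uniformly_continuous_on {a..b} f"
    using cont by (intro compact_uniformly_continuous) auto
  then obtain h where h: "0 < h" "\<And>s t. s \<in> {a..b} \<Longrightarrow> t \<in> {a..b} \<Longrightarrow> dist t s < h \<Longrightarrow> dist (f t) (f s) < e / 2"
    using \<open>0 < e\<close> unfolding uniformly_continuous_on_def by (metis half_gt_zero)
  obtain N :: nat where N: "(b - a) / (h / 2) \<le> real N"
    using real_arch_simple by blast
  have "norm (mdist (cfunspace (top_of_set {a..b}) euclidean_metric) (interpolate a b (Suc p) f) (restrict f {a..b}) - 0) < e"
    if "N \<le> p" for p
  proof -
    have "(b - a) / (h / 2) \<le> real (Suc p)"
      using N that by linarith
    then have "(b - a) / real (Suc p) \<le> h / 2"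
      using h(1) by (simp add: field_simps)
    then have "\<bar>interpolate a b (Suc p) f u - f u\<bar> \<le> e / 2" if "u \<in> {a..b}" for u
      using h that by (intro interpolate_approx[OF ab, where h = "h / 2"]) (auto simp: dist_real_def abs_minus_commute less_imp_le)
    then have "mdist (cfunspace (top_of_set {a..b}) euclidean_metric) (interpolate a b (Suc p) f) (restrict f {a..b}) \<le> e / 2"
      using \<open>0 < e\<close> by (intro mdist_C_top_le) auto
    then show ?thesis
      using \<open>0 < e\<close> by simp
  qed
  then show "\<exists>N. \<forall>p\<ge>N. norm (mdist (cfunspace (top_of_set {a..b}) euclidean_metric) (interpolate a b (Suc p) f) (restrict f {a..b}) - 0) < e"
    by blast
qed

lemma interpolate_continuous_map:
  assumes I: "node a b p ` {..p} \<subseteq> I"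
  shows "continuous_map (product_topology (\<lambda>_. euclideanreal) I) (C_top a b) (interpolate a b p)"
proof -
  have "continuous_map (product_topology (\<lambda>_. euclideanreal) I) euclideanreal (\<lambda>v. if k \<le> p then v (node a b p k) else 0)" for k
    using I by (cases "k \<le> p") (auto intro!: continuous_map_product_projection)
  then have "continuous_map (product_topology (\<lambda>_. euclideanreal) I) (euclidean :: (nat \<Rightarrow> real) topology)
      (\<lambda>v k. if k \<le> p then v (node a b p k) else 0)"
    unfolding euclidean_product_topology[symmetric] continuous_map_componentwise_UNIV by blast
  from continuous_map_compose[OF this combination_continuous_map[OF tent]]
  show ?thesis
    unfolding interpolate_def[abs_def] by (simp add: comp_def)
qed

lemma interpolate_restrict:
  "node a b p ` {..p} \<subseteq> I \<Longrightarrow> interpolate a b p (restrict f I) = interpolate a b p f"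
  unfolding interpolate_def by (intro arg_cong[where f = "combination _ _ _ _"] ext) auto

lemma interpolate_cong:
  "(\<And>k. k \<le> p \<Longrightarrow> f (node a b p k) = g (node a b p k)) \<Longrightarrow> interpolate a b p f = interpolate a b p g"
  unfolding interpolate_def by (intro arg_cong[where f = "combination _ _ _ _"]) auto

context tight_fdd
begin

lemma interpolate_version_measurable:
  assumes "0 \<le> a" "a \<le> b"
  shows "(\<lambda>y. interpolate a b p (\<lambda>u. version u y)) \<in> Q \<rightarrow>\<^sub>M borel_of (C_top a b)"
  unfolding interpolate_def
proof (rule combination_measurable[OF tent])
  show "(\<lambda>y. if k \<le> p then version (node a b p k) y else 0) \<in> borel_measurable Q" for k
    using version_measurable[of "node a b p k"] node_ge[OF assms(2), of p k] assms by simp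
qed

lemma version_continuous_on: "0 \<le> a \<Longrightarrow> continuous_on {a..b} (\<lambda>u. version u y)"
  by (rule continuous_on_subset[OF version_continuous]) auto

lemma version_C_measurable:
  assumes "0 \<le> a" "a \<le> b"
  shows "(\<lambda>y. restrict (\<lambda>u. version u y) {a..b}) \<in> Q \<rightarrow>\<^sub>M borel_of (C_top a b)"
  unfolding C_top_def
proof (rule borel_of_metric_limit[where f = "\<lambda>p y. interpolate a b (Suc p) (\<lambda>u. version u y)"])
  show "(\<lambda>y. interpolate a b (Suc p) (\<lambda>u. version u y)) \<in>
      Q \<rightarrow>\<^sub>M borel_of (mtopology_of (cfunspace (top_of_set {a..b}) euclidean_metric))" for p
    using interpolate_version_measurable[OF assms, of "Suc p"] by (simp only: C_top_def)
qed (intro restrict_in_mspace_C_top interpolate_tendsto version_continuous_on assms)+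

text \<open>Three comparisons: tightness replaces the process by its interpolation, the
  finite-dimensional limit carries the interpolations to the limit, and path continuity with
  dominated convergence removes the interpolation there.\<close>

theorem converges_weakly_version:
  assumes a: "0 \<le> a" and ab: "a \<le> b"
  shows "converges_weakly (C_top a b) M (\<lambda>n x. restrict (X n x) {a..b}) Q (\<lambda>y. restrict (\<lambda>u. version u y) {a..b})"
  unfolding C_top_def
proof (rule converges_weakly_lipschitzI)
  let ?m = "cfunspace (top_of_set {a..b}) euclidean_metric :: (real \<Rightarrow> real) metric"
  have X: "\<forall>\<^sub>F n in sequentially. prob_space (M n) \<and> (\<lambda>x. restrict (X n x) {a..b}) \<in> M n \<rightarrow>\<^sub>M borel_of (C_top a b)"
    using prob_space_M X_measurable[OF a ab] by eventually_elim simp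
  then show "\<forall>\<^sub>F n in sequentially. prob_space (M n) \<and> (\<lambda>x. restrict (X n x) {a..b}) \<in> M n \<rightarrow>\<^sub>M borel_of (mtopology_of ?m)"
    by (simp only: C_top_def)
  show "prob_space Q"
    by (rule prob_space_Q)
  show Y: "(\<lambda>y. restrict (\<lambda>u. version u y) {a..b}) \<in> Q \<rightarrow>\<^sub>M borel_of (mtopology_of ?m)"
    using version_C_measurable[OF a ab] by (simp only: C_top_def)
  fix F :: "(real \<Rightarrow> real) \<Rightarrow> real" and L c
  assume lip: "lipschitz_map ?m L F" and c: "\<And>f. f \<in> mspace ?m \<Longrightarrow> \<bar>F f\<bar> \<le> c"
  have F_cont: "continuous_map (C_top a b) euclideanreal F"
    unfolding C_top_def by (rule lipschitz_map_continuous[OF lip])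
  have F_bound: "\<bar>F f\<bar> \<le> c" if "f \<in> topspace (C_top a b)" for f
    using that c by (simp add: C_top_def)
  have L: "0 \<le> L" and F_lip: "\<And>f g. f \<in> mspace ?m \<Longrightarrow> g \<in> mspace ?m \<Longrightarrow> \<bar>F f - F g\<bar> \<le> L * mdist ?m f g"
    using lip by (auto simp: lipschitz_map_def)
  have c0: "0 \<le> c"
    using c[OF interpolate_in_mspace] by (rule order_trans[OF abs_ge_zero])
  show "(\<lambda>n. \<integral>x. F (restrict (X n x) {a..b}) \<partial>M n) \<longlonglongrightarrow> (\<integral>y. F (restrict (\<lambda>u. version u y) {a..b}) \<partial>Q)"
  proof (rule tendstoI)
    fix e :: real assume e: "0 < e"
    \<comment> \<open>Off the exceptional set the Lipschitz bound costs \<open>L * e'\<close>, and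
      on it boundedness costs \<open>2 * c * \<eta>\<close>; each is at most a quarter of
      \<open>e\<close>. Adding 1 to \<open>L\<close> and \<open>c\<close> avoids division by
      0.\<close>
    define e' \<eta> where "e' = e / (4 * (L + 1))" and "\<eta> = e / (8 * (c + 1))"
    have e': "0 < e'" "L * e' \<le> e / 4" and \<eta>: "0 < \<eta>" "2 * c * \<eta> \<le> e / 4"
      using e L c0 by (auto simp: e'_def \<eta>_def field_simps)
    obtain h where h: "0 < h" and tight_h: "\<forall>\<^sub>F n in sequentially. \<exists>E\<in>sets (M n). measure (M n) E \<le> \<eta> \<and>
        (\<forall>x\<in>space (M n) - E. \<forall>s\<in>{0..b}. \<forall>t\<in>{0..b}. \<bar>s - t\<bar> \<le> h \<longrightarrow> \<bar>X n x s - X n x t\<bar> \<le> e')"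
      using tight[of b e' \<eta>] a ab e' \<eta> by auto
    have "(\<lambda>p. \<integral>y. F (interpolate a b (Suc p) (\<lambda>u. version u y)) \<partial>Q) \<longlonglongrightarrow> (\<integral>y. F (restrict (\<lambda>u. version u y) {a..b}) \<partial>Q)"
    proof (rule integral_dominated_convergence[where w = "\<lambda>_. c"])
      show "(\<lambda>y. F (restrict (\<lambda>u. version u y) {a..b})) \<in> borel_measurable Q"
        by (rule measurable_compose[OF version_C_measurable[OF a ab] continuous_map_measurable[OF F_cont]])
      show "(\<lambda>y. F (interpolate a b (Suc p) (\<lambda>u. version u y))) \<in> borel_measurable Q" for p
        by (rule measurable_compose[OF interpolate_version_measurable[OF a ab] continuous_map_measurable[OF F_cont]])
      show "AE y in Q. (\<lambda>p. F (interpolate a b (Suc p) (\<lambda>u. version u y))) \<longlonglongrightarrow> F (restrict (\<lambda>u. version u y) {a..b})"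
      proof (rule AE_I2, rule LIM_zero_cancel)
        fix y
        have lim: "(\<lambda>p. L * mdist ?m (interpolate a b (Suc p) (\<lambda>u. version u y)) (restrict (\<lambda>u. version u y) {a..b})) \<longlonglongrightarrow> L * 0"
          by (intro tendsto_intros interpolate_tendsto ab version_continuous_on a)
        show "(\<lambda>p. F (interpolate a b (Suc p) (\<lambda>u. version u y)) - F (restrict (\<lambda>u. version u y) {a..b})) \<longlonglongrightarrow> 0"
        proof (rule Lim_null_comparison[OF _ lim[unfolded mult_zero_right]])
          show "\<forall>\<^sub>F p in sequentially. norm (F (interpolate a b (Suc p) (\<lambda>u. version u y)) - F (restrict (\<lambda>u. version u y) {a..b})) \<le>
            L * mdist ?m (interpolate a b (Suc p) (\<lambda>u. version u y)) (restrict (\<lambda>u. version u y) {a..b})"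
            unfolding real_norm_def
            by (intro always_eventually allI F_lip interpolate_in_mspace restrict_in_mspace_C_top version_continuous_on a)
        qed
      qed
      show "AE y in Q. norm (F (interpolate a b (Suc p) (\<lambda>u. version u y))) \<le> c" for p
        using c[OF interpolate_in_mspace] by simp
    qed simp
    then have "\<forall>\<^sub>F p in sequentially. dist (\<integral>y. F (interpolate a b (Suc p) (\<lambda>u. version u y)) \<partial>Q) (\<integral>y. F (restrict (\<lambda>u. version u y) {a..b}) \<partial>Q) < e / 4"
      using e by (intro tendstoD) auto
    moreover obtain N :: nat where N: "(b - a) / h \<le> real N"
      using real_arch_simple by blast
    have "\<forall>\<^sub>F p in sequentially. N \<le> p"
      by (rule eventually_ge_at_top)
    ultimately have "\<forall>\<^sub>F p in sequentially. dist (\<integral>y. F (interpolate a b (Suc p) (\<lambda>u. version u y)) \<partial>Q) (\<integral>y. F (restrict (\<lambda>u. version u y) {a..b}) \<partial>Q) < e / 4 \<and> N \<le> p"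
      by (rule eventually_conj)
    then obtain p0 where p0: "dist (\<integral>y. F (interpolate a b (Suc p0) (\<lambda>u. version u y)) \<partial>Q) (\<integral>y. F (restrict (\<lambda>u. version u y) {a..b}) \<partial>Q) < e / 4" "N \<le> p0"
      by (auto simp: eventually_sequentially)
    define p where "p = Suc p0"
    have p: "0 < p" "(b - a) / real p \<le> h"
    proof -
      have "(b - a) / h \<le> real p"
        using N p0(2) by (simp add: p_def)
      then show "(b - a) / real p \<le> h"
        using h by (simp add: p_def field_simps)
    qed (simp add: p_def)
    define I where "I = node a b p ` {..p}"
    have I: "finite I" "I \<subseteq> {0..}" "node a b p ` {..p} \<subseteq> I"
      using node_ge[OF ab, of p] a by (auto simp: I_def intro: order_trans)
    let ?T = "product_topology (\<lambda>_. euclideanreal) I"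
    have G_cont: "continuous_map ?T euclideanreal (\<lambda>v. F (interpolate a b p v))"
      using continuous_map_compose[OF interpolate_continuous_map[OF I(3)] F_cont] by (simp add: comp_def)
    have G_bound: "\<bar>F (interpolate a b p v)\<bar> \<le> c" for v
      by (rule c[OF interpolate_in_mspace])
    have "(\<lambda>n. \<integral>x. F (interpolate a b p (restrict (X n x) I)) \<partial>M n) \<longlonglongrightarrow> (\<integral>y. F (interpolate a b p (restrict (Y y) I)) \<partial>Q)"
      by (rule fdd_converges_lim[OF fdd I(1,2) G_cont G_bound])
    \<comment> \<open>Only finitely many nodes are involved, so \<open>Y\<close> and its version
      agree at all of them almost surely.\<close>
    moreover have "(\<integral>y. F (interpolate a b p (restrict (Y y) I)) \<partial>Q) = (\<integral>y. F (interpolate a b p (\<lambda>u. version u y)) \<partial>Q)"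
    proof (rule integral_cong_AE)
      have "(\<lambda>y. restrict (Y y) I) \<in> Q \<rightarrow>\<^sub>M borel_of ?T"
        using fdd I unfolding fdd_converges_def converges_weakly_def by blast
      then show "(\<lambda>y. F (interpolate a b p (restrict (Y y) I))) \<in> borel_measurable Q"
        by (rule measurable_compose[OF _ continuous_map_measurable[OF G_cont]])
      show "(\<lambda>y. F (interpolate a b p (\<lambda>u. version u y))) \<in> borel_measurable Q"
        by (rule measurable_compose[OF interpolate_version_measurable[OF a ab] continuous_map_measurable[OF F_cont]])
      have "AE y in Q. \<forall>k\<in>{..p}. version (node a b p k) y = Y y (node a b p k)"
        using I by (intro AE_finite_allI AE_version) auto
      then show "AE y in Q. F (interpolate a b p (restrict (Y y) I)) = F (interpolate a b p (\<lambda>u. version u y))"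
      proof eventually_elim
        case (elim y)
        then have "interpolate a b p (Y y) = interpolate a b p (\<lambda>u. version u y)"
          by (intro interpolate_cong) auto
        then show ?case
          by (simp add: interpolate_restrict[OF I(3)])
      qed
    qed
    ultimately have "(\<lambda>n. \<integral>x. F (interpolate a b p (X n x)) \<partial>M n) \<longlonglongrightarrow> (\<integral>y. F (interpolate a b p (\<lambda>u. version u y)) \<partial>Q)"
      by (simp add: interpolate_restrict[OF I(3)])
    then have lim_p: "\<forall>\<^sub>F n in sequentially. dist (\<integral>x. F (interpolate a b p (X n x)) \<partial>M n) (\<integral>y. F (interpolate a b p (\<lambda>u. version u y)) \<partial>Q) < e / 4"
      using e by (intro tendstoD) auto
    have meas: "\<forall>\<^sub>F n in sequentially. (\<lambda>x. restrict (X n x) I) \<in> M n \<rightarrow>\<^sub>M borel_of ?T"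
      using fdd I unfolding fdd_converges_def converges_weakly_def by (auto dest!: spec[of _ I] elim: eventually_mono)
    have "\<forall>\<^sub>F n in sequentially. \<bar>(\<integral>x. F (restrict (X n x) {a..b}) \<partial>M n) - (\<integral>x. F (interpolate a b p (X n x)) \<partial>M n)\<bar> \<le> e / 2"
      using X meas tight_h
    proof eventually_elim
      case (elim n)
      interpret Mn: prob_space "M n"
        using elim by simp
      have Xn: "(\<lambda>x. restrict (X n x) {a..b}) \<in> M n \<rightarrow>\<^sub>M borel_of (C_top a b)"
        using elim by simp
      obtain E where E: "E \<in> sets (M n)" "measure (M n) E \<le> \<eta>"
        "\<And>x s t. x \<in> space (M n) - E \<Longrightarrow> s \<in> {0..b} \<Longrightarrow> t \<in> {0..b} \<Longrightarrow> \<bar>s - t\<bar> \<le> h \<Longrightarrow> \<bar>X n x s - X n x t\<bar> \<le> e'"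
        using elim(3) by blast
      have int: "integrable (M n) (\<lambda>x. F (restrict (X n x) {a..b}))"
        by (rule Mn.integrable_bounded_borel_of[OF Xn F_cont F_bound])
      have int': "integrable (M n) (\<lambda>x. F (interpolate a b p (X n x)))"
        using Mn.integrable_bounded_borel_of[OF elim(2) G_cont G_bound] by (simp add: interpolate_restrict[OF I(3)])
      have "\<bar>(\<integral>x. F (restrict (X n x) {a..b}) \<partial>M n) - (\<integral>x. F (interpolate a b p (X n x)) \<partial>M n)\<bar> =
          \<bar>\<integral>x. F (restrict (X n x) {a..b}) - F (interpolate a b p (X n x)) \<partial>M n\<bar>"
        using int int' by simp
      also have "\<dots> \<le> (\<integral>x. \<bar>F (restrict (X n x) {a..b}) - F (interpolate a b p (X n x))\<bar> \<partial>M n)"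
        by (rule integral_abs_bound)
      also have "\<dots> \<le> (\<integral>x. L * e' + 2 * c * indicator E x \<partial>M n)"
      proof (rule integral_mono)
        show "integrable (M n) (\<lambda>x. \<bar>F (restrict (X n x) {a..b}) - F (interpolate a b p (X n x))\<bar>)"
          using int int' by (intro integrable_abs Bochner_Integration.integrable_diff)
        show "integrable (M n) (\<lambda>x. L * e' + 2 * c * indicator E x)"
          using E(1) by (simp add: Mn.emeasure_eq_measure)
        fix x assume x: "x \<in> space (M n)"
        have in_space: "restrict (X n x) {a..b} \<in> mspace ?m"
          using measurable_space[OF Xn x] by (simp add: C_top_def)
        show "\<bar>F (restrict (X n x) {a..b}) - F (interpolate a b p (X n x))\<bar> \<le> L * e' + 2 * c * indicator E x"
        proof (cases "x \<in> E")
          case True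
          have "0 \<le> L * e'"
            using L e' by simp
          then have "\<bar>F (restrict (X n x) {a..b}) - F (interpolate a b p (X n x))\<bar> \<le> L * e' + 2 * c"
            using c[OF in_space] G_bound[of "X n x"] by linarith
          with True show ?thesis
            by simp
        next
          case False
          have "mdist ?m (interpolate a b p (X n x)) (restrict (X n x) {a..b}) \<le> e'"
          proof (rule mdist_C_top_le)
            fix u assume u: "u \<in> {a..b}"
            have "\<bar>interpolate a b p (X n x) u - X n x u\<bar> \<le> e'"
              by (rule interpolate_approx[OF ab p _ u]) (use False x a in \<open>auto intro!: E(3)\<close>)
            then show "\<bar>interpolate a b p (X n x) u - restrict (X n x) {a..b} u\<bar> \<le> e'"
              using u by simp
          qed (use e' in simp)
          then have "L * mdist ?m (restrict (X n x) {a..b}) (interpolate a b p (X n x)) \<le> L * e'"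
            using L by (subst mdist_commute) (intro mult_left_mono)
          then show ?thesis
            using F_lip[OF in_space interpolate_in_mspace, of p "X n x"] False by simp
        qed
      qed
      also have "\<dots> = L * e' + 2 * c * measure (M n) E"
        using E(1) by (simp add: Mn.emeasure_eq_measure Mn.prob_space)
      also have "\<dots> \<le> e / 4 + 2 * c * \<eta>"
        using e' E(2) c0 by (intro add_mono mult_left_mono) auto
      also have "\<dots> \<le> e / 2"
        using \<eta> by simp
      finally show ?case .
    qed
    with lim_p show "\<forall>\<^sub>F n in sequentially. dist (\<integral>x. F (restrict (X n x) {a..b}) \<partial>M n) (\<integral>y. F (restrict (\<lambda>u. version u y) {a..b}) \<partial>Q) < e"
    proof eventually_elim
      case (elim n)
      then show ?case
        using p0(1) unfolding p_def[symmetric] dist_real_def by linarith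
    qed
  qed
qed

end

section \<open>The point-to-point model\<close>

text \<open>The absolute value changes the weights on a null set only, but makes them nonnegative
  everywhere, as the pathwise comparisons require.\<close>

lemma exponential_model:
  assumes "0 < n"
  shows "prob_space (exponential_product 1 1 n)"
    and "exponential_weights (exponential_product 1 1 n) 1 1 n (\<lambda>p u. \<bar>u p\<bar>)"
proof -
  let ?M = "exponential_product 1 1 n"
  show M: "prob_space ?M"
    by (rule prob_space_exponential_product) simp_all
  interpret prob_space ?M
    by (rule M)
  have w: "exponential_weights ?M 1 1 n (\<lambda>p u. u p)"
    by (rule exponential_weights_product) (use assms in simp_all)
  show "exponential_weights ?M 1 1 n (\<lambda>p u. \<bar>u p\<bar>)"
    unfolding exponential_weights_def
  proof (intro conjI ballI)
    show "indep_vars (\<lambda>_. borel) (\<lambda>p u. \<bar>u p\<bar>) (sites n)"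
      by (rule indep_vars_compose2[where M' = "\<lambda>_. borel"]) (use w in \<open>auto simp: exponential_weights_def\<close>)
    fix p assume "p \<in> sites n"
    then have d: "distributed ?M lborel (\<lambda>u. u p) (exponential_density (site_rate 1 1 p))"
      using w by (simp add: exponential_weights_def)
    have pos: "0 < site_rate 1 1 p"
      by (simp add: site_rate_pos)
    have [measurable]: "(\<lambda>u. u p) \<in> borel_measurable ?M"
      using distributed_measurable[OF d] by simp
    show "distributed ?M lborel (\<lambda>u. \<bar>u p\<bar>) (exponential_density (site_rate 1 1 p))"
      unfolding exponential_distributed_iff[OF pos]
    proof (intro conjI allI impI)
      fix t :: real assume t: "0 \<le> t"
      have "prob {u \<in> space ?M. \<bar>u p\<bar> \<le> t} = prob {u \<in> space ?M. u p \<le> t}"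
        by (rule finite_measure_eq_AE[OF AE_mp[OF exponential_AE_pos[OF d pos] AE_I2]]) auto
      then show "prob {u \<in> space ?M. \<bar>u p\<bar> \<le> t} = 1 - exp (- t * site_rate 1 1 p)"
        using exponential_distributedD_le[OF d t pos] by simp
    qed simp
  qed
qed

text \<open>The window bound lives on the coupled space. Finitely many independent weights have a
  joint law determined by the marginals. These are compared as distributions rather than densities,
  since the weights of the bottom row are point masses at 0.\<close>

lemma pp_weights_transfer:
  assumes w: "pp_weights P r w" and "0 < r" and M: "prob_space M"
    and g: "exponential_weights M 1 1 n g" and "0 < n"
    and A: "A \<in> sets (PiM (sites n) (\<lambda>_. borel))"
  shows "measure P {x \<in> space P. (\<lambda>p\<in>sites n. w p x) \<in> A} =
    measure M {u \<in> space M. (\<lambda>p\<in>sites n. scaled_weights (1 / r) 0 g p u) \<in> A}"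
proof -
  interpret P: prob_space P
    using w by (simp add: pp_weights_def)
  interpret M: prob_space M
    by (rule M)
  let ?v = "scaled_weights (1 / r) 0 g"
  have ne: "sites n \<noteq> {}"
    using \<open>0 < n\<close> by (auto simp: sites_def)
  have w_indep: "P.indep_vars (\<lambda>_. borel) w (sites n)"
    using w by (auto simp: pp_weights_def half_space_def sites_def intro: P.indep_vars_subset)
  have w_rv: "w p \<in> borel_measurable P" if "p \<in> sites n" for p
    using w_indep that by (simp add: P.indep_vars_def)
  have v_indep: "M.indep_vars (\<lambda>_. borel) ?v (sites n)"
    unfolding scaled_weights_def[abs_def]
    by (rule M.indep_vars_compose2[where M' = "\<lambda>_. borel"]) (use g in \<open>auto simp: exponential_weights_def\<close>)
  have v_rv: "?v p \<in> borel_measurable M" if "p \<in> sites n" for p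
    using v_indep that by (simp add: M.indep_vars_def)
  have marginal: "distr P borel (w p) = distr M borel (?v p)" if p: "p \<in> sites n" for p
  proof -
    obtain i j where ij: "p = (i, j)" "j \<le> i" "0 < i" "i \<le> n"
      using p by (auto simp: sites_def)
    show ?thesis
    proof (cases "j = 0")
      case True
      have "distr P borel (w p) = distr P borel (\<lambda>_. 0)"
        using w True ij by (intro distr_cong) (auto simp: pp_weights_def)
      also have "\<dots> = distr M borel (\<lambda>_. 0)"
        by (simp add: P.distr_const M.distr_const)
      also have "\<dots> = distr M borel (?v p)"
        using True ij by (intro distr_cong) (auto simp: scaled_weights_def site_rate_def)
      finally show ?thesis .
    next
      case False
      define l where "l = (if j = i then r else 1)"
      have gp: "distributed M lborel (g p) (exponential_density 1)"
        using g p by (auto simp: exponential_weights_def site_rate_def split: if_splits)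
      have "?v p = (\<lambda>u. 1 / l * g p u)"
        using False ij by (auto simp: scaled_weights_def site_rate_def l_def)
      then have "distributed M lborel (?v p) (exponential_density l)"
        using M.exponential_scale[OF gp, of l] \<open>0 < r\<close> by (simp add: l_def)
      moreover have "distributed P lborel (w p) (exponential_density l)"
        using w False ij by (auto simp: pp_weights_def l_def)
      ultimately have "distr P lborel (w p) = distr M lborel (?v p)"
        by (simp add: distributed_distr_eq_density)
      then show ?thesis
        by (metis distr_cong sets_lborel)
    qed
  qed
  have "distr P (PiM (sites n) (\<lambda>_. borel)) (\<lambda>x. \<lambda>p\<in>sites n. w p x) = PiM (sites n) (\<lambda>p. distr P borel (w p))"
    by (rule P.indep_vars_iff_distr_eq_PiM'[OF ne, THEN iffD1, OF _ w_indep]) (rule w_rv)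
  also have "\<dots> = PiM (sites n) (\<lambda>p. distr M borel (?v p))"
    by (intro PiM_cong refl marginal)
  also have "\<dots> = distr M (PiM (sites n) (\<lambda>_. borel)) (\<lambda>u. \<lambda>p\<in>sites n. ?v p u)"
    by (rule M.indep_vars_iff_distr_eq_PiM'[OF ne, THEN iffD1, OF _ v_indep, symmetric]) (rule v_rv)
  finally have "measure (distr P (PiM (sites n) (\<lambda>_. borel)) (\<lambda>x. \<lambda>p\<in>sites n. w p x)) A =
      measure (distr M (PiM (sites n) (\<lambda>_. borel)) (\<lambda>u. \<lambda>p\<in>sites n. ?v p u)) A"
    by simp
  then show ?thesis
    using A by (simp add: measure_distr measurable_restrict w_rv v_rv vimage_def Int_def conj_commute)
qed

lemma pp_weights_measurable: "pp_weights P r w \<Longrightarrow> p \<in> sites n \<Longrightarrow> w p \<in> borel_measurable P"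
  by (auto simp: pp_weights_def prob_space.indep_vars_def half_space_def sites_def)

lemma tendsto_powr_third: "(\<lambda>n. real n powr (- 1/3)) \<longlonglongrightarrow> 0"
  by (intro tendsto_neg_powr filterlim_real_sequentially) auto

lemma diag_param_pos: "\<forall>\<^sub>F n in sequentially. 0 < diag_param \<delta> n"
proof -
  have "(\<lambda>n. diag_param \<delta> n) \<longlonglongrightarrow> 1/2 + \<delta> * 2 powr (- 4/3) * 0"
    unfolding diag_param_def by (intro tendsto_intros tendsto_powr_third)
  then show ?thesis
    by (rule order_tendstoD) simp
qed

section \<open>From lattice increments to the interpolated process\<close>

lemma convex_close:
  fixes a b y e f :: real
  assumes "\<bar>a - y\<bar> \<le> e" "\<bar>b - y\<bar> \<le> e" "0 \<le> f" "f \<le> 1"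
  shows "\<bar>(1 - f) * a + f * b - y\<bar> \<le> e"
proof -
  have "(1 - f) * \<bar>a - y\<bar> + f * \<bar>b - y\<bar> \<le> (1 - f) * e + f * e"
    using assms by (intro add_mono mult_left_mono) auto
  moreover have "\<bar>(1 - f) * a + f * b - y\<bar> \<le> (1 - f) * \<bar>a - y\<bar> + f * \<bar>b - y\<bar>"
  proof -
    have "(1 - f) * a + f * b - y = (1 - f) * (a - y) + f * (b - y)"
      by (simp add: algebra_simps)
    also have "\<bar>\<dots>\<bar> \<le> \<bar>(1 - f) * (a - y)\<bar> + \<bar>f * (b - y)\<bar>"
      by (rule abs_triangle_ineq)
    also have "\<dots> = (1 - f) * \<bar>a - y\<bar> + f * \<bar>b - y\<bar>"
      using assms by (simp add: abs_mult)
    finally show ?thesis .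
  qed
  ultimately show ?thesis
    by (simp add: algebra_simps)
qed

text \<open>Interpolation at \<open>u\<close> uses the node below \<open>u * c\<close> and the next
  one. Reaching the next node costs 1 in the bound by \<open>K\<close>. For the distance of the
  nodes used at \<open>u\<close> and at \<open>v\<close>, rounding and the shift to the next node
  cost at most 1 each.\<close>

lemma pp_process_close:
  assumes grid: "\<And>k l. k \<le> l \<Longrightarrow> l \<le> k + m \<Longrightarrow> l \<le> K \<Longrightarrow> \<bar>pp_grid w n l - pp_grid w n k\<bar> \<le> e"
    and c: "c = (2 * real n) powr (2/3)"
    and u: "0 \<le> u" "u * c + 1 \<le> real K" and v: "0 \<le> v" "v * c + 1 \<le> real K"
    and m: "\<bar>u - v\<bar> * c + 2 \<le> real m"
  shows "\<bar>pp_process w n u - pp_process w n v\<bar> \<le> e"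
proof -
  have c0: "0 \<le> c"
    by (simp add: c)
  define i j where "i = nat \<lfloor>u * c\<rfloor>" and "j = nat \<lfloor>v * c\<rfloor>"
  have i: "real i \<le> u * c" "u * c < real i + 1" and j: "real j \<le> v * c" "v * c < real j + 1"
    using u v c0 by (auto simp: i_def j_def)
  have ij_m: "\<bar>real i - real j\<bar> + 1 \<le> real m"
  proof -
    have "\<bar>u * c - v * c\<bar> = \<bar>u - v\<bar> * c"
      using c0 by (simp add: left_diff_distrib[symmetric] abs_mult)
    then show ?thesis
      using i j m by linarith
  qed
  have grid': "\<bar>pp_grid w n i' - pp_grid w n j'\<bar> \<le> e" if "i' = i \<or> i' = Suc i" "j' = j \<or> j' = Suc j" for i' j'
  proof -
    have "i' \<le> K" "j' \<le> K" "i' \<le> j' + m" "j' \<le> i' + m"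
      using that i j u v ij_m by linarith+
    then show ?thesis
      using grid[of i' j'] grid[of j' i'] by (cases "i' \<le> j'") (auto simp: abs_minus_commute)
  qed
  have process: "pp_process w n u = (1 - frac (u * c)) * pp_grid w n i + frac (u * c) * pp_grid w n (Suc i)"
      "pp_process w n v = (1 - frac (v * c)) * pp_grid w n j + frac (v * c) * pp_grid w n (Suc j)"
    by (simp_all add: pp_process_def Let_def i_def j_def c)
  have frac: "0 \<le> frac t" "frac t \<le> 1" for t :: real
    by (simp_all add: less_imp_le frac_lt_1)
  have "\<bar>pp_process w n u - pp_grid w n j'\<bar> \<le> e" if "j' = j \<or> j' = Suc j" for j'
    unfolding process(1) using that by (intro convex_close grid' frac) auto
  then have close: "\<bar>pp_grid w n j' - pp_process w n u\<bar> \<le> e" if "j' = j \<or> j' = Suc j" for j'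
    using that by (simp only: abs_minus_commute)
  have "\<bar>pp_process w n v - pp_process w n u\<bar> \<le> e"
    unfolding process(2) by (intro convex_close frac close) simp_all
  then show ?thesis
    by (simp only: abs_minus_commute)
qed

lemma pp_process_measurable:
  assumes w: "pp_weights P r w" and "0 < n" and ab: "0 \<le> a" "a \<le> b"
  shows "(\<lambda>x. restrict (pp_process (\<lambda>p. w p x) n) {a..b}) \<in> P \<rightarrow>\<^sub>M borel_of (C_top a b)"
proof -
  define c where "c = (2 * real n) powr (2/3)"
  obtain K :: nat where K: "b * c \<le> real K"
    using real_arch_simple by blast
  have "(\<lambda>x. combination (\<lambda>k u. hat (u * c - real k)) (Suc K) a b (pp_grid (\<lambda>p. w p x) n)) \<in> P \<rightarrow>\<^sub>M borel_of (C_top a b)"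
  proof (rule combination_measurable)
    show "continuous_on {a..b} (\<lambda>u. hat (u * c - real k))" for k
      by (intro continuous_intros)
    show "\<bar>hat (u * c - real k)\<bar> \<le> 1" for k u
      by (rule hat_bounded)
    fix k
    have "(\<lambda>x. passage (\<lambda>p. w p x) (n + min k n) (n - min k n)) \<in> borel_measurable P"
      by (rule passage_measurable[where n = "2 * n"]) (auto intro: pp_weights_measurable[OF w])
    then show "(\<lambda>x. pp_grid (\<lambda>p. w p x) n k) \<in> borel_measurable P"
      unfolding pp_grid_def by (subst lpp_eq_passage) auto
  qed
  moreover have "combination (\<lambda>k u. hat (u * c - real k)) (Suc K) a b (pp_grid (\<lambda>p. w p x) n) =
      restrict (pp_process (\<lambda>p. w p x) n) {a..b}" for x
    unfolding combination_def
  proof (intro restrict_ext)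
    fix u assume u: "u \<in> {a..b}"
    have "u * c \<le> b * c"
      using u by (intro mult_right_mono) (auto simp: c_def)
    then have "0 \<le> u * c" "u * c \<le> real K"
      using u ab K by (auto simp: c_def)
    from hat_sum[OF this]
    show "(\<Sum>k<Suc K. pp_grid (\<lambda>p. w p x) n k * hat (u * c - real k)) = pp_process (\<lambda>p. w p x) n u"
      by (simp add: pp_process_def Let_def c_def del: sum.lessThan_Suc)
  qed
  ultimately show ?thesis
    by simp
qed

text \<open>The scaling is \<open>2 powr (4/3) / s\<close>, and its constant, at least 1, is
  dropped. For indices up to \<open>n\<close> the freezing in \<open>pp_grid\<close> is
  inactive.\<close>

lemma pp_grid_diff_le:
  assumes "0 < n" "k \<le> n" "l \<le> n" and s: "s = real n powr (- 1/3)"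
    and le: "\<bar>passage w (n + l) (n - l) - passage w (n + k) (n - k)\<bar> \<le> e / s" and "0 \<le> e"
  shows "\<bar>pp_grid w n l - pp_grid w n k\<bar> \<le> e"
proof -
  define d where "d = 2 powr (4/3) * real n powr (1/3)"
  have s0: "0 < s" and ns: "real n powr (1/3) = 1 / s"
    using \<open>0 < n\<close> by (simp_all add: s powr_minus_divide)
  have two: "1 \<le> (2 :: real) powr (4/3)"
    by (rule ge_one_powr_ge_zero) simp_all
  have d: "1 / s \<le> d" "0 < d"
    using mult_right_mono[OF two, of "1 / s"] s0 unfolding d_def ns by simp_all
  have "pp_grid w n l - pp_grid w n k = (passage w (n + l) (n - l) - passage w (n + k) (n - k)) / d"
    using assms by (simp add: pp_grid_def lpp_eq_passage d_def diff_divide_distrib[symmetric])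
  then have "\<bar>pp_grid w n l - pp_grid w n k\<bar> = \<bar>passage w (n + l) (n - l) - passage w (n + k) (n - k)\<bar> / d"
    using d by simp
  also have "\<dots> \<le> e / s / d"
    using d by (intro divide_right_mono le) simp
  also have "\<dots> = e * (1 / s / d)"
    by simp
  also have "\<dots> \<le> e * 1"
  proof (rule mult_left_mono)
    show "1 / s / d \<le> 1"
      using d by (simp only: divide_le_eq_1_pos)
  qed fact
  finally show ?thesis
    by simp
qed

lemma pp_process_tight:
  fixes P :: "nat \<Rightarrow> 'a measure"
  assumes weights: "\<And>N. 1 \<le> N \<Longrightarrow> 0 < diag_param \<delta> N \<Longrightarrow> pp_weights (P N) (diag_param \<delta> N) (w N)"
    and "0 \<le> T" "0 < e" "0 < \<eta>"
  shows "\<exists>h>0. \<forall>\<^sub>F n in sequentially. \<exists>E\<in>sets (P n). measure (P n) E \<le> \<eta> \<and>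
    (\<forall>x\<in>space (P n) - E. \<forall>s\<in>{0..T}. \<forall>t\<in>{0..T}. \<bar>s - t\<bar> \<le> h \<longrightarrow>
      \<bar>pp_process (\<lambda>p. w n p x) n s - pp_process (\<lambda>p. w n p x) n t\<bar> \<le> e)"
proof -
  define \<sigma> where "\<sigma> = \<delta> * 2 powr (- 4/3)"
  \<comment> \<open>The horizon is \<open>2 * T + 1\<close> in units of
    \<open>1 / s\<^sup>2\<close>: the lattice scale \<open>(2 * n) powr (2/3)\<close> is at most
    \<open>2 / s\<^sup>2\<close>, and the extra 1 leaves space for the next node.\<close>
  obtain q where q: "1 \<le> q" and ev: "\<forall>\<^sub>F n in sequentially. let s = real n powr (- 1/3) in
    nat \<lceil>(2 * T + 1) / s\<^sup>2\<rceil> \<le> n \<and> (\<forall>(M :: (nat \<times> nat \<Rightarrow> real) measure) g.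
    prob_space M \<longrightarrow> exponential_weights M 1 1 (2 * n) g \<longrightarrow> (\<forall>p \<omega>. 0 \<le> g p \<omega>) \<longrightarrow>
    measure M {\<omega> \<in> space M. \<exists>k l. k \<le> l \<and> l \<le> k + nat \<lceil>1 / (q * s)\<^sup>2\<rceil> \<and> l \<le> nat \<lceil>(2 * T + 1) / s\<^sup>2\<rceil> \<and>
      e / s < \<bar>pp_scaled (1/2 + \<sigma> * s) g n l \<omega> - pp_scaled (1/2 + \<sigma> * s) g n k \<omega>\<bar>} \<le> \<eta>)"
    using pp_modulus_small[of "2 * T + 1" e \<eta> \<sigma>] assms by auto
  have small: "\<forall>\<^sub>F n in sequentially. real n powr (- 1/3) < 1 / (2 * q)"
    using q by (intro order_tendstoD(2)[OF tendsto_powr_third]) simp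
  \<comment> \<open>With \<open>h = 1 / (4 * q\<^sup>2)\<close>, times at distance \<open>h\<close>
    are at most half a window \<open>1 / (q * s)\<^sup>2\<close> apart on the lattice. The other
    half is at least 2 for small \<open>s\<close> and absorbs the rounding.\<close>
  have "\<forall>\<^sub>F n in sequentially. \<exists>E\<in>sets (P n). measure (P n) E \<le> \<eta> \<and>
    (\<forall>x\<in>space (P n) - E. \<forall>s\<in>{0..T}. \<forall>t\<in>{0..T}. \<bar>s - t\<bar> \<le> 1 / (4 * q\<^sup>2) \<longrightarrow>
      \<bar>pp_process (\<lambda>p. w n p x) n s - pp_process (\<lambda>p. w n p x) n t\<bar> \<le> e)"
    using ev small diag_param_pos[of \<delta>] eventually_gt_at_top[of 0]
  proof eventually_elim
    case (elim n)
    define s where "s = real n powr (- 1/3)"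
    define m K where "m = nat \<lceil>1 / (q * s)\<^sup>2\<rceil>" and "K = nat \<lceil>(2 * T + 1) / s\<^sup>2\<rceil>"
    have s: "0 < s" "s < 1 / (2 * q)"
      using elim by (simp_all add: s_def)
    have r: "diag_param \<delta> n = 1/2 + \<sigma> * s"
      by (simp add: diag_param_def \<sigma>_def s_def)
    have bound: "measure M {\<omega> \<in> space M. \<exists>k l. k \<le> l \<and> l \<le> k + m \<and> l \<le> K \<and>
        e / s < \<bar>pp_scaled (1/2 + \<sigma> * s) g n l \<omega> - pp_scaled (1/2 + \<sigma> * s) g n k \<omega>\<bar>} \<le> \<eta>"
      if "prob_space M" "exponential_weights M 1 1 (2 * n) g" "\<And>p \<omega>. 0 \<le> g p \<omega>"
      for M :: "(nat \<times> nat \<Rightarrow> real) measure" and g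
      using elim(1) that unfolding Let_def s_def[symmetric] m_def[symmetric] K_def[symmetric] by blast
    have Kn: "K \<le> n"
      using elim(1) unfolding Let_def s_def[symmetric] K_def[symmetric] by blast
    have w: "pp_weights (P n) (1/2 + \<sigma> * s) (w n)"
      using weights[of n] elim r by simp
    let ?V = "PiM (sites (2 * n)) (\<lambda>_. borel) :: (nat \<times> nat \<Rightarrow> real) measure"
    let ?H = "\<lambda>v k. passage v (n + k) (n - k)"
    \<comment> \<open>The bad event is written as a measurable set of weight vectors, so that its
      probability depends on the law of the weights alone.\<close>
    define A where "A = {v \<in> space ?V. \<exists>k l. k \<le> l \<and> l \<le> k + m \<and> l \<le> K \<and> e / s < \<bar>?H v l - ?H v k\<bar>}"
    have H_meas: "(\<lambda>v. ?H v k) \<in> borel_measurable ?V" if "k \<le> n" for k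
      using that by (intro passage_measurable[where n = "2 * n" and v = "\<lambda>p v. v p"]) auto
    have "A = (\<Union>l\<in>{..K}. \<Union>k\<in>{k. k \<le> l \<and> l \<le> k + m}. {v \<in> space ?V. e / s < \<bar>?H v l - ?H v k\<bar>})"
      unfolding A_def by blast
    also have "\<dots> \<in> sets ?V"
    proof (intro sets.finite_UN)
      fix l k assume "l \<in> {..K}" "k \<in> {k. k \<le> l \<and> l \<le> k + m}"
      then have [measurable]: "(\<lambda>v. ?H v l) \<in> borel_measurable ?V" "(\<lambda>v. ?H v k) \<in> borel_measurable ?V"
        using Kn by (auto intro!: H_meas)
      show "{v \<in> space ?V. e / s < \<bar>?H v l - ?H v k\<bar>} \<in> sets ?V"
        by measurable
    qed auto
    finally have A: "A \<in> sets ?V" .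
    have H_restrict: "?H (\<lambda>p\<in>sites (2 * n). v p) k = ?H v k" if "k \<le> n" for v k
      using that by (intro passage_cong) (auto simp: sites_def)
    have A_iff: "(\<lambda>p\<in>sites (2 * n). v p) \<in> A \<longleftrightarrow> (\<exists>k l. k \<le> l \<and> l \<le> k + m \<and> l \<le> K \<and> e / s < \<bar>?H v l - ?H v k\<bar>)" for v
    proof -
      have "(\<lambda>p\<in>sites (2 * n). v p) \<in> space ?V"
        by (simp add: space_PiM)
      moreover have "k \<le> l \<and> l \<le> k + m \<and> l \<le> K \<and> e / s < \<bar>?H (\<lambda>p\<in>sites (2 * n). v p) l - ?H (\<lambda>p\<in>sites (2 * n). v p) k\<bar> \<longleftrightarrow>
          k \<le> l \<and> l \<le> k + m \<and> l \<le> K \<and> e / s < \<bar>?H v l - ?H v k\<bar>" for k l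
        using H_restrict[of k v] H_restrict[of l v] Kn by auto
      ultimately show ?thesis
        unfolding A_def by simp
    qed
    define E where "E = {x \<in> space (P n). (\<lambda>p\<in>sites (2 * n). w n p x) \<in> A}"
    have "(\<lambda>x. \<lambda>p\<in>sites (2 * n). w n p x) \<in> measurable (P n) ?V"
      by (intro measurable_restrict pp_weights_measurable[OF w])
    then have "E \<in> sets (P n)"
      unfolding E_def using A by measurable
    moreover have "measure (P n) E \<le> \<eta>"
    proof -
      let ?M = "exponential_product 1 1 (2 * n)" and ?g = "\<lambda>p u. \<bar>u p\<bar> :: real"
      have n: "0 < 2 * n"
        using elim by simp
      have "measure (P n) E = measure ?M {u \<in> space ?M. (\<lambda>p\<in>sites (2 * n). scaled_weights (1 / (1/2 + \<sigma> * s)) 0 ?g p u) \<in> A}"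
        unfolding E_def
        by (rule pp_weights_transfer[OF w _ exponential_model[OF n] n A]) (use elim r in simp)
      also have "\<dots> \<le> \<eta>"
        unfolding A_iff using bound[OF exponential_model[OF n]] by (simp add: pp_scaled_def)
      finally show ?thesis .
    qed
    moreover have "\<bar>pp_process (\<lambda>p. w n p x) n u - pp_process (\<lambda>p. w n p x) n v\<bar> \<le> e"
      if x: "x \<in> space (P n) - E" and uv: "u \<in> {0..T}" "v \<in> {0..T}" "\<bar>u - v\<bar> \<le> 1 / (4 * q\<^sup>2)" for x u v
    proof (rule pp_process_close[OF _ refl])
      fix k l assume kl: "k \<le> l" "l \<le> k + m" "l \<le> K"
      have "\<not> e / s < \<bar>?H (\<lambda>p. w n p x) l - ?H (\<lambda>p. w n p x) k\<bar>"
        using x kl unfolding E_def A_iff by blast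
      then show "\<bar>pp_grid (\<lambda>p. w n p x) n l - pp_grid (\<lambda>p. w n p x) n k\<bar> \<le> e"
        using elim kl Kn \<open>0 < e\<close> by (intro pp_grid_diff_le[OF _ _ _ s_def]) auto
    next
      have c: "(2 * real n) powr (2/3) \<le> 2 / s\<^sup>2"
      proof -
        have "(2 * real n) powr (2/3) = 2 powr (2/3) * real n powr (2/3)"
          by (simp add: powr_mult)
        also have "real n powr (2/3) = 1 / s\<^sup>2"
        proof -
          have "s\<^sup>2 = s powr 2"
            using s powr_realpow[of s 2] by simp
          also have "\<dots> = real n powr (- (2/3))"
            by (simp add: s_def powr_powr)
          finally show ?thesis
            by (simp add: powr_minus_divide)
        qed
        also have "2 powr (2/3) * (1 / s\<^sup>2) \<le> 2 * (1 / s\<^sup>2)"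
        proof (rule mult_right_mono)
          have "(2 :: real) powr (2/3) \<le> 2 powr 1"
            by (intro powr_mono) auto
          then show "(2 :: real) powr (2/3) \<le> 2"
            by simp
        qed simp
        finally show ?thesis
          by simp
      qed
      have ceil: "t \<le> real (nat \<lceil>t\<rceil>)" for t :: real
        by (rule real_nat_ceiling_ge)
      have s1: "s\<^sup>2 \<le> 1"
      proof -
        have "1 / (2 * q) \<le> 1"
          using q by simp
        then show ?thesis
          using s by (intro power_le_one) auto
      qed
      have top: "u * (2 * real n) powr (2/3) + 1 \<le> real K" if "u \<in> {0..T}" for u
      proof -
        have "u * (2 * real n) powr (2/3) \<le> T * (2 / s\<^sup>2)"
          using that c by (intro mult_mono) auto
        moreover have "1 \<le> 1 / s\<^sup>2"
          using s1 s by simp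
        moreover have "(2 * T + 1) / s\<^sup>2 = T * (2 / s\<^sup>2) + 1 / s\<^sup>2"
          by (simp add: add_divide_distrib)
        ultimately have "u * (2 * real n) powr (2/3) + 1 \<le> (2 * T + 1) / s\<^sup>2"
          by linarith
        then show ?thesis
          using ceil[of "(2 * T + 1) / s\<^sup>2"] by (simp add: K_def)
      qed
      show "u * (2 * real n) powr (2/3) + 1 \<le> real K" "v * (2 * real n) powr (2/3) + 1 \<le> real K"
        using top uv by auto
      show "0 \<le> u" "0 \<le> v"
        using uv by auto
      have "\<bar>u - v\<bar> * (2 * real n) powr (2/3) \<le> 1 / (4 * q\<^sup>2) * (2 / s\<^sup>2)"
        using uv c by (intro mult_mono) auto
      also have "\<dots> = 1 / (q * s)\<^sup>2 / 2"
        by (simp add: power_mult_distrib)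
      finally have "\<bar>u - v\<bar> * (2 * real n) powr (2/3) \<le> 1 / (q * s)\<^sup>2 / 2" .
      moreover have "4 \<le> 1 / (q * s)\<^sup>2"
      proof -
        have "q * s \<le> 1/2"
          using s q by (simp add: field_simps)
        then have "(q * s)\<^sup>2 \<le> (1/2)\<^sup>2"
          using q s by (intro power_mono) auto
        then have "4 * (q * s)\<^sup>2 \<le> 1"
          by (simp add: power_divide)
        moreover have "0 < (q * s)\<^sup>2"
          using q s by simp
        ultimately show ?thesis
          by (simp add: le_divide_eq)
      qed
      moreover have "x + 2 \<le> z" if "x \<le> y / 2" "4 \<le> y" "y \<le> z" for x y z :: real
        using that by linarith
      ultimately show "\<bar>u - v\<bar> * (2 * real n) powr (2/3) + 2 \<le> real m"
        using ceil[of "1 / (q * s)\<^sup>2"] unfolding m_def by blast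
    qed
    ultimately show ?case
      by blast
  qed
  moreover have "0 < 1 / (4 * q\<^sup>2)"
    using q by simp
  ultimately show ?thesis
    by blast
qed

text \<open>Finite-dimensional distributions do not determine path regularity, so the limit in
  function space is taken along a modification \<open>B\<close> of \<open>A\<close> on the same
  probability space whose paths are all continuous.\<close>

theorem theorem4p2:
  fixes \<delta> :: real
    and P :: "nat \<Rightarrow> 'a measure"
    and w :: "nat \<Rightarrow> nat \<times> nat \<Rightarrow> 'a \<Rightarrow> real"
    and Q :: "'b measure"
    and A :: "real \<Rightarrow> 'b \<Rightarrow> real"
  assumes weights: "\<And>N. N \<ge> 1 \<Longrightarrow> diag_param \<delta> N > 0 \<Longrightarrow> pp_weights (P N) (diag_param \<delta> N) (w N)"
    and Q: "prob_space Q"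
    and A_meas: "\<And>u. u \<ge> 0 \<Longrightarrow> A u \<in> borel_measurable Q"
    and A_limit: "fdd_converges P (\<lambda>N x. pp_process (\<lambda>p. w N p x) N)
                                Q (\<lambda>y u. A u y - u\<^sup>2)"
  shows "\<exists>B :: real \<Rightarrow> 'b \<Rightarrow> real.
           (\<forall>u\<ge>0. B u \<in> borel_measurable Q \<and> (AE y in Q. B u y = A u y)) \<and>
           (\<forall>y \<in> space Q. continuous_on {0..} (\<lambda>u. B u y)) \<and>
           (\<forall>a b. 0 \<le> a \<and> a \<le> b \<longrightarrow>
              converges_weakly (C_top a b)
                P (\<lambda>N x. restrict (pp_process (\<lambda>p. w N p x) N) {a..b})
                Q (\<lambda>y. restrict (\<lambda>u. B u y - u\<^sup>2) {a..b}))"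
proof -
  interpret tight_fdd P "\<lambda>N x. pp_process (\<lambda>p. w N p x) N" Q "\<lambda>y u. A u y - u\<^sup>2"
  proof
    show "fdd_converges P (\<lambda>N x. pp_process (\<lambda>p. w N p x) N) Q (\<lambda>y u. A u y - u\<^sup>2)"
      by (rule A_limit)
    show "(\<lambda>y. A u y - u\<^sup>2) \<in> borel_measurable Q" if "0 \<le> u" for u
      using A_meas[OF that] by simp
    show "\<forall>\<^sub>F N in sequentially. (\<lambda>x. restrict (pp_process (\<lambda>p. w N p x) N) {a..b}) \<in> P N \<rightarrow>\<^sub>M borel_of (C_top a b)"
      if "0 \<le> a" "a \<le> b" for a b
      using diag_param_pos[of \<delta>] eventually_ge_at_top[of 1]
    proof eventually_elim
      case (elim N)
      then show ?case
        using that by (intro pp_process_measurable[OF weights]) auto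
    qed
  qed (rule pp_process_tight[OF weights])
  define B where "B u y = version u y + u\<^sup>2" for u y
  have "B u \<in> borel_measurable Q" if "0 \<le> u" for u
    using version_measurable[OF that] unfolding B_def[abs_def] by simp
  moreover have "AE y in Q. B u y = A u y" if "0 \<le> u" for u
    using AE_version[OF that] by eventually_elim (simp add: B_def)
  moreover have "continuous_on {0..} (\<lambda>u. B u y)" for y
    unfolding B_def by (intro continuous_intros version_continuous)
  moreover have "converges_weakly (C_top a b) P (\<lambda>N x. restrict (pp_process (\<lambda>p. w N p x) N) {a..b})
      Q (\<lambda>y. restrict (\<lambda>u. B u y - u\<^sup>2) {a..b})" if "0 \<le> a" "a \<le> b" for a b
    using converges_weakly_version[OF that] by (simp add: B_def)
  ultimately show ?thesis
    by (intro exI[of _ B]) blast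
qed

end
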